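(* Let $\tau_1,\tau_2\in\mathbb{R}$, let $f_1,f_2\in\mathscr{P}'$ with $f_1\in\mathscr{P}'^{\tau_1}$ and $f_2\in\mathscr{P}'^{\tau_2}$, and let $\Gamma_1$ and $\Gamma_2$ be cones of $\mathbb{R}^d$ such that $\Gamma_1\cap(-\Gamma_2)=\emptyset$. Assume that the following conditions are fulfilled. a) There exist $C>0$ and $\gamma\geq1$ such that $$\operatorname{card}\{k\in\mathbb{Z}^d: n-k\in\Gamma_1\text{ and }k\in\Gamma_2\}\leq C|n|^{\gamma},\qquad n\in\mathbb{Z}^d.$$ b) Let $(x_0,\xi_0)\in\mathbb{R}^d\times(\mathbb{R}^d\setminus\{\mathbf 0\})$ and let $\psi\in\mathcal{D}(\mathbb{T}_{\eta,x_0})$ with $\eta\in(0,1)$ and $\psi\equiv1$ in $\mathbb{T}_{\varepsilon,x_0}$, $0<\varepsilon<\eta$, be such that $$pr_2\big(WF_{s_1}(f_1\psi)\big)\subset\Gamma_1,\qquad pr_2\big(WF_{s_2}(f_2\psi)\big)\subset\Gamma_2,$$ where $s_1\geq\tau_2$ and $s_2\geq\tau_1$. Then the product $f=(f_1\psi)_{per}(f_2\psi)_{per}$ exists in $\mathcal{D}'(\mathbb{R}^d)$. Moreover, $f\in\mathscr{P}'$.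
   Context: Here $|x|$ is the Euclidean norm, $\langle x\rangle=(1+|x|^2)^{1/2}$, $e_n(x)=e^{2\pi\sqrt{-1}\langle n,x\rangle}$. $\mathscr{P}'$ is the space of distributions on $\mathbb{R}^d$ that are $1$-periodic in each variable; $f=\sum_{n\in\mathbb{Z}^d}f_ne_n\in\mathscr{P}'$ iff $\sum_n|f_n|^2\langle n\rangle^{-2k_0}<+\infty$ for some $k_0\in\mathbb{N}$, and $f\in\mathscr{P}'^{\tau}$ means $\sum_n|f_n|^2\langle n\rangle^{-2\tau}<+\infty$. The product of $\sum_nf_ne_n$ and $\sum_ng_ne_n$ is $\sum_nh_ne_n$ with $h_n=\sum_{j\in\mathbb{Z}^d}f_{n-j}g_j$. $\mathbb{T}_{\eta,x}=\prod_{j=1}^d(x_j-\eta/2,x_j+\eta/2)$ for $0<\eta\leq1$, $\mathcal{D}(U)$ is the space of smooth functions with compact support in the open set $U$, and $\mathcal{D}'$ its dual. For $f\in\mathcal{D}'(\mathbb{R}^d)$ and $\psi\in\mathcal{D}(\mathbb{T}_{\eta,x_0})$, $(f\psi)_{per}$ is the $1$-periodic extension of $f\psi$, i.e. $(f\psi)_{per}=\sum_{k\in\mathbb{Z}^d}a_ke_k$ with $a_k=\langle f,\psi e_{-k}\rangle$. A cone is a subset of $\mathbb{R}^d$ closed under multiplication by positive scalars. For $f\in\mathcal{D}'(\mathbb{R}^d)$, $s\in\mathbb{R}$ and $(x_0,\xi_0)\in\mathbb{R}^d\times(\mathbb{R}^d\setminus\{\mathbf 0\})$, one says $(x_0,\xi_0)\notin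 WF_s(f)$ if there exist an open cone $\Gamma$ around $\xi_0$ and $\psi\in\mathcal{D}(\mathbb{R}^d)$ with $\psi\equiv1$ in a neighborhood of $x_0$ such that $\int_\Gamma|\widehat{\psi f}(\xi)|^2\langle\xi\rangle^{2s}\,d\xi<+\infty$, where $\widehat g(\xi)=\int g(x)e^{-2\pi\sqrt{-1}\langle x,\xi\rangle}dx$. Also $pr_2(x,\xi)=\xi$. *)

theory Defs
  imports "HOL-Analysis.Analysis"
begin

text \<open>The list \<open>is\<close> records the directions of an iterated partial derivative; the head is
  differentiated last.\<close>

fun partial :: "'d list \<Rightarrow> (real^'d \<Rightarrow> complex) \<Rightarrow> real^'d \<Rightarrow> complex" where
  "partial [] \<phi> = \<phi>"
| "partial (i # is) \<phi> = (\<lambda>x. frechet_derivative (partial is \<phi>) (at x) (axis i 1))"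

definition smooth :: "(real^'d \<Rightarrow> complex) \<Rightarrow> bool" where
  "smooth \<phi> \<longleftrightarrow> (\<forall>is x. partial is \<phi> differentiable (at x))"

definition supp :: "(real^'d \<Rightarrow> complex) \<Rightarrow> (real^'d) set" where
  "supp \<phi> = closure {x. \<phi> x \<noteq> 0}"

definition test_functions :: "(real^'d) set \<Rightarrow> (real^'d \<Rightarrow> complex) set" where
  "test_functions U = {\<phi>. smooth \<phi> \<and> compact (supp \<phi>) \<and> supp \<phi> \<subseteq> U}"

text \<open>A distribution is represented by a functional on all functions; only its values on
  \<open>test_functions UNIV\<close> are constrained. Continuity is expressed by the usual seminorm
  estimates on compact sets (lists of length at most \<open>N\<close> run through all partial derivatives
  of order at most \<open>N\<close>, with repetitions that only affect the constant).\<close>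

type_synonym 'd functional = "(real^'d \<Rightarrow> complex) \<Rightarrow> complex"

definition distribution :: "'d::finite functional \<Rightarrow> bool" where
  "distribution f \<longleftrightarrow>
     (\<forall>\<phi>\<in>test_functions UNIV. \<forall>\<theta>\<in>test_functions UNIV. f (\<lambda>x. \<phi> x + \<theta> x) = f \<phi> + f \<theta>) \<and>
     (\<forall>\<phi>\<in>test_functions UNIV. \<forall>c. f (\<lambda>x. c * \<phi> x) = c * f \<phi>) \<and>
     (\<forall>K. compact K \<longrightarrow> (\<exists>C N. \<forall>\<phi>\<in>test_functions UNIV. supp \<phi> \<subseteq> K \<longrightarrow>
        norm (f \<phi>) \<le> C * (\<Sum>is | length is \<le> N. SUP x. norm (partial is \<phi> x))))"

text \<open>If \<open>\<psi>\<close> is a test function and \<open>f\<close> a distribution, then \<open>smult_distr \<psi> f\<close> is the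
  compactly supported distribution \<open>\<psi> f\<close> together with its canonical extension to all
  smooth \<open>\<phi>\<close>, since \<open>\<psi> \<phi>\<close> is again a test function.\<close>

definition smult_distr :: "(real^'d \<Rightarrow> complex) \<Rightarrow> 'd functional \<Rightarrow> 'd functional" where
  "smult_distr \<psi> f = (\<lambda>\<phi>. f (\<lambda>x. \<psi> x * \<phi> x))"

definition expo :: "real^'d::finite \<Rightarrow> real^'d \<Rightarrow> complex" where
  "expo \<xi> x = exp (2 * of_real pi * \<i> * of_real (\<xi> \<bullet> x))"

text \<open>Fourier transform of a compactly supported distribution, as its pairing with the smooth
  function \<open>x \<mapsto> exp (- 2 \<pi> \<i> (\<xi> \<bullet> x))\<close>. It is meaningful for functionals of the form
  \<open>smult_distr \<psi> f\<close> with \<open>\<psi>\<close> a test function, and is only applied to those.\<close>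

definition fourier_distr :: "'d::finite functional \<Rightarrow> real^'d \<Rightarrow> complex" where
  "fourier_distr g \<xi> = g (expo (- \<xi>))"

definition jbracket :: "real^'d::finite \<Rightarrow> real" where
  "jbracket x = sqrt (1 + (norm x)\<^sup>2)"

text \<open>Unlike the library's \<open>cone\<close> and \<open>conic\<close>, only positive scalars are allowed, so a
  nonempty cone need not contain the origin.\<close>

definition pos_cone :: "(real^'d) set \<Rightarrow> bool" where
  "pos_cone \<Gamma> \<longleftrightarrow> (\<forall>x\<in>\<Gamma>. \<forall>c>0. c *\<^sub>R x \<in> \<Gamma>)"

definition WF :: "real \<Rightarrow> 'd::finite functional \<Rightarrow> ((real^'d) \<times> (real^'d)) set" where
  "WF s f = {(x0, \<xi>0). \<xi>0 \<noteq> 0 \<and>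
     \<not> (\<exists>\<Gamma> \<psi>. open \<Gamma> \<and> pos_cone \<Gamma> \<and> \<xi>0 \<in> \<Gamma> \<and>
          \<psi> \<in> test_functions UNIV \<and> (\<forall>\<^sub>F x in nhds x0. \<psi> x = 1) \<and>
          (\<integral>\<^sup>+\<xi>\<in>\<Gamma>. ennreal ((norm (fourier_distr (smult_distr \<psi> f) \<xi>))\<^sup>2
                        * jbracket \<xi> powr (2 * s)) \<partial>lborel) < \<infinity>)}"

definition lattice :: "int^'d \<Rightarrow> real^'d" where
  "lattice n = (\<chi> i. real_of_int (n $ i))"

definition periodic_distributions :: "'d::finite functional set" where
  "periodic_distributions = {f. distribution f \<and>
     (\<forall>\<phi>\<in>test_functions UNIV. \<forall>k. f (\<lambda>x. \<phi> (x + lattice k)) = f \<phi>)}"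

definition fourier_term :: "(int^'d::finite \<Rightarrow> complex) \<Rightarrow> (real^'d \<Rightarrow> complex) \<Rightarrow> int^'d \<Rightarrow> complex" where
  "fourier_term c \<phi> n = c n * (LINT x|lborel. expo (lattice n) x * \<phi> x)"

text \<open>\<open>f = (\<Sum>n. c n * expo (lattice n))\<close> in the sense of distributions.\<close>

definition has_fourier_series :: "'d::finite functional \<Rightarrow> (int^'d \<Rightarrow> complex) \<Rightarrow> bool" where
  "has_fourier_series f c \<longleftrightarrow>
     (\<forall>\<phi>\<in>test_functions UNIV. (fourier_term c \<phi> has_sum f \<phi>) UNIV)"

definition periodic_distributions_order :: "real \<Rightarrow> 'd::finite functional set" where
  "periodic_distributions_order \<tau> = {f \<in> periodic_distributions. \<exists>c. has_fourier_series f c \<and>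
     (\<lambda>n. (norm (c n))\<^sup>2 * jbracket (lattice n) powr (- 2 * \<tau>)) summable_on UNIV}"

definition cube :: "real \<Rightarrow> real^'d \<Rightarrow> (real^'d) set" where
  "cube \<eta> x = {y. \<forall>j. x $ j - \<eta> / 2 < y $ j \<and> y $ j < x $ j + \<eta> / 2}"

text \<open>The periodic extension of \<open>f \<psi>\<close>, for \<open>\<psi>\<close> a test function on a cube of side at most \<open>1\<close>:
  the distribution with Fourier coefficients \<open>f (\<psi> * expo (- lattice k))\<close>.\<close>

definition periodic_extension :: "'d::finite functional \<Rightarrow> (real^'d \<Rightarrow> complex) \<Rightarrow> 'd functional" where
  "periodic_extension f \<psi> =
     (\<lambda>\<phi>. \<Sum>\<^sub>\<infinity>k. fourier_term (\<lambda>k. f (\<lambda>x. \<psi> x * expo (- lattice k) x)) \<phi> k)"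

text \<open>\<open>h\<close> is the product of the periodic distributions \<open>f\<close> and \<open>g\<close>. Existence of the product
  requires that all coefficient sums converge and that the resulting Fourier series converges
  to \<open>h\<close> in the sense of distributions.\<close>

definition is_product :: "'d::finite functional \<Rightarrow> 'd functional \<Rightarrow> 'd functional \<Rightarrow> bool" where
  "is_product f g h \<longleftrightarrow> (\<exists>a b. has_fourier_series f a \<and> has_fourier_series g b \<and>
     (\<forall>n. (\<lambda>j. a (n - j) * b j) summable_on UNIV) \<and>
     has_fourier_series h (\<lambda>n. \<Sum>\<^sub>\<infinity>j. a (n - j) * b j))"

end

theory Submission
  imports Defs
begin

text \<open>
  Let \<open>a k\<close> and \<open>b k\<close> be the Fourier coefficients of the periodic extensions of \<open>f1 \<psi>\<close> and
  \<open>f2 \<psi>\<close>. A Fourier series with coefficients of polynomial growth always is a periodic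
  distribution, because Fourier transforms of test functions decay rapidly
  (\<open>fourier_sum_periodic_distribution\<close>). So everything reduces to one claim about sequences: the
  sums \<open>\<Sum>j. a (n - j) * b j\<close> converge absolutely and grow at most polynomially in \<open>n\<close>.

  Multiplication by \<open>\<psi>\<close> is convolution with a rapidly decreasing sequence, so \<open>a\<close> and \<open>b\<close> inherit the
  global weighted square summability of \<open>f1\<close> and \<open>f2\<close>, with exponents \<open>-\<tau>1\<close> and \<open>-\<tau>2\<close>
  (\<open>localized_coefficients_l2\<close>). The wave front sets give more in some directions: if
  \<open>\<xi> \<noteq> 0\<close> is not in \<open>\<Gamma>1\<close>, then \<open>a\<close> is square summable with the exponent \<open>s1\<close> on an open cone around
  \<open>\<xi>\<close>, and likewise for \<open>b\<close>, \<open>s2\<close> and \<open>\<Gamma>2\<close> (\<open>l2_near_if_not_in_WF\<close>).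

  As \<open>\<Gamma>1\<close> and \<open>- \<Gamma>2\<close> are disjoint, every direction \<open>\<xi> \<noteq> 0\<close> is good for \<open>a\<close>, or \<open>- \<xi>\<close> is good for \<open>b\<close>.
  Compactness of the unit sphere turns this into a set \<open>A\<close> on which \<open>a\<close> is good and a set \<open>B\<close> such
  that \<open>b\<close> is good on \<open>- B\<close>, with complements that meet at a positive angle
  (\<open>microlocal_cover\<close>). A summand \<open>a (n - j) * b j\<close> then is of one of three kinds. If \<open>n - j\<close> is in \<open>A\<close>,
  the exponent \<open>s1\<close> for \<open>a\<close> compensates the exponent \<open>-\<tau>2\<close> for \<open>b\<close>, because \<open>\<tau>2 \<le> s1\<close>, up to a power
  of the size of \<open>n\<close>. If \<open>- j\<close> is in \<open>B\<close>, the same holds with the roles exchanged. In the remaining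
  case the angle forces \<open>j\<close> to be at most a multiple of \<open>n\<close> in size, and any polynomial bound
  suffices (\<open>convolution_poly_bounded\<close>).

  The analytic core is the passage from the integrals in the definition of the wave front set to
  sums over the lattice (\<open>localization\<close>). The finite integral of a nonnegative function over \<open>real^'d\<close> is the integral over the
  unit cube of its sums over translated lattices, hence one of these sums, over \<open>lattice k + t\<close>
  say, is finite. Multiplying the cut-off by \<open>expo t\<close> moves this translate back to the lattice:
  expanding the cut-off in its Fourier series on the unit cube, the wanted coefficients become a
  convolution of the translated ones with a rapidly decreasing sequence. Cut-offs at different points of the support
  of \<open>\<psi>\<close> are glued with the identity \<open>\<psi> = \<psi> * (1 - (\<Prod>y. 1 - \<beta> y))\<close>, where the \<open>\<beta> y\<close> are
  rescaled copies of \<open>\<psi>\<close>.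
\<close>

section \<open>Smooth functions and test functions\<close>

lemma partial_append: "partial (is @ js) \<phi> = partial is (partial js \<phi>)"
  by (induction "is") auto

lemma smooth_differentiable: "smooth \<phi> \<Longrightarrow> \<phi> differentiable (at x)"
  unfolding smooth_def by (drule spec[of _ "[]"]) simp

lemma smooth_partial: "smooth \<phi> \<Longrightarrow> smooth (partial is \<phi>)"
  unfolding smooth_def by (simp add: partial_append[symmetric] del: partial.simps)

text \<open>Smoothness is a coinductive notion: a class of differentiable functions that is closed under
  first partial derivatives consists of smooth functions. This replaces any calculation with
  iterated product rules.\<close>

lemma smooth_coinduct:
  assumes "P \<phi>" and "\<And>\<phi> x. P \<phi> \<Longrightarrow> \<phi> differentiable (at x)"
    and "\<And>\<phi> i. P \<phi> \<Longrightarrow> P (partial [i] \<phi>)"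
  shows "smooth \<phi>"
proof -
  have "P (partial is \<phi>)" for "is"
  proof (induction "is")
    case (Cons i "is")
    then show ?case using assms(3)[of "partial is \<phi>" i] partial_append[of "[i]" "is" \<phi>] by simp
  qed (use assms in simp)
  then show ?thesis unfolding smooth_def using assms(2) by blast
qed

lemma partial_eqI:
  assumes "\<And>x. (\<phi> has_derivative D x) (at x)"
  shows "partial [i] \<phi> = (\<lambda>x. D x (axis i 1))"
proof -
  have "frechet_derivative \<phi> (at x) = D x" for x
    by (rule frechet_derivative_at[symmetric, OF assms])
  then show ?thesis by simp
qed

lemma has_derivative_frechet:
  "smooth \<phi> \<Longrightarrow> (\<phi> has_derivative frechet_derivative \<phi> (at x)) (at x)"
  using smooth_differentiable frechet_derivative_works by blast

lemma has_derivative_expo: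
  "(expo \<xi> has_derivative (\<lambda>v. expo \<xi> x * (2 * of_real pi * \<i> * of_real (\<xi> \<bullet> v)))) (at x)"
proof -
  have "((\<lambda>x. 2 * of_real pi * \<i> * complex_of_real (\<xi> \<bullet> x)) has_derivative
      (\<lambda>v. 2 * of_real pi * \<i> * of_real (\<xi> \<bullet> v))) (at x)"
    by (intro has_derivative_mult_right has_derivative_of_real has_derivative_inner_right
        has_derivative_ident)
  then show ?thesis unfolding expo_def
    by (rule has_derivative_compose[OF _ DERIV_exp[unfolded has_field_derivative_def]])
qed

text \<open>All the smooth functions that the proof builds lie in this class. It is closed under partial derivatives by
  inspection of the five rules, which is what \<open>smooth_coinduct\<close> needs; smooth functions
  themselves enter through affine substitutions.\<close>

inductive smooth_alg :: "(real^'d::finite \<Rightarrow> complex) \<Rightarrow> bool" where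
  affine: "smooth \<phi> \<Longrightarrow> smooth_alg (\<lambda>x. \<phi> (a + r *\<^sub>R x))"
| expo: "smooth_alg (expo \<xi>)"
| const: "smooth_alg (\<lambda>_. c)"
| add: "smooth_alg \<phi> \<Longrightarrow> smooth_alg \<theta> \<Longrightarrow> smooth_alg (\<lambda>x. \<phi> x + \<theta> x)"
| mult: "smooth_alg \<phi> \<Longrightarrow> smooth_alg \<theta> \<Longrightarrow> smooth_alg (\<lambda>x. \<phi> x * \<theta> x)"

lemma smooth_alg_derivative:
  assumes "smooth_alg \<phi>"
  shows "(\<forall>x. \<phi> differentiable (at x)) \<and> (\<forall>i. smooth_alg (partial [i] \<phi>))"
  using assms
proof induction
  case (affine \<phi> a r)
  have D: "((\<lambda>x. \<phi> (a + r *\<^sub>R x)) has_derivative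
      (\<lambda>v. frechet_derivative \<phi> (at (a + r *\<^sub>R x)) (r *\<^sub>R v))) (at x)" for x
    by (rule has_derivative_eq_rhs,
        rule has_derivative_compose[OF _ has_derivative_frechet[OF affine]],
        (rule derivative_intros)+) auto
  have "partial [i] (\<lambda>x. \<phi> (a + r *\<^sub>R x)) = (\<lambda>x. of_real r * partial [i] \<phi> (a + r *\<^sub>R x))" for i
    by (subst partial_eqI[OF D], unfold partial.simps, rule ext, subst linear_cmul[OF linear_frechet_derivative[OF smooth_differentiable[OF affine]]])
      (rule scaleR_conv_of_real)
  moreover have "smooth_alg (\<lambda>x. of_real r * partial [i] \<phi> (a + r *\<^sub>R x))" for i
    by (intro smooth_alg.intros smooth_partial affine)
  ultimately show ?case by (simp add: differentiableI[OF D] del: partial.simps)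
next
  case (expo \<xi>)
  have "partial [i] (expo \<xi>) = (\<lambda>x. expo \<xi> x * (2 * of_real pi * \<i> * of_real (\<xi> \<bullet> axis i 1)))" for i
    by (rule partial_eqI[OF has_derivative_expo])
  moreover have "smooth_alg (\<lambda>x. expo \<xi> x * (2 * of_real pi * \<i> * of_real (\<xi> \<bullet> axis i 1)))" for i
    by (intro smooth_alg.intros)
  ultimately show ?case by (simp add: differentiableI[OF has_derivative_expo] del: partial.simps)
next
  case (const c)
  have D: "((\<lambda>_. c) has_derivative (\<lambda>_. 0)) (at x)" for x :: "real^'d"
    by simp
  show ?case unfolding partial_eqI[OF D] by (auto intro: smooth_alg.const)
next
  case (add \<phi> \<theta>)
  have D: "((\<lambda>x. \<phi> x + \<theta> x) has_derivative (\<lambda>v. frechet_derivative \<phi> (at x) v + frechet_derivative \<theta> (at x) v)) (at x)" for x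
    using add by (intro has_derivative_add) (auto simp: frechet_derivative_works)
  have "partial [i] (\<lambda>x. \<phi> x + \<theta> x) = (\<lambda>x. partial [i] \<phi> x + partial [i] \<theta> x)" for i
    unfolding partial_eqI[OF D] by simp
  then show ?case using add by (simp add: differentiableI[OF D] smooth_alg.add del: partial.simps)
next
  case (mult \<phi> \<theta>)
  have D: "((\<lambda>x. \<phi> x * \<theta> x) has_derivative
      (\<lambda>v. \<phi> x * frechet_derivative \<theta> (at x) v + frechet_derivative \<phi> (at x) v * \<theta> x)) (at x)" for x
    using mult by (intro has_derivative_mult) (auto simp: frechet_derivative_works)
  have "partial [i] (\<lambda>x. \<phi> x * \<theta> x) = (\<lambda>x. \<phi> x * partial [i] \<theta> x + partial [i] \<phi> x * \<theta> x)" for i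
    unfolding partial_eqI[OF D] by simp
  moreover have "smooth_alg (\<lambda>x. \<phi> x * partial [i] \<theta> x + partial [i] \<phi> x * \<theta> x)" for i
    using mult by (intro smooth_alg.add smooth_alg.mult) auto
  ultimately show ?case by (simp add: differentiableI[OF D] del: partial.simps)
qed

lemma smooth_alg_smooth: "smooth_alg \<phi> \<Longrightarrow> smooth \<phi>"
  by (erule smooth_coinduct[of smooth_alg])
    (blast dest: smooth_alg_derivative)+

lemma smooth_imp_alg: "smooth \<phi> \<Longrightarrow> smooth_alg \<phi>"
  using smooth_alg.affine[of \<phi> 0 1] by simp

lemma smooth_expo: "smooth (expo \<xi>)"
  by (rule smooth_alg_smooth[OF smooth_alg.expo])

lemma smooth_const: "smooth (\<lambda>_. c)"
  by (rule smooth_alg_smooth[OF smooth_alg.const])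

lemma smooth_add: "smooth \<phi> \<Longrightarrow> smooth \<theta> \<Longrightarrow> smooth (\<lambda>x. \<phi> x + \<theta> x)"
  by (rule smooth_alg_smooth[OF smooth_alg.add[OF smooth_imp_alg smooth_imp_alg]])

lemma smooth_mult: "smooth \<phi> \<Longrightarrow> smooth \<theta> \<Longrightarrow> smooth (\<lambda>x. \<phi> x * \<theta> x)"
  by (rule smooth_alg_smooth[OF smooth_alg.mult[OF smooth_imp_alg smooth_imp_alg]])

lemma smooth_affine: "smooth \<phi> \<Longrightarrow> smooth (\<lambda>x. \<phi> (a + r *\<^sub>R x))"
  by (rule smooth_alg_smooth[OF smooth_alg.affine])

lemma smooth_diff: "smooth \<phi> \<Longrightarrow> smooth \<theta> \<Longrightarrow> smooth (\<lambda>x. \<phi> x - \<theta> x)"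
  using smooth_add[of \<phi> "\<lambda>x. (-1) * \<theta> x"] smooth_mult[OF smooth_const[of "-1"], of \<theta>] by simp

lemma smooth_prod:
  "(\<And>i. i \<in> I \<Longrightarrow> smooth (\<phi> i)) \<Longrightarrow> smooth (\<lambda>x. \<Prod>i\<in>I. \<phi> i x)"
proof (induction I rule: infinite_finite_induct)
  case (insert i I)
  have "smooth (\<lambda>x. \<phi> i x * (\<Prod>i\<in>I. \<phi> i x))" using insert by (intro smooth_mult) auto
  then show ?case using insert by simp
qed (simp_all add: smooth_const)

lemma smooth_continuous: "smooth \<phi> \<Longrightarrow> continuous_on S \<phi>"
  by (intro continuous_at_imp_continuous_on ballI differentiable_imp_continuous_within
      smooth_differentiable)

lemma partial_mult_expo:
  assumes "smooth \<phi>"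
  shows "partial [i] (\<lambda>x. expo \<xi> x * \<phi> x) =
    (\<lambda>x. expo \<xi> x * (2 * of_real pi * \<i> * of_real (\<xi> $ i) * \<phi> x + partial [i] \<phi> x))"
proof -
  have D: "((\<lambda>x. expo \<xi> x * \<phi> x) has_derivative
      (\<lambda>v. expo \<xi> x * frechet_derivative \<phi> (at x) v
           + expo \<xi> x * (2 * of_real pi * \<i> * of_real (\<xi> \<bullet> v)) * \<phi> x)) (at x)" for x
    by (intro has_derivative_mult has_derivative_expo has_derivative_frechet assms)
  show ?thesis unfolding partial_eqI[OF D]
    by (auto simp: inner_axis algebra_simps)
qed

lemma support_subset_supp: "\<phi> x \<noteq> 0 \<Longrightarrow> x \<in> supp \<phi>"
  unfolding supp_def by (rule closure_subset[THEN subsetD]) simp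

lemma supp_mono: "(\<And>x. \<phi> x \<noteq> 0 \<Longrightarrow> \<theta> x \<noteq> 0) \<Longrightarrow> supp \<phi> \<subseteq> supp \<theta>"
  unfolding supp_def by (rule closure_mono) blast

lemma partial_zero_off_supp:
  assumes "x \<notin> supp \<phi>" shows "partial is \<phi> x = 0"
proof -
  have o: "open (- supp \<phi>)" unfolding supp_def by (simp add: open_Compl)
  have "partial is \<phi> y = 0" if "y \<in> - supp \<phi>" for y
    using that
  proof (induction "is" arbitrary: y)
    case Nil
    then show ?case using support_subset_supp[of \<phi> y] unfolding partial.simps(1) by blast
  next
    case (Cons i "is")
    have "((\<lambda>_. 0) has_derivative (\<lambda>_. 0)) (at y)" by (rule has_derivative_const)
    then have "(partial is \<phi> has_derivative (\<lambda>_. 0)) (at y)"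
      by (rule has_derivative_transform_within_open[OF _ o Cons.prems]) (rule Cons.IH[symmetric])
    then have "frechet_derivative (partial is \<phi>) (at y) = (\<lambda>_. 0)"
      by (rule frechet_derivative_at[symmetric])
    then show ?case unfolding partial.simps by (rule fun_cong)
  qed
  then show ?thesis using assms by blast
qed

lemma supp_partial: "supp (partial is \<phi>) \<subseteq> supp \<phi>"
  unfolding supp_def[of "partial is \<phi>"]
proof (rule closure_minimal)
  show "{x. partial is \<phi> x \<noteq> 0} \<subseteq> supp \<phi>" using partial_zero_off_supp by blast
qed (simp add: supp_def)

lemma test_functionsD:
  assumes "\<phi> \<in> test_functions U"
  shows "smooth \<phi>" "compact (supp \<phi>)" "supp \<phi> \<subseteq> U"
  using assms unfolding test_functions_def by auto

lemma test_functions_UNIV: "\<phi> \<in> test_functions U \<Longrightarrow> \<phi> \<in> test_functions UNIV"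
  unfolding test_functions_def by auto

lemma test_functionsI:
  assumes "smooth \<theta>" "\<phi> \<in> test_functions U" "\<And>x. \<theta> x \<noteq> 0 \<Longrightarrow> \<phi> x \<noteq> 0"
  shows "\<theta> \<in> test_functions U"
proof -
  have "supp \<theta> \<subseteq> supp \<phi>" by (rule supp_mono[OF assms(3)])
  moreover have "closed (supp \<theta>)" unfolding supp_def by simp
  ultimately have "compact (supp \<theta>)"
    using test_functionsD(2)[OF assms(2)] by (metis compact_Int_closed inf.absorb2)
  with \<open>supp \<theta> \<subseteq> supp \<phi>\<close> show ?thesis using assms(1) test_functionsD(3)[OF assms(2)]
    unfolding test_functions_def by blast
qed

lemma test_functions_mult:
  assumes "smooth \<theta>" "\<phi> \<in> test_functions U"
  shows "(\<lambda>x. \<theta> x * \<phi> x) \<in> test_functions U"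
proof (rule test_functionsI)
  show "smooth (\<lambda>x. \<theta> x * \<phi> x)" by (rule smooth_mult[OF assms(1) test_functionsD(1)[OF assms(2)]])
  show "\<phi> \<in> test_functions U" by fact
  show "\<phi> x \<noteq> 0" if "\<theta> x * \<phi> x \<noteq> 0" for x using that by force
qed

lemma test_functions_mult':
  assumes "smooth \<theta>" "\<phi> \<in> test_functions U"
  shows "(\<lambda>x. \<phi> x * \<theta> x) \<in> test_functions U"
  using test_functions_mult[OF assms] by (simp only: mult.commute)

lemma test_functions_partial: "\<phi> \<in> test_functions U \<Longrightarrow> partial is \<phi> \<in> test_functions U"
proof -
  assume a: "\<phi> \<in> test_functions U"
  have "closed (supp (partial is \<phi>))" unfolding supp_def by simp
  then have "compact (supp (partial is \<phi>))"
    using supp_partial[of "is" \<phi>] test_functionsD(2)[OF a] by (metis compact_Int_closed inf.absorb2)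
  then show ?thesis using supp_partial[of "is" \<phi>] test_functionsD(3)[OF a]
      smooth_partial[OF test_functionsD(1)[OF a], of "is"]
    unfolding test_functions_def by blast
qed

lemma test_functions_bounded:
  assumes "\<phi> \<in> test_functions UNIV"
  shows "bdd_above (range (\<lambda>x. norm (\<phi> x)))"
proof -
  have "compact ((\<lambda>x. norm (\<phi> x)) ` supp \<phi>)"
    by (intro compact_continuous_image continuous_on_norm smooth_continuous test_functionsD(1,2)[OF assms])
  then have "bdd_above ((\<lambda>x. norm (\<phi> x)) ` supp \<phi>)"
    by (intro bounded_imp_bdd_above compact_imp_bounded)
  then obtain B where B: "\<And>x. x \<in> supp \<phi> \<Longrightarrow> norm (\<phi> x) \<le> B"
    by (auto simp: bdd_above_def)
  have "norm (\<phi> x) \<le> max B 0" for x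
    using B[of x] support_subset_supp[of \<phi> x] by (cases "\<phi> x = 0") (simp_all add: max.coboundedI1)
  then show ?thesis by (auto simp: bdd_above_def)
qed

section \<open>Fourier transforms of test functions\<close>

text \<open>The sign is that of \<^const>\<open>fourier_term\<close>, so that a Fourier series \<open>c\<close> pairs with a test function \<open>\<phi>\<close> to
  \<open>\<Sum>n. c n * ft \<phi> (lattice n)\<close>.\<close>

definition ft :: "(real^'d::finite \<Rightarrow> complex) \<Rightarrow> real^'d \<Rightarrow> complex" where
  "ft \<phi> \<xi> = (LINT x|lborel. expo \<xi> x * \<phi> x)"

lemma fourier_term_ft: "fourier_term c \<phi> n = c n * ft \<phi> (lattice n)"
  unfolding fourier_term_def ft_def ..

lemma expo_add: "expo (\<xi> + \<zeta>) x = expo \<xi> x * expo \<zeta> x"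
  unfolding expo_def by (simp add: inner_add_left exp_add[symmetric] algebra_simps)

lemma expo_add_right: "expo \<xi> (x + y) = expo \<xi> x * expo \<xi> y"
  unfolding expo_def by (simp add: inner_add_right exp_add[symmetric] algebra_simps)

lemma expo_0 [simp]: "expo 0 x = 1" "expo \<xi> 0 = 1"
  unfolding expo_def by simp_all

lemma expo_eq_cis: "expo \<xi> x = cis (2 * pi * (\<xi> \<bullet> x))"
  unfolding expo_def cis_conv_exp by (simp add: algebra_simps)

lemma norm_expo [simp]: "norm (expo \<xi> x) = 1"
  by (simp add: expo_eq_cis)

lemma lattice_inner: "lattice n \<bullet> lattice m \<in> \<int>"
  unfolding lattice_def inner_vec_def by (auto intro!: Ints_sum)

lemma expo_lattice [simp]: "expo (lattice n) (lattice m) = 1"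
proof -
  obtain k where "lattice n \<bullet> lattice m = of_int k" using lattice_inner Ints_cases by metis
  then show ?thesis unfolding expo_eq_cis by (simp del: mult.assoc)
qed

lemma lattice_add: "lattice (n + m) = lattice n + lattice m"
  and lattice_diff: "lattice (n - m) = lattice n - lattice m"
  and lattice_minus: "lattice (- n) = - lattice n"
  and lattice_0 [simp]: "lattice 0 = 0"
  unfolding lattice_def by (auto simp: vec_eq_iff)

lemma continuous_expo: "continuous_on S (expo \<xi>)"
  using smooth_continuous[OF smooth_expo] .

lemma measurable_expo [measurable]: "expo \<xi> \<in> borel_measurable borel"
  by (intro borel_measurable_continuous_onI continuous_expo)

lemma test_continuous: "\<phi> \<in> test_functions U \<Longrightarrow> continuous_on S \<phi>"
  by (rule smooth_continuous[OF test_functionsD(1)])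

lemma test_measurable: "\<phi> \<in> test_functions U \<Longrightarrow> \<phi> \<in> borel_measurable borel"
  by (intro borel_measurable_continuous_onI test_continuous)

lemma test_integrable:
  assumes "\<phi> \<in> test_functions U" shows "integrable lborel \<phi>"
proof -
  have "integrable lborel (\<lambda>x. indicator (supp \<phi>) x *\<^sub>R \<phi> x)"
    by (intro borel_integrable_compact test_functionsD(2)[OF assms] test_continuous[OF assms])
  moreover have "(\<lambda>x. indicator (supp \<phi>) x *\<^sub>R \<phi> x) = \<phi>"
    using support_subset_supp[of \<phi>] by (auto simp: fun_eq_iff indicator_def)
  ultimately show ?thesis by simp
qed

lemma test_expo: "\<phi> \<in> test_functions U \<Longrightarrow> (\<lambda>x. expo \<xi> x * \<phi> x) \<in> test_functions U"
  by (rule test_functions_mult[OF smooth_expo])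

lemma lborel_integral_shift:
  fixes f :: "'a::euclidean_space \<Rightarrow> 'b::{banach, second_countable_topology}"
  assumes [measurable]: "f \<in> borel_measurable borel"
  shows "(LINT x|lborel. f (x + a)) = (LINT x|lborel. f x)"
proof -
  have "(LINT x|lborel. f x) = (LINT x|distr lborel borel ((+) a). f x)"
    by (simp add: lborel_distr_plus)
  also have "\<dots> = (LINT x|lborel. f (a + x))" by (rule integral_distr) auto
  finally show ?thesis by (simp add: add.commute)
qed

lemma integrable_shift:
  fixes f :: "'a::euclidean_space \<Rightarrow> 'b::{banach, second_countable_topology}"
  assumes "integrable lborel f"
  shows "integrable lborel (\<lambda>x. f (x + a))"
proof -
  have [measurable]: "f \<in> borel_measurable borel" using assms by auto
  have "integrable (distr lborel borel ((+) a)) f" using assms by (simp add: lborel_distr_plus)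
  then have "integrable lborel (\<lambda>x. f (a + x))" by (subst (asm) integrable_distr_eq) auto
  then show ?thesis by (simp add: add.commute)
qed

text \<open>Mean value inequality along a coordinate line; it provides the domination for the difference
  quotients below.\<close>

lemma smooth_directional_bound:
  assumes "smooth \<phi>" and B: "\<And>x. norm (partial [i] \<phi> x) \<le> B" and "h \<ge> 0"
  shows "norm (\<phi> (x + h *\<^sub>R axis i 1) - \<phi> x) \<le> B * h"
proof -
  let ?g = "\<lambda>s. \<phi> (x + s *\<^sub>R axis i 1)"
  have D: "(?g has_derivative (\<lambda>t. t *\<^sub>R partial [i] \<phi> (x + s *\<^sub>R axis i 1))) (at s within {0..h})" for s
  proof -
    have 1: "((\<lambda>s. x + s *\<^sub>R axis i 1) has_derivative (\<lambda>t. t *\<^sub>R axis i 1)) (at s)"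
      by (auto intro!: derivative_eq_intros)
    have "(?g has_derivative (\<lambda>t. frechet_derivative \<phi> (at (x + s *\<^sub>R axis i 1)) (t *\<^sub>R axis i 1))) (at s)"
      by (rule has_derivative_compose[OF 1 has_derivative_frechet[OF assms(1)]])
    then have "(?g has_derivative (\<lambda>t. t *\<^sub>R partial [i] \<phi> (x + s *\<^sub>R axis i 1))) (at s)"
      by (simp add: linear_cmul[OF linear_frechet_derivative[OF smooth_differentiable[OF assms(1)]]])
    then show ?thesis by (rule has_derivative_at_withinI)
  qed
  have "norm (?g h - ?g 0) \<le> B * norm (h - 0)"
  proof (rule differentiable_bound[OF _ D])
    show "onorm (\<lambda>t. t *\<^sub>R partial [i] \<phi> (x + s *\<^sub>R axis i 1)) \<le> B" for s
      by (rule onorm_le) (use mult_right_mono[OF B abs_ge_zero] in \<open>simp add: mult.commute\<close>)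
  qed (use \<open>h \<ge> 0\<close> in auto)
  then show ?thesis using \<open>h \<ge> 0\<close> by simp
qed

lemma test_norm_le_SUP:
  assumes "\<phi> \<in> test_functions U" shows "norm (\<phi> x) \<le> (SUP x. norm (\<phi> x))"
  by (rule cSUP_upper[OF UNIV_I test_functions_bounded[OF test_functions_UNIV[OF assms]]])

text \<open>A partial derivative is a limit of difference quotients, and these have integral \<open>0\<close> because the
  Lebesgue measure is translation invariant. The quotients are dominated by the supremum of the
  derivative on a compact neighbourhood of the support.\<close>

lemma integral_partial_eq_0:
  fixes \<phi> :: "real^'d::finite \<Rightarrow> complex"
  assumes "\<phi> \<in> test_functions U"
  shows "(LINT x|lborel. partial [i] \<phi> x) = 0"
proof -
  define h where "h n = inverse (real (Suc n))" for n
  have h: "h n > 0" "h n \<le> 1" for n unfolding h_def by (auto simp: field_simps)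
  have h0: "h \<longlonglongrightarrow> 0" unfolding h_def by (rule LIMSEQ_inverse_real_of_nat)
  define q where "q n x = (\<phi> (x + h n *\<^sub>R axis i 1) - \<phi> x) /\<^sub>R h n" for n x
  define B where "B = (SUP x. norm (partial [i] \<phi> x))"
  have B: "norm (partial [i] \<phi> x) \<le> B" for x
    unfolding B_def by (rule test_norm_le_SUP[OF test_functions_partial[OF assms]])
  have B0: "B \<ge> 0" using B[of 0] norm_ge_zero[of "partial [i] \<phi> 0"] by linarith
  note sm = test_functionsD(1)[OF assms]
  have [measurable]: "\<phi> \<in> borel_measurable borel" by (rule test_measurable[OF assms])
  define K where "K = {x + y |x y. x \<in> supp \<phi> \<and> y \<in> cball (0::real^'d) 1}"
  have memK: "x \<in> K" if "x + y \<in> supp \<phi>" "norm y \<le> 1" for x y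
  proof -
    have "x = (x + y) + (- y)" "- y \<in> cball 0 1" using that by simp_all
    then show ?thesis unfolding K_def using that(1) by blast
  qed
  have K: "compact K" unfolding K_def by (rule compact_sums[OF test_functionsD(2)[OF assms] compact_cball])
  have qK: "norm (q n x) \<le> B * indicator K x" for n x
  proof (cases "x \<in> K")
    case True
    have "norm (q n x) = norm (\<phi> (x + h n *\<^sub>R axis i 1) - \<phi> x) / h n"
      unfolding q_def using h(1)[of n] by (simp add: divide_inverse_commute)
    also have "\<dots> \<le> B"
      using smooth_directional_bound[OF sm B less_imp_le[OF h(1)[of n]], of x] h(1)[of n]
      by (simp add: field_simps)
    finally show ?thesis using True by simp
  next
    case False
    have "x \<notin> supp \<phi>" using False memK[of x 0] by auto
    moreover have "x + h n *\<^sub>R axis i 1 \<notin> supp \<phi>"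
      using False memK[of x "h n *\<^sub>R axis i 1"] h[of n] by auto
    ultimately have "\<phi> x = 0" "\<phi> (x + h n *\<^sub>R axis i 1) = 0"
      using support_subset_supp[of \<phi> x] support_subset_supp[of \<phi> "x + h n *\<^sub>R axis i 1"] by blast+
    then have "q n x = 0" unfolding q_def by simp
    then show ?thesis using B0 by simp
  qed
  have lim: "(\<lambda>n. q n x) \<longlonglongrightarrow> partial [i] \<phi> x" for x
  proof -
    let ?D = "frechet_derivative \<phi> (at x)"
    have "((\<lambda>v. norm (\<phi> (x + v) - \<phi> x - ?D v) / norm v) \<longlongrightarrow> 0) (at 0)"
      using has_derivative_frechet[OF sm, of x] unfolding has_derivative_at by simp
    moreover have "filterlim (\<lambda>n. h n *\<^sub>R axis i 1 :: real^'d) (at 0) sequentially"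
    proof (rule filterlim_atI)
      show "(\<lambda>n. h n *\<^sub>R axis i 1 :: real^'d) \<longlonglongrightarrow> 0"
        using tendsto_scaleR[OF h0 tendsto_const[of "axis i 1 :: real^'d"]] by simp
      have "h n *\<^sub>R axis i 1 \<noteq> (0 :: real^'d)" for n
        using h(1)[of n] by (simp add: axis_eq_0_iff)
      then show "\<forall>\<^sub>F n in sequentially. h n *\<^sub>R axis i 1 \<noteq> (0 :: real^'d)" by simp
    qed
    ultimately have "(\<lambda>n. norm (\<phi> (x + h n *\<^sub>R axis i 1) - \<phi> x - ?D (h n *\<^sub>R axis i 1)) / norm (h n *\<^sub>R axis i 1 :: real^'d)) \<longlonglongrightarrow> 0"
      by (rule filterlim_compose)
    moreover have "norm (\<phi> (x + h n *\<^sub>R axis i 1) - \<phi> x - ?D (h n *\<^sub>R axis i 1)) / norm (h n *\<^sub>R axis i 1 :: real^'d)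
        = norm (q n x - partial [i] \<phi> x)" for n
    proof -
      have "q n x - partial [i] \<phi> x = (\<phi> (x + h n *\<^sub>R axis i 1) - \<phi> x - ?D (h n *\<^sub>R axis i 1)) /\<^sub>R h n"
        unfolding q_def using h(1)[of n]
        by (simp add: linear_cmul[OF linear_frechet_derivative[OF smooth_differentiable[OF sm]]]
            scaleR_diff_right)
      then show ?thesis using h(1)[of n] by (simp add: divide_inverse_commute)
    qed
    ultimately have "(\<lambda>n. norm (q n x - partial [i] \<phi> x)) \<longlonglongrightarrow> 0" by simp
    then show ?thesis by (rule LIM_zero_cancel[OF tendsto_norm_zero_cancel])
  qed
  have "(\<lambda>n. LINT x|lborel. q n x) \<longlonglongrightarrow> (LINT x|lborel. partial [i] \<phi> x)"
  proof (rule integral_dominated_convergence[where w = "\<lambda>x. B * indicator K x"])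
    show "integrable lborel (\<lambda>x. B * indicator K x)"
      using K by (intro integrable_mult_right integrable_real_indicator emeasure_compact_finite) (simp_all add: borel_compact)
    show "partial [i] \<phi> \<in> borel_measurable lborel"
      using test_measurable[OF test_functions_partial[OF assms, of "[i]"]] by simp
    show "q n \<in> borel_measurable lborel" for n unfolding q_def by measurable
  qed (use lim qK in auto)
  moreover have "(LINT x|lborel. q n x) = 0" for n
  proof -
    note I = test_integrable[OF assms]
    have "(LINT x|lborel. q n x) = ((LINT x|lborel. \<phi> (x + h n *\<^sub>R axis i 1)) - (LINT x|lborel. \<phi> x)) /\<^sub>R h n"
      unfolding q_def using I integrable_shift[OF I]
      by (subst integral_scaleR_right) (auto simp: Bochner_Integration.integral_diff)
    then show ?thesis by (simp add: lborel_integral_shift)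
  qed
  ultimately show ?thesis using LIMSEQ_unique[OF _ tendsto_const[of 0]] by simp
qed

lemma ft_partial:
  assumes "\<phi> \<in> test_functions U"
  shows "ft (partial [i] \<phi>) \<xi> = - (2 * of_real pi * \<i> * of_real (\<xi> $ i)) * ft \<phi> \<xi>"
proof -
  have "0 = (LINT x|lborel. partial [i] (\<lambda>x. expo \<xi> x * \<phi> x) x)"
    by (rule integral_partial_eq_0[symmetric, OF test_expo[OF assms]])
  also have "\<dots> = (LINT x|lborel. (2 * of_real pi * \<i> * of_real (\<xi> $ i)) * (expo \<xi> x * \<phi> x)
       + expo \<xi> x * partial [i] \<phi> x)"
    unfolding partial_mult_expo[OF test_functionsD(1)[OF assms]] by (simp add: algebra_simps)
  also have "\<dots> = (2 * of_real pi * \<i> * of_real (\<xi> $ i)) * ft \<phi> \<xi> + ft (partial [i] \<phi>) \<xi>"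
    unfolding ft_def
    using Bochner_Integration.integral_add[OF integrable_mult_right[OF test_integrable[OF test_expo[OF assms]],
        of "2 * of_real pi * \<i> * of_real (\<xi> $ i)"]
       test_integrable[OF test_expo[OF test_functions_partial[OF assms, of "[i]"]]], of \<xi> \<xi>]
    by (simp del: partial.simps)
  finally show ?thesis by (simp add: eq_neg_iff_add_eq_0 add.commute)
qed

lemma ft_partial_replicate:
  assumes "\<phi> \<in> test_functions U"
  shows "ft (partial (replicate n i) \<phi>) \<xi> = (- (2 * of_real pi * \<i> * of_real (\<xi> $ i))) ^ n * ft \<phi> \<xi>"
proof (induction n)
  case (Suc n)
  have "partial (replicate (Suc n) i) \<phi> = partial [i] (partial (replicate n i) \<phi>)" by simp
  then show ?case using ft_partial[OF test_functions_partial[OF assms], of i "replicate n i" \<xi>] Suc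
    by (simp del: partial.simps)
qed simp

lemma norm_ft_le: "norm (ft \<phi> \<xi>) \<le> (LINT x|lborel. norm (\<phi> x))"
proof -
  have "norm (ft \<phi> \<xi>) \<le> (LINT x|lborel. norm (expo \<xi> x * \<phi> x))"
    unfolding ft_def by (rule integral_norm_bound)
  then show ?thesis by (simp add: norm_mult)
qed

text \<open>Pure derivatives \<open>partial (replicate n i)\<close> suffice for the decay of Fourier transforms, because the
  coordinate of largest modulus controls the whole norm.\<close>

lemma power_weight_le:
  fixes \<xi> :: "real^'d::finite"
  shows "(1 + (norm \<xi>)\<^sup>2) ^ N \<le> (real CARD('d) + 1) ^ N * (1 + (\<Sum>i\<in>UNIV. \<bar>\<xi> $ i\<bar> ^ (2 * N)))"
proof -
  obtain j where j: "\<And>i. \<bar>\<xi> $ i\<bar> \<le> \<bar>\<xi> $ j\<bar>"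
    using ex_is_arg_min_if_finite[of "UNIV :: 'd set" "\<lambda>i. - \<bar>\<xi> $ i\<bar>"]
    by (auto simp: is_arg_min_linorder)
  define m where "m = max 1 (\<bar>\<xi> $ j\<bar>\<^sup>2)"
  have "(norm \<xi>)\<^sup>2 = (\<Sum>i\<in>UNIV. \<bar>\<xi> $ i\<bar>\<^sup>2)"
    unfolding power2_norm_eq_inner inner_vec_def by (simp add: power2_eq_square)
  also have "\<dots> \<le> (\<Sum>i\<in>(UNIV::'d set). m)"
    unfolding m_def by (intro sum_mono max.coboundedI2 power_mono j abs_ge_zero)
  finally have "1 + (norm \<xi>)\<^sup>2 \<le> (real CARD('d) + 1) * m" unfolding m_def by (simp add: algebra_simps)
  then have "(1 + (norm \<xi>)\<^sup>2) ^ N \<le> ((real CARD('d) + 1) * m) ^ N"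
    by (intro power_mono) auto
  also have "\<dots> = (real CARD('d) + 1) ^ N * m ^ N" by (rule power_mult_distrib)
  also have "m ^ N \<le> 1 + (\<Sum>i\<in>UNIV. \<bar>\<xi> $ i\<bar> ^ (2 * N))"
  proof -
    have "\<bar>\<xi> $ j\<bar> ^ (2 * N) \<le> (\<Sum>i\<in>UNIV. \<bar>\<xi> $ i\<bar> ^ (2 * N))"
      by (rule member_le_sum) auto
    moreover have "0 \<le> (\<Sum>i\<in>UNIV. \<bar>\<xi> $ i\<bar> ^ (2 * N))" by (intro sum_nonneg) auto
    moreover have "m ^ N = 1 \<or> m ^ N = \<bar>\<xi> $ j\<bar> ^ (2 * N)"
      unfolding m_def max_def power_mult by simp
    ultimately show ?thesis by linarith
  qed
  finally show ?thesis by (simp add: mult_left_mono)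
qed

lemma ft_weighted_bound:
  fixes \<phi> :: "real^'d::finite \<Rightarrow> complex"
  assumes "\<phi> \<in> test_functions U"
  shows "(1 + (norm \<xi>)\<^sup>2) ^ N * norm (ft \<phi> \<xi>) \<le> (real CARD('d) + 1) ^ N *
     ((LINT x|lborel. norm (\<phi> x)) + (\<Sum>i\<in>UNIV. LINT x|lborel. norm (partial (replicate (2 * N) i) \<phi> x)))"
proof -
  have 1: "\<bar>\<xi> $ i\<bar> ^ n * norm (ft \<phi> \<xi>) \<le> (LINT x|lborel. norm (partial (replicate n i) \<phi> x))" for i n
  proof -
    have "\<bar>\<xi> $ i\<bar> * 1 \<le> \<bar>\<xi> $ i\<bar> * (2 * pi)" using pi_ge_two by (intro mult_left_mono) auto
    then have "\<bar>\<xi> $ i\<bar> ^ n \<le> (2 * pi * \<bar>\<xi> $ i\<bar>) ^ n" by (intro power_mono) (auto simp: mult.commute)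
    then have "\<bar>\<xi> $ i\<bar> ^ n * norm (ft \<phi> \<xi>) \<le> (2 * pi * \<bar>\<xi> $ i\<bar>) ^ n * norm (ft \<phi> \<xi>)"
      by (intro mult_right_mono) auto
    also have "\<dots> = norm (ft (partial (replicate n i) \<phi>) \<xi>)"
      unfolding ft_partial_replicate[OF assms] by (simp add: norm_mult norm_power)
    also have "\<dots> \<le> (LINT x|lborel. norm (partial (replicate n i) \<phi> x))" by (rule norm_ft_le)
    finally show ?thesis .
  qed
  have "(1 + (norm \<xi>)\<^sup>2) ^ N * norm (ft \<phi> \<xi>)
    \<le> (real CARD('d) + 1) ^ N * (1 + (\<Sum>i\<in>UNIV. \<bar>\<xi> $ i\<bar> ^ (2 * N))) * norm (ft \<phi> \<xi>)"
    by (intro mult_right_mono power_weight_le) auto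
  also have "\<dots> = (real CARD('d) + 1) ^ N * (norm (ft \<phi> \<xi>) + (\<Sum>i\<in>UNIV. \<bar>\<xi> $ i\<bar> ^ (2 * N) * norm (ft \<phi> \<xi>)))"
    by (simp add: algebra_simps sum_distrib_left)
  also have "\<dots> \<le> (real CARD('d) + 1) ^ N *
     ((LINT x|lborel. norm (\<phi> x)) + (\<Sum>i\<in>UNIV. LINT x|lborel. norm (partial (replicate (2 * N) i) \<phi> x)))"
    by (intro mult_left_mono add_mono sum_mono norm_ft_le 1) auto
  finally show ?thesis .
qed

lemma finite_lists_le: "finite {is :: 'd::finite list. length is \<le> N}"
  using finite_lists_length_le[of "UNIV :: 'd set" N] by simp

text \<open>The decay of the Fourier transform in terms of the seminorms of the test function, uniformly for
  supports in a fixed compact set. This is what makes a Fourier series of polynomial growth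
  continuous on test functions.\<close>

lemma ft_seminorm_bound:
  fixes K :: "(real^'d::finite) set"
  assumes "compact K"
  shows "\<exists>C\<ge>0. \<forall>\<phi>\<in>test_functions UNIV. supp \<phi> \<subseteq> K \<longrightarrow>
    (\<forall>\<xi>. (1 + (norm \<xi>)\<^sup>2) ^ N * norm (ft \<phi> \<xi>) \<le> C * (\<Sum>is | length is \<le> 2 * N. SUP x. norm (partial is \<phi> x)))"
proof (intro exI conjI ballI impI allI)
  define V where "V = measure lborel K"
  let ?C = "(real CARD('d) + 1) ^ N * ((1 + real CARD('d)) * V)"
  show "?C \<ge> 0" unfolding V_def by simp
  fix \<phi> :: "real^'d \<Rightarrow> complex" and \<xi> :: "real^'d"
  assume t: "\<phi> \<in> test_functions UNIV" and sK: "supp \<phi> \<subseteq> K"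
  define T where "T = (\<Sum>is | length is \<le> 2 * N. SUP x. norm (partial is \<phi> x))"
  have S0: "(SUP x. norm (partial is \<phi> x)) \<ge> 0" for "is"
    using test_norm_le_SUP[OF test_functions_partial[OF t, of "is"], of 0] norm_ge_zero[of "partial is \<phi> 0"] by linarith
  have L: "(LINT x|lborel. norm (partial is \<phi> x)) \<le> V * T" if "length is \<le> 2 * N" for "is"
  proof -
    let ?s = "SUP x. norm (partial is \<phi> x)"
    have fin: "emeasure lborel K < \<infinity>" by (rule emeasure_compact_finite[OF assms])
    have [measurable]: "K \<in> sets borel" using assms by (rule borel_compact)
    have "(LINT x|lborel. norm (partial is \<phi> x)) \<le> (LINT x|lborel. ?s * indicator K x)"
    proof (rule integral_mono)
      show "integrable lborel (\<lambda>x. norm (partial is \<phi> x))"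
        by (intro integrable_norm test_integrable[OF test_functions_partial[OF t]])
      show "integrable lborel (\<lambda>x. ?s * indicator K x)"
        using fin by (intro integrable_mult_right integrable_real_indicator) auto
      show "norm (partial is \<phi> x) \<le> ?s * indicator K x" for x
        using test_norm_le_SUP[OF test_functions_partial[OF t, of "is"], of x] sK
          partial_zero_off_supp[of x \<phi> "is"] S0[of "is"]
        by (cases "x \<in> supp \<phi>") (auto simp: indicator_def)
    qed
    also have "\<dots> = ?s * V" unfolding V_def by simp
    also have "?s \<le> T" unfolding T_def using that
      by (intro member_le_sum finite_lists_le S0) auto
    finally show ?thesis unfolding V_def by (simp add: mult_right_mono mult.commute)
  qed
  have "(LINT x|lborel. norm (\<phi> x)) + (\<Sum>i\<in>UNIV. LINT x|lborel. norm (partial (replicate (2 * N) i) \<phi> x))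
     \<le> V * T + (\<Sum>i\<in>(UNIV::'d set). V * T)"
    using L[of "[]"] by (intro add_mono sum_mono L) auto
  also have "\<dots> = ((1 + real CARD('d)) * V) * T" by (simp add: algebra_simps)
  finally have "(real CARD('d) + 1) ^ N * ((LINT x|lborel. norm (\<phi> x)) + (\<Sum>i\<in>UNIV. LINT x|lborel. norm (partial (replicate (2 * N) i) \<phi> x)))
     \<le> (real CARD('d) + 1) ^ N * (((1 + real CARD('d)) * V) * T)"
    by (intro mult_left_mono) auto
  then show "(1 + (norm \<xi>)\<^sup>2) ^ N * norm (ft \<phi> \<xi>) \<le> ?C * (\<Sum>is | length is \<le> 2 * N. SUP x. norm (partial is \<phi> x))"
    using ft_weighted_bound[OF t, of \<xi> N] unfolding T_def[symmetric] by (simp only: mult.assoc)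
qed

section \<open>Weights and weighted square summability\<close>

abbreviation weight :: "int^'d::finite \<Rightarrow> real" where
  "weight n \<equiv> jbracket (lattice n)"

lemma jbracket_ge_1: "jbracket x \<ge> 1"
  unfolding jbracket_def by simp

lemma jbracket_pos [simp]: "jbracket x > 0"
  using jbracket_ge_1[of x] by linarith

lemma jbracket_nonzero [simp]: "jbracket x \<noteq> 0"
  using jbracket_pos[of x] by linarith

lemma jbracket_powr_square: "(jbracket x powr s)\<^sup>2 = jbracket x powr (2 * s)"
  by (simp add: power2_eq_square powr_add[symmetric])

lemma jbracket_powr_cancel: "jbracket x powr s * jbracket x powr (- s) = 1"
  by (simp add: powr_add[symmetric])

lemma jbracket_minus [simp]: "jbracket (- x) = jbracket x"
  unfolding jbracket_def by simp

lemma jbracket_squared: "(jbracket x)\<^sup>2 = 1 + (norm x)\<^sup>2"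
  unfolding jbracket_def by simp

text \<open>Turns the comparison of norms that comes out of the geometry of cones into a comparison of
  weights.\<close>

lemma jbracket_scale:
  assumes "norm x \<le> c * norm y" "c \<ge> 1" shows "jbracket x \<le> c * jbracket y"
proof (rule power2_le_imp_le)
  have "(norm x)\<^sup>2 \<le> (c * norm y)\<^sup>2" using assms by (intro power_mono) auto
  moreover have "1 \<le> c\<^sup>2" using assms by simp
  ultimately show "(jbracket x)\<^sup>2 \<le> (c * jbracket y)\<^sup>2"
    unfolding power_mult_distrib jbracket_squared by (simp add: algebra_simps)
qed (use assms in \<open>simp add: less_imp_le\<close>)

lemma jbracket_add_le: "jbracket (x + y) \<le> 2 * jbracket x * jbracket y"
proof (rule power2_le_imp_le)
  have "(norm (x + y))\<^sup>2 \<le> (norm x + norm y)\<^sup>2" by (intro power_mono norm_triangle_ineq) auto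
  also have "\<dots> \<le> 2 * (norm x)\<^sup>2 + 2 * (norm y)\<^sup>2"
    using sum_squares_bound[of "norm x" "norm y"] by (simp add: power2_sum)
  finally have "1 + (norm (x + y))\<^sup>2 \<le> 4 * ((1 + (norm x)\<^sup>2) * (1 + (norm y)\<^sup>2))"
    using mult_nonneg_nonneg[OF zero_le_power2[of "norm x"] zero_le_power2[of "norm y"]]
      zero_le_power2[of "norm x"] zero_le_power2[of "norm y"]
    unfolding distrib_left distrib_right by linarith
  then have "1 + (norm (x + y))\<^sup>2 \<le> 2\<^sup>2 * (1 + (norm x)\<^sup>2) * (1 + (norm y)\<^sup>2)"
    unfolding mult.assoc power2_eq_square[of "2::real"] by simp
  then show "(jbracket (x + y))\<^sup>2 \<le> (2 * jbracket x * jbracket y)\<^sup>2"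
    unfolding power_mult_distrib jbracket_squared .
qed (simp add: less_imp_le)

text \<open>Peetre's inequality. It makes weights nearly multiplicative under translation, and the
  convolution estimates rest on it.\<close>

lemma peetre: "jbracket (x + y) powr s \<le> 2 powr \<bar>s\<bar> * jbracket x powr s * jbracket y powr \<bar>s\<bar>"
proof (cases "s \<ge> 0")
  case True
  then have "jbracket (x + y) powr s \<le> (2 * jbracket x * jbracket y) powr s"
    by (intro powr_mono2 jbracket_add_le) (auto simp: less_imp_le)
  then show ?thesis using True by (simp add: powr_mult less_imp_le)
next
  case False
  have "jbracket x \<le> 2 * jbracket (x + y) * jbracket y"
    using jbracket_add_le[of "x + y" "- y"] by simp
  then have "(2 * jbracket (x + y) * jbracket y) powr s \<le> jbracket x powr s"
    using False by (intro powr_mono2') auto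
  then have "2 powr s * jbracket (x + y) powr s * jbracket y powr s \<le> jbracket x powr s"
    by (simp add: powr_mult less_imp_le)
  then have "2 powr s * jbracket (x + y) powr s * jbracket y powr s * (2 powr (- s) * jbracket y powr (- s))
     \<le> jbracket x powr s * (2 powr (- s) * jbracket y powr (- s))"
    by (intro mult_right_mono) auto
  moreover have "2 powr s * jbracket (x + y) powr s * jbracket y powr s * (2 powr (- s) * jbracket y powr (- s))
     = jbracket (x + y) powr s"
  proof -
    have "2 powr s * jbracket (x + y) powr s * jbracket y powr s * (2 powr (- s) * jbracket y powr (- s))
      = (2 powr s * 2 powr (- s)) * (jbracket y powr s * jbracket y powr (- s)) * jbracket (x + y) powr s"
      by (simp only: mult_ac)
    also have "2 powr s * 2 powr (- s) = (1::real)" by (simp add: powr_add[symmetric])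
    finally show ?thesis by (simp only: jbracket_powr_cancel mult_1)
  qed
  ultimately have "jbracket (x + y) powr s \<le> jbracket x powr s * (2 powr (- s) * jbracket y powr (- s))"
    by (simp only:)
  then show ?thesis using False by (simp add: mult_ac)
qed

lemma power_eq_jbracket_powr: "(1 + (norm x)\<^sup>2) ^ N = jbracket x powr (2 * real N)"
proof -
  have "jbracket x powr (2 * real N) = ((jbracket x)\<^sup>2) ^ N"
    using powr_realpow[OF jbracket_pos, of x "2 * N"] by (simp add: power_mult)
  then show ?thesis by (simp add: jbracket_squared)
qed

lemma ft_decay:
  assumes "\<phi> \<in> test_functions U"
  shows "\<exists>C\<ge>0. \<forall>\<xi>. norm (ft \<phi> \<xi>) \<le> C * jbracket \<xi> powr (- R)"
proof -
  define N where "N = nat \<lceil>\<bar>R\<bar>\<rceil>"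
  have N: "R \<le> 2 * real N" unfolding N_def by linarith
  obtain C where C: "C \<ge> 0" "\<And>\<xi>. (1 + (norm \<xi>)\<^sup>2) ^ N * norm (ft \<phi> \<xi>) \<le> C"
  proof
    show "0 \<le> (real CARD('a) + 1) ^ N *
     ((LINT x|lborel. norm (\<phi> x)) + (\<Sum>i\<in>UNIV. LINT x|lborel. norm (partial (replicate (2 * N) i) \<phi> x)))"
      by (intro mult_nonneg_nonneg add_nonneg_nonneg sum_nonneg integral_nonneg_AE) auto
  qed (rule ft_weighted_bound[OF assms])
  have "norm (ft \<phi> \<xi>) \<le> C * jbracket \<xi> powr (- R)" for \<xi>
  proof -
    have "jbracket \<xi> powr R \<le> (1 + (norm \<xi>)\<^sup>2) ^ N"
      unfolding power_eq_jbracket_powr using N jbracket_ge_1 by (intro powr_mono) auto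
    then have "jbracket \<xi> powr R * norm (ft \<phi> \<xi>) \<le> C"
      using C(2)[of \<xi>] by (meson mult_right_mono norm_ge_zero order_trans)
    then have "jbracket \<xi> powr R * norm (ft \<phi> \<xi>) * jbracket \<xi> powr (- R) \<le> C * jbracket \<xi> powr (- R)"
      by (rule mult_right_mono) simp
    then show ?thesis using jbracket_powr_cancel[of \<xi> R] by (simp add: mult_ac)
  qed
  with C(1) show ?thesis by blast
qed

lemma summable_inverse_square_int: "(\<lambda>n::int. inverse (1 + (real_of_int n)\<^sup>2)) summable_on UNIV"
proof -
  have s: "summable (\<lambda>n. inverse (1 + (real n)\<^sup>2))"
  proof (rule summable_comparison_test_ev)
    show "summable (\<lambda>n. inverse ((real n)\<^sup>2))" by (rule inverse_power_summable) simp
    show "\<forall>\<^sub>F n in sequentially. norm (inverse (1 + (real n)\<^sup>2)) \<le> inverse ((real n)\<^sup>2)"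
      using eventually_gt_at_top[of 0] by eventually_elim (auto intro!: le_imp_inverse_le add_nonneg_nonneg)
  qed
  then have N: "(\<lambda>n. inverse (1 + (real n)\<^sup>2)) summable_on UNIV"
    by (rule summable_nonneg_imp_summable_on) (simp add: add_nonneg_nonneg)
  have "(\<lambda>n::int. inverse (1 + (real_of_int n)\<^sup>2)) summable_on range int"
    using N by (subst summable_on_reindex) (auto simp: o_def inj_def)
  moreover have "(\<lambda>n::int. inverse (1 + (real_of_int n)\<^sup>2)) summable_on range (\<lambda>n. - int n)"
    using N by (subst summable_on_reindex) (auto simp: o_def inj_def)
  moreover have "range int \<union> range (\<lambda>n. - int n) = UNIV"
    by (auto, metis int_cases2 rangeI)
  ultimately show ?thesis using summable_on_union by metis
qed

text \<open>Each factor \<open>1 + (n $ i)\<^sup>2\<close> is at most \<open>(weight n)\<^sup>2\<close>, so this power of the weight is dominated by a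
  product of one-dimensional summable sequences.\<close>

lemma summable_lattice_decay:
  "(\<lambda>n::int^'d::finite. weight n powr (- (2 * real CARD('d)))) summable_on UNIV"
proof (rule summable_on_comparison_test)
  define g where "g n = inverse (1 + (real_of_int n)\<^sup>2)" for n
  have g0: "g n \<ge> 0" for n unfolding g_def by (simp add: add_nonneg_nonneg)
  show "(\<lambda>n::int^'d. \<Prod>i\<in>UNIV. g (n $ i)) summable_on UNIV"
  proof (rule nonneg_bdd_above_summable_on)
    show "bdd_above (sum (\<lambda>n::int^'d. \<Prod>i\<in>UNIV. g (n $ i)) ` {F. F \<subseteq> UNIV \<and> finite F})"
    proof (rule bdd_aboveI2)
      fix F :: "(int^'d) set" assume "F \<in> {F. F \<subseteq> UNIV \<and> finite F}"
      then have F: "finite F" by simp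
      define S where "S = (\<Union>n\<in>F. range (($) n))"
      have S: "finite S" unfolding S_def using F by auto
      have "(\<Sum>n\<in>F. \<Prod>i\<in>UNIV. g (n $ i)) = (\<Sum>f\<in>($) ` F. \<Prod>i\<in>UNIV. g (f i))"
        by (subst sum.reindex) (auto simp: inj_on_def vec_eq_iff fun_eq_iff)
      also have "\<dots> \<le> (\<Sum>f\<in>PiE UNIV (\<lambda>_. S). \<Prod>i\<in>(UNIV::'d set). g (f i))"
      proof (rule sum_mono2)
        show "finite (PiE UNIV (\<lambda>_. S) :: ('d \<Rightarrow> int) set)" using S by (intro finite_PiE) auto
        show "($) ` F \<subseteq> (PiE UNIV (\<lambda>_. S) :: ('d \<Rightarrow> int) set)" unfolding S_def by auto
      qed (simp add: prod_nonneg g0)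
      also have "\<dots> = (\<Prod>i\<in>(UNIV::'d set). \<Sum>n\<in>S. g n)"
        using S by (subst prod_sum_PiE) auto
      also have "\<dots> \<le> (\<Prod>i\<in>(UNIV::'d set). infsum g UNIV)"
        using summable_inverse_square_int S g0
        by (intro prod_mono conjI sum_nonneg finite_sum_le_infsum) (auto simp: g_def)
      finally show "(\<Sum>n\<in>F. \<Prod>i\<in>UNIV. g (n $ i)) \<le> (\<Prod>i\<in>(UNIV::'d set). infsum g UNIV)" .
    qed
  qed (simp add: prod_nonneg g0)
  fix n :: "int^'d"
  have "(1::real) + (real_of_int (n $ i))\<^sup>2 \<le> (weight n)\<^sup>2" for i
  proof -
    have "\<bar>lattice n $ i\<bar>\<^sup>2 \<le> (norm (lattice n))\<^sup>2" by (intro power_mono component_le_norm_cart) auto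
    then show ?thesis unfolding jbracket_squared by (simp add: lattice_def)
  qed
  then have "(\<Prod>i\<in>(UNIV::'d set). inverse ((weight n)\<^sup>2)) \<le> (\<Prod>i\<in>UNIV. g (n $ i))"
    unfolding g_def by (intro prod_mono conjI le_imp_inverse_le) (auto simp: add_pos_nonneg)
  moreover have "weight n powr (- (2 * real CARD('d))) = (\<Prod>i\<in>(UNIV::'d set). inverse ((weight n)\<^sup>2))"
    using powr_realpow[OF jbracket_pos, of "lattice n" "2 * CARD('d)"]
    by (simp add: powr_minus power_mult power_inverse)
  ultimately show "weight n powr (- (2 * real CARD('d))) \<le> (\<Prod>i\<in>UNIV. g (n $ i))" by simp
qed simp

lemma summable_lattice_powr:
  assumes "R \<ge> 2 * real CARD('d)"
  shows "(\<lambda>n::int^'d::finite. weight n powr (- R)) summable_on UNIV"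
  by (rule summable_on_comparison_test[OF summable_lattice_decay])
    (use assms jbracket_ge_1 in \<open>auto intro!: powr_mono\<close>)

lemma summable_decay_mult:
  fixes a :: "int^'d::finite \<Rightarrow> real"
  assumes "\<And>n. 0 \<le> a n" "\<And>n. a n \<le> C * weight n powr (- R)" "R \<ge> 2 * real CARD('d)"
  shows "a summable_on UNIV"
  by (rule summable_on_comparison_test[OF summable_on_cmult_right[OF summable_lattice_powr[OF assms(3)], of C]])
    (use assms in auto)

text \<open>A single term is bounded by the whole sum.\<close>

lemma l2_pointwise:
  fixes c :: "int^'d::finite \<Rightarrow> complex"
  assumes "(\<lambda>n. (norm (c n))\<^sup>2 * weight n powr (2 * s)) summable_on UNIV"
  shows "\<exists>C\<ge>0. \<forall>n. norm (c n) \<le> C * weight n powr (- s)"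
proof (intro exI conjI allI)
  let ?S = "\<Sum>\<^sub>\<infinity>n. (norm (c n))\<^sup>2 * weight n powr (2 * s)"
  show S0: "sqrt ?S \<ge> 0" by (simp add: infsum_nonneg)
  fix n
  have "(norm (c n) * weight n powr s)\<^sup>2 = (norm (c n))\<^sup>2 * weight n powr (2 * s)"
    by (simp add: power_mult_distrib jbracket_powr_square)
  also have "\<dots> \<le> ?S"
    using finite_sum_le_infsum[OF assms, of "{n}"] by simp
  finally have "norm (c n) * weight n powr s \<le> sqrt ?S" by (rule real_le_rsqrt)
  then have "norm (c n) * weight n powr s * weight n powr (- s)
      \<le> sqrt ?S * weight n powr (- s)"
    by (rule mult_right_mono) simp
  then show "norm (c n) \<le> sqrt ?S * weight n powr (- s)"
    by (simp only: mult.assoc jbracket_powr_cancel mult_1_right)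
qed

text \<open>The quadratic polynomial \<open>t \<mapsto> \<Sum>m. \<rho> m * (\<bar>u m\<bar> - t)\<^sup>2\<close> is nonnegative; the inequality is
  its value at \<open>t = (\<Sum>m. \<rho> m * \<bar>u m\<bar>) / (\<Sum>m. \<rho> m)\<close>.\<close>

lemma infsum_Cauchy_Schwarz:
  fixes \<rho> u :: "'a \<Rightarrow> real"
  assumes \<rho>0: "\<And>m. \<rho> m \<ge> 0" and 1: "\<rho> summable_on UNIV" and 2: "(\<lambda>m. \<rho> m * (u m)\<^sup>2) summable_on UNIV"
  shows "(\<lambda>m. \<rho> m * \<bar>u m\<bar>) summable_on UNIV"
    and "(\<Sum>\<^sub>\<infinity>m. \<rho> m * \<bar>u m\<bar>)\<^sup>2 \<le> (\<Sum>\<^sub>\<infinity>m. \<rho> m) * (\<Sum>\<^sub>\<infinity>m. \<rho> m * (u m)\<^sup>2)"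
proof -
  show 3: "(\<lambda>m. \<rho> m * \<bar>u m\<bar>) summable_on UNIV"
  proof (rule summable_on_comparison_test[OF summable_on_add[OF 1 2]])
    fix m
    have "\<bar>u m\<bar> \<le> 1 + (u m)\<^sup>2"
      using sum_squares_bound[of 1 "\<bar>u m\<bar>"] by simp
    then have "\<rho> m * \<bar>u m\<bar> \<le> \<rho> m * (1 + (u m)\<^sup>2)" using \<rho>0 by (rule mult_left_mono)
    then show "\<rho> m * \<bar>u m\<bar> \<le> \<rho> m + \<rho> m * (u m)\<^sup>2" by (simp add: algebra_simps)
  qed (use \<rho>0 in simp)
  define A B C where "A = (\<Sum>\<^sub>\<infinity>m. \<rho> m)" and "B = (\<Sum>\<^sub>\<infinity>m. \<rho> m * \<bar>u m\<bar>)" and "C = (\<Sum>\<^sub>\<infinity>m. \<rho> m * (u m)\<^sup>2)"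
  have q: "0 \<le> C - 2 * t * B + t\<^sup>2 * A" for t
  proof -
    have "((\<lambda>m. \<rho> m * (u m)\<^sup>2 - (2 * t) * (\<rho> m * \<bar>u m\<bar>) + t\<^sup>2 * \<rho> m) has_sum (C - (2 * t) * B + t\<^sup>2 * A)) UNIV"
      unfolding A_def B_def C_def diff_conv_add_uminus
      by (intro has_sum_add has_sum_uminusI has_sum_cmult_right has_sum_infsum 1 2 3)
    moreover have "\<rho> m * (u m)\<^sup>2 - (2 * t) * (\<rho> m * \<bar>u m\<bar>) + t\<^sup>2 * \<rho> m = \<rho> m * (\<bar>u m\<bar> - t)\<^sup>2" for m
      by (simp add: power2_diff algebra_simps)
    ultimately have "((\<lambda>m. \<rho> m * (\<bar>u m\<bar> - t)\<^sup>2) has_sum (C - 2 * t * B + t\<^sup>2 * A)) UNIV" by simp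
    then show ?thesis by (rule has_sum_nonneg) (use \<rho>0 in simp)
  qed
  have "B\<^sup>2 \<le> A * C"
  proof (cases "A = 0")
    case True
    have "\<rho> m = 0" for m
      by (rule nonneg_infsum_le_0D[of \<rho> UNIV]) (use True 1 \<rho>0 in \<open>auto simp: A_def\<close>)
    then show ?thesis unfolding B_def True by simp
  next
    case False
    then have "A > 0" using infsum_nonneg[of UNIV \<rho>] \<rho>0 unfolding A_def by auto
    then show ?thesis using q[of "B / A"] by (simp add: field_simps power2_eq_square)
  qed
  then show "B\<^sup>2 \<le> A * C" .
qed

text \<open>Young's inequality: convolution with a summable sequence preserves square summability. By
  Cauchy-Schwarz, the square of a convolution is at most a constant times the convolution with
  \<open>u\<^sup>2\<close>, whose double sum converges after a change of variables.\<close>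

lemma young_l1_l2:
  fixes \<rho> u :: "'a::ab_group_add \<Rightarrow> real"
  assumes \<rho>0: "\<And>m. \<rho> m \<ge> 0" and u0: "\<And>m. u m \<ge> 0"
    and 1: "\<rho> summable_on UNIV" and 2: "(\<lambda>m. (u m)\<^sup>2) summable_on UNIV"
  shows "(\<lambda>m. \<rho> m * u (k + m)) summable_on UNIV"
    and "(\<lambda>k. (\<Sum>\<^sub>\<infinity>m. \<rho> m * u (k + m))\<^sup>2) summable_on UNIV"
proof -
  have "(\<lambda>(j, m). \<rho> m * (u j)\<^sup>2) summable_on UNIV \<times> UNIV"
  proof (rule summable_on_SigmaI)
    show "((\<lambda>m. case (j, m) of (j, m) \<Rightarrow> \<rho> m * (u j)\<^sup>2) has_sum (infsum \<rho> UNIV * (u j)\<^sup>2)) UNIV" for j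
      using has_sum_cmult_left[OF has_sum_infsum[OF 1]] by simp
    show "(\<lambda>j. infsum \<rho> UNIV * (u j)\<^sup>2) summable_on UNIV" by (rule summable_on_cmult_right[OF 2])
  qed (use \<rho>0 in auto)
  also have "?this \<longleftrightarrow> (\<lambda>(k, m). \<rho> m * (u (k + m))\<^sup>2) summable_on UNIV \<times> UNIV"
    by (rule summable_on_reindex_bij_witness[where i = "\<lambda>(k, m). (k + m, m)" and j = "\<lambda>(j, m). (j - m, m)"]) auto
  finally have pair: "(\<lambda>(k, m). \<rho> m * (u (k + m))\<^sup>2) summable_on UNIV \<times> UNIV" .
  have row: "(\<lambda>m. \<rho> m * (u (k + m))\<^sup>2) summable_on UNIV" for k
    using summable_on_SigmaD1[OF pair UNIV_I] .
  note cs = infsum_Cauchy_Schwarz[OF \<rho>0 1 row, unfolded abs_of_nonneg[OF u0]]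
  show "(\<lambda>m. \<rho> m * u (k + m)) summable_on UNIV" by (rule cs(1))
  show "(\<lambda>k. (\<Sum>\<^sub>\<infinity>m. \<rho> m * u (k + m))\<^sup>2) summable_on UNIV"
  proof (rule summable_on_comparison_test)
    show "(\<lambda>k. infsum \<rho> UNIV * (\<Sum>\<^sub>\<infinity>m. \<rho> m * (u (k + m))\<^sup>2)) summable_on UNIV"
      by (rule summable_on_cmult_right[OF summable_on_Sigma_banach[OF pair]])
  qed (use cs(2) in auto)
qed

text \<open>By Peetre's inequality the weight can be distributed over the two factors of the convolution,
  which reduces this to the unweighted case.\<close>

lemma young_weighted:
  fixes \<rho> u :: "int^'d::finite \<Rightarrow> real"
  assumes \<rho>0: "\<And>m. \<rho> m \<ge> 0" and u0: "\<And>m. u m \<ge> 0"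
    and 1: "(\<lambda>m. \<rho> m * weight m powr \<bar>s\<bar>) summable_on UNIV"
    and 2: "(\<lambda>k. (u k)\<^sup>2 * weight k powr (2 * s)) summable_on UNIV"
  shows "(\<lambda>m. \<rho> m * u (k + m)) summable_on UNIV"
    and "(\<lambda>k. (\<Sum>\<^sub>\<infinity>m. \<rho> m * u (k + m))\<^sup>2 * weight k powr (2 * s)) summable_on UNIV"
proof -
  let ?w = "\<lambda>n::int^'d. weight n"
  define \<rho>' u' where "\<rho>' m = 2 powr \<bar>s\<bar> * (\<rho> m * ?w m powr \<bar>s\<bar>)" and "u' k = u k * ?w k powr s" for k m
  have 1: "\<rho>' summable_on UNIV" unfolding \<rho>'_def by (rule summable_on_cmult_right[OF 1])
  have 2: "(\<lambda>k. (u' k)\<^sup>2) summable_on UNIV"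
    using 2 unfolding u'_def by (simp add: power_mult_distrib jbracket_powr_square)
  have nn: "\<rho>' m \<ge> 0" "u' m \<ge> 0" for m unfolding \<rho>'_def u'_def using \<rho>0 u0 by auto
  have le: "\<rho> m * u (k + m) * ?w k powr s \<le> \<rho>' m * u' (k + m)" for k m
  proof -
    have "lattice k = lattice (k + m) + - lattice m" by (simp add: lattice_add)
    then have "?w k powr s \<le> 2 powr \<bar>s\<bar> * ?w (k + m) powr s * ?w m powr \<bar>s\<bar>"
      using peetre[of "lattice (k + m)" "- lattice m" s] by simp
    then have "\<rho> m * u (k + m) * ?w k powr s \<le> \<rho> m * u (k + m) * (2 powr \<bar>s\<bar> * ?w (k + m) powr s * ?w m powr \<bar>s\<bar>)"
      using \<rho>0 u0 by (intro mult_left_mono) auto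
    then show ?thesis unfolding \<rho>'_def u'_def by (simp add: mult_ac)
  qed
  note y = young_l1_l2[OF nn 1 2]
  have s: "(\<lambda>m. \<rho> m * u (k + m) * ?w k powr s) summable_on UNIV" for k
    by (rule summable_on_comparison_test[OF y(1)[of k]]) (use le \<rho>0 u0 in auto)
  then show *: "(\<lambda>m. \<rho> m * u (k + m)) summable_on UNIV" for k
    by (subst (asm) summable_on_cmult_left') (use jbracket_pos[of "lattice k"] in auto)
  show "(\<lambda>k. (\<Sum>\<^sub>\<infinity>m. \<rho> m * u (k + m))\<^sup>2 * ?w k powr (2 * s)) summable_on UNIV"
  proof (rule summable_on_comparison_test[OF y(2)])
    fix k
    have "(\<Sum>\<^sub>\<infinity>m. \<rho> m * u (k + m)) * ?w k powr s = (\<Sum>\<^sub>\<infinity>m. \<rho> m * u (k + m) * ?w k powr s)"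
      by (rule infsum_cmult_left'[symmetric])
    also have "\<dots> \<le> (\<Sum>\<^sub>\<infinity>m. \<rho>' m * u' (k + m))"
      by (rule infsum_mono[OF s y(1) le])
    finally have "((\<Sum>\<^sub>\<infinity>m. \<rho> m * u (k + m)) * ?w k powr s)\<^sup>2 \<le> (\<Sum>\<^sub>\<infinity>m. \<rho>' m * u' (k + m))\<^sup>2"
      by (rule power_mono) (use \<rho>0 u0 in \<open>auto intro!: mult_nonneg_nonneg infsum_nonneg\<close>)
    then show "(\<Sum>\<^sub>\<infinity>m. \<rho> m * u (k + m))\<^sup>2 * ?w k powr (2 * s) \<le> (\<Sum>\<^sub>\<infinity>m. \<rho>' m * u' (k + m))\<^sup>2"
      by (simp add: power_mult_distrib jbracket_powr_square)
  qed simp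
qed

section \<open>Integration over translated unit cubes\<close>

text \<open>Half-open, so that the lattice translates of one cube partition the space; the corner \<open>a\<close> is arbitrary
  because the cube has to contain the support of a given test function.\<close>

definition unit_box :: "real^'d::finite \<Rightarrow> (real^'d) set" where
  "unit_box a = {x. \<forall>i. a $ i \<le> x $ i \<and> x $ i < a $ i + 1}"

lemma unit_box_measurable [measurable]: "unit_box a \<in> sets borel"
proof -
  have "unit_box a = (\<Inter>i\<in>UNIV. {x. x $ i \<ge> a $ i} \<inter> {x. x $ i < a $ i + 1})"
    unfolding unit_box_def by auto
  also have "\<dots> \<in> sets borel"
    by (intro sets.finite_INT sets.Int borel_closed borel_open
        closed_halfspace_component_ge_cart open_halfspace_component_lt_cart) auto
  finally show ?thesis .
qed

lemma unit_box_translate_unique: "\<exists>k0. \<forall>k. x - lattice k \<in> unit_box a \<longleftrightarrow> k = k0"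
proof (intro exI allI)
  fix k
  have "x - lattice k \<in> unit_box a \<longleftrightarrow> (\<forall>i. k $ i = \<lfloor>x $ i - a $ i\<rfloor>)"
    unfolding unit_box_def lattice_def by (auto simp: floor_eq_iff algebra_simps eq_commute[of "k $ _"])
  then show "x - lattice k \<in> unit_box a \<longleftrightarrow> k = (\<chi> i. \<lfloor>x $ i - a $ i\<rfloor>)"
    by (simp add: vec_eq_iff)
qed

lemma nn_integral_unit_box_translates:
  "(\<integral>\<^sup>+k. indicator (unit_box a) (x - lattice k) \<partial>count_space UNIV) = 1"
proof -
  obtain k0 where k0: "\<And>k. x - lattice k \<in> unit_box a \<longleftrightarrow> k = k0"
    using unit_box_translate_unique[of x a] by blast
  have "(\<lambda>k. indicator (unit_box a) (x - lattice k) :: ennreal) = indicator {k0}"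
    using k0 by (auto simp: indicator_def fun_eq_iff)
  then show ?thesis by simp
qed

lemma nn_integral_shift:
  fixes f :: "'a::euclidean_space \<Rightarrow> ennreal"
  assumes [measurable]: "f \<in> borel_measurable borel"
  shows "(\<integral>\<^sup>+x. f (x + a) \<partial>lborel) = (\<integral>\<^sup>+x. f x \<partial>lborel)"
proof -
  have "(\<integral>\<^sup>+x. f x \<partial>lborel) = (\<integral>\<^sup>+x. f x \<partial>distr lborel borel ((+) a))"
    by (simp add: lborel_distr_plus)
  also have "\<dots> = (\<integral>\<^sup>+x. f (a + x) \<partial>lborel)" by (rule nn_integral_distr) auto
  finally show ?thesis by (simp add: add.commute)
qed

text \<open>The integral is split over the partition into translated cubes, and each piece is shifted back to
  the cube at \<open>a\<close>.\<close>

lemma nn_integral_tiling: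
  fixes F :: "real^'d::finite \<Rightarrow> ennreal"
  assumes [measurable]: "F \<in> borel_measurable borel"
  shows "(\<integral>\<^sup>+x. F x \<partial>lborel) =
    (\<integral>\<^sup>+x. (\<integral>\<^sup>+k. F (x + lattice k) \<partial>count_space UNIV) * indicator (unit_box a) x \<partial>lborel)"
proof -
  have "(\<integral>\<^sup>+x. F x \<partial>lborel) =
      (\<integral>\<^sup>+x. (\<integral>\<^sup>+k. F x * indicator (unit_box a) (x - lattice k) \<partial>count_space UNIV) \<partial>lborel)"
    by (simp add: nn_integral_cmult nn_integral_unit_box_translates)
  also have "\<dots> = (\<integral>\<^sup>+k. (\<integral>\<^sup>+x. F x * indicator (unit_box a) (x - lattice k) \<partial>lborel) \<partial>count_space UNIV)"
    by (rule nn_integral_count_space_nn_integral) (auto intro: measurable_compose)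
  also have "\<dots> = (\<integral>\<^sup>+k. (\<integral>\<^sup>+x. F (x + lattice k) * indicator (unit_box a) x \<partial>lborel) \<partial>count_space UNIV)"
  proof (rule nn_integral_cong)
    fix k :: "int^'d"
    have "(\<integral>\<^sup>+x. F x * indicator (unit_box a) (x - lattice k) \<partial>lborel)
       = (\<integral>\<^sup>+x. F (x + lattice k) * indicator (unit_box a) (x + lattice k - lattice k) \<partial>lborel)"
      by (rule nn_integral_shift[symmetric]) measurable
    then show "(\<integral>\<^sup>+x. F x * indicator (unit_box a) (x - lattice k) \<partial>lborel)
       = (\<integral>\<^sup>+x. F (x + lattice k) * indicator (unit_box a) x \<partial>lborel)" by simp
  qed
  also have "\<dots> = (\<integral>\<^sup>+x. (\<integral>\<^sup>+k. F (x + lattice k) * indicator (unit_box a) x \<partial>count_space UNIV) \<partial>lborel)"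
    by (rule nn_integral_count_space_nn_integral[symmetric]) auto
  finally show ?thesis by (simp add: nn_integral_multc)
qed

lemma nn_integral_periodic_unit_box:
  fixes G :: "real^'d::finite \<Rightarrow> ennreal"
  assumes [measurable]: "G \<in> borel_measurable borel" and per: "\<And>x k. G (x + lattice k) = G x"
  shows "(\<integral>\<^sup>+x. G x * indicator (unit_box b) x \<partial>lborel) = (\<integral>\<^sup>+x. G x * indicator (unit_box a) x \<partial>lborel)"
proof -
  have 1: "(\<integral>\<^sup>+k. indicator (unit_box b) (x + lattice k) \<partial>count_space UNIV) = (1::ennreal)" for x
  proof -
    have "(\<integral>\<^sup>+k. indicator (unit_box b) (x + lattice k) \<partial>count_space UNIV)
       = (\<integral>\<^sup>+k. indicator (unit_box b) (x - lattice k) \<partial>count_space UNIV :: ennreal)"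
      by (subst nn_integral_bij_count_space[of uminus UNIV UNIV, symmetric])
        (auto simp: lattice_minus bij_betw_def)
    then show ?thesis by (simp add: nn_integral_unit_box_translates)
  qed
  show ?thesis
    by (subst nn_integral_tiling[where a = a]) (simp_all add: per nn_integral_cmult 1)
qed

lemma emeasure_unit_box: "emeasure lborel (unit_box a :: (real^'d::finite) set) = 1"
proof -
  have in_ax: "(\<forall>b\<in>Basis. P (x \<bullet> b) (y \<bullet> b)) \<longleftrightarrow> (\<forall>i. P (x $ i) (y $ i))" for P and x y :: "real^'d"
    by (auto simp: Basis_vec_def inner_axis)
  have p: "(\<Prod>b\<in>Basis. (a + 1 - a) \<bullet> b) = 1"
    by (rule prod.neutral) (auto simp: Basis_vec_def inner_axis)
  have le: "\<forall>b\<in>Basis. a \<bullet> b \<le> (a + 1) \<bullet> b" unfolding in_ax by simp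
  have "emeasure lborel (unit_box a) \<le> emeasure lborel (cbox a (a + 1))"
    by (rule emeasure_mono) (auto simp: unit_box_def mem_box_cart less_imp_le)
  moreover have "emeasure lborel (box a (a + 1)) \<le> emeasure lborel (unit_box a)"
    by (rule emeasure_mono) (auto simp: unit_box_def mem_box_cart less_imp_le)
  ultimately show ?thesis
    unfolding emeasure_lborel_box_eq emeasure_lborel_cbox_eq using le p by (auto intro: antisym)
qed

lemma measure_unit_box: "measure lborel (unit_box a) = 1"
  unfolding measure_def emeasure_unit_box by simp

lemma integrable_unit_box:
  fixes g :: "real^'d::finite \<Rightarrow> 'b::{banach, second_countable_topology}"
  assumes [measurable]: "g \<in> borel_measurable borel" and B: "\<And>x. norm (g x) \<le> B"
  shows "integrable lborel (\<lambda>x. indicator (unit_box a) x *\<^sub>R g x)"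
proof (rule Bochner_Integration.integrable_bound)
  show "integrable lborel (\<lambda>x. B * indicator (unit_box a) x)"
    by (intro integrable_mult_right integrable_real_indicator) (simp_all add: emeasure_unit_box)
  have "B \<ge> 0" using B[of 0] norm_ge_zero[of "g 0"] by linarith
  then show "AE x in lborel. norm (indicator (unit_box a) x *\<^sub>R g x) \<le> norm (B * indicator (unit_box a) x)"
    using B by (auto simp: indicator_def)
qed simp

lemma integral_periodic_unit_box:
  fixes h :: "real^'d::finite \<Rightarrow> real"
  assumes [measurable]: "h \<in> borel_measurable borel" and per: "\<And>x k. h (x + lattice k) = h x"
    and B: "\<And>x. \<bar>h x\<bar> \<le> B"
  shows "(LINT x|lborel. indicator (unit_box b) x *\<^sub>R h x) = (LINT x|lborel. indicator (unit_box a) x *\<^sub>R h x)"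
proof -
  have nn: "h x + B \<ge> 0" for x using B[of x] by linarith
  have 2: "norm (h x + B) \<le> 2 * B" for x using B[of x] by auto
  \<comment> \<open>Adding the bound \<open>B\<close> makes the function nonnegative, and the cube has measure \<open>1\<close>.\<close>
  have I: "(LINT x|lborel. indicator (unit_box c) x *\<^sub>R h x) =
     enn2real (\<integral>\<^sup>+x. ennreal (h x + B) * indicator (unit_box c) x \<partial>lborel) - B" for c
  proof -
    have "(LINT x|lborel. indicator (unit_box c) x *\<^sub>R (h x + B)) =
       enn2real (\<integral>\<^sup>+x. ennreal (indicator (unit_box c) x *\<^sub>R (h x + B)) \<partial>lborel)"
      by (rule integral_eq_nn_integral) (auto simp: nn)
    also have "(\<integral>\<^sup>+x. ennreal (indicator (unit_box c) x *\<^sub>R (h x + B)) \<partial>lborel)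
        = (\<integral>\<^sup>+x. ennreal (h x + B) * indicator (unit_box c) x \<partial>lborel)"
      by (rule nn_integral_cong) (auto simp: indicator_def)
    also have "(LINT x|lborel. indicator (unit_box c) x *\<^sub>R (h x + B))
      = (LINT x|lborel. indicator (unit_box c) x *\<^sub>R h x) + (LINT x|lborel. indicator (unit_box c) x *\<^sub>R B)"
      unfolding scaleR_add_right
      by (intro Bochner_Integration.integral_add integrable_unit_box[where B = B]) (use B in \<open>auto intro: order_trans[OF abs_ge_zero]\<close>)
    finally show ?thesis by (simp add: measure_unit_box)
  qed
  show ?thesis unfolding I
    by (subst nn_integral_periodic_unit_box[where b = b and a = a]) (simp_all add: per)
qed

lemma expo_lattice_periodic: "expo (lattice n) (x + lattice k) = expo (lattice n) x"
  by (simp add: expo_add_right)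

text \<open>For \<open>n \<noteq> 0\<close> there is a \<open>v\<close> with \<open>expo (lattice n) v = -1\<close>. The integral of a periodic function over a unit cube
  does not change when the cube is translated by \<open>v\<close>, hence equals its own negative.\<close>

lemma integral_unit_box_expo:
  fixes n :: "int^'d::finite"
  shows "(LINT x|lborel. indicator (unit_box a) x *\<^sub>R expo (lattice n) x) = (if n = 0 then 1 else 0)"
proof (cases "n = 0")
  case True
  then show ?thesis by (simp add: measure_unit_box flip: of_real_eq_1_iff) (simp add: scaleR_conv_of_real measure_unit_box)
next
  case False
  then obtain i where "n $ i \<noteq> 0" by (auto simp: vec_eq_iff)
  then have "lattice n $ i \<noteq> 0" by (simp add: lattice_def)
  then have n0: "lattice n \<noteq> (0 :: real^'d)" by (metis zero_index)
  \<comment> \<open>Half a period in the direction of \<open>n\<close>.\<close>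
  define v where "v = (1 / (2 * (norm (lattice n))\<^sup>2)) *\<^sub>R lattice n"
  have "lattice n \<bullet> v = 1 / 2"
    using n0 unfolding v_def by (simp add: power2_norm_eq_inner)
  then have "expo (lattice n) v = cis pi" unfolding expo_eq_cis by (simp only:) simp
  then have v: "expo (lattice n) (x + v) = - expo (lattice n) x" for x
    unfolding expo_add_right by simp
  have zero: "(LINT x|lborel. indicator (unit_box a) x *\<^sub>R h x) = 0"
    if [measurable]: "h \<in> borel_measurable borel" and "\<And>x k. h (x + lattice k) = h x"
      "\<And>x. \<bar>h x\<bar> \<le> 1" "\<And>x. h (x + v) = - h x" for h :: "real^'d \<Rightarrow> real"
  proof -
    have "(LINT x|lborel. indicator (unit_box a) x *\<^sub>R h x) = (LINT x|lborel. indicator (unit_box (a + v)) x *\<^sub>R h x)"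
      by (rule integral_periodic_unit_box[OF that(1-3)])
    also have "\<dots> = (LINT x|lborel. indicator (unit_box (a + v)) (x + v) *\<^sub>R h (x + v))"
      by (rule lborel_integral_shift[symmetric]) measurable
    also have "\<dots> = (LINT x|lborel. - (indicator (unit_box a) x *\<^sub>R h x))"
      by (rule Bochner_Integration.integral_cong) (auto simp: that(4) unit_box_def indicator_def algebra_simps)
    finally show ?thesis by simp
  qed
  let ?I = "\<lambda>x. indicator (unit_box a) x *\<^sub>R expo (lattice n) x"
  have int: "integrable lborel ?I" by (rule integrable_unit_box[where B = 1]) auto
  have "Re (LINT x|lborel. ?I x) = (LINT x|lborel. indicator (unit_box a) x *\<^sub>R Re (expo (lattice n) x))"
    using integral_Re[OF int] by simp
  also have "\<dots> = 0"
    by (rule zero) (use abs_Re_le_cmod[of "expo (lattice n) _"] in \<open>auto simp: v expo_lattice_periodic\<close>)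
  finally have 1: "Re (LINT x|lborel. ?I x) = 0" .
  have "Im (LINT x|lborel. ?I x) = (LINT x|lborel. indicator (unit_box a) x *\<^sub>R Im (expo (lattice n) x))"
    using integral_Im[OF int] by simp
  also have "\<dots> = 0"
    by (rule zero) (use abs_Im_le_cmod[of "expo (lattice n) _"] in \<open>auto simp: v expo_lattice_periodic\<close>)
  finally have 2: "Im (LINT x|lborel. ?I x) = 0" .
  from 1 2 False show ?thesis by (simp add: complex_eq_iff)
qed

section \<open>Fourier inversion on a unit cube\<close>

inductive trig_poly :: "(real^'d::finite \<Rightarrow> complex) \<Rightarrow> bool" where
  monom: "trig_poly (\<lambda>x. c * expo (lattice n) x)"
| add: "trig_poly S \<Longrightarrow> trig_poly T \<Longrightarrow> trig_poly (\<lambda>x. S x + T x)"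

lemma trig_poly_monom_mult: "trig_poly T \<Longrightarrow> trig_poly (\<lambda>x. c * expo (lattice n) x * T x)"
proof (induction rule: trig_poly.induct)
  case (monom d m)
  have "(\<lambda>x. c * expo (lattice n) x * (d * expo (lattice m) x)) = (\<lambda>x. (c * d) * expo (lattice (n + m)) x)"
    by (simp add: lattice_add expo_add mult_ac)
  then show ?case using trig_poly.monom[of "c * d" "n + m"] by (simp only:)
next
  case (add S T)
  then show ?case using trig_poly.add[of "\<lambda>x. c * expo (lattice n) x * S x"]
    by (simp add: distrib_left)
qed

lemma trig_poly_mult: "trig_poly S \<Longrightarrow> trig_poly T \<Longrightarrow> trig_poly (\<lambda>x. S x * T x)"
proof (induction rule: trig_poly.induct)
  case (monom c n)
  then show ?case by (rule trig_poly_monom_mult)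
next
  case (add S S')
  then show ?case using trig_poly.add[of "\<lambda>x. S x * T x"] by (simp add: distrib_right)
qed

lemma trig_poly_const: "trig_poly (\<lambda>_. c)"
  using trig_poly.monom[of c 0] by simp

lemma trig_poly_power: "trig_poly T \<Longrightarrow> trig_poly (\<lambda>x. T x ^ N)"
proof (induction N)
  case (Suc N)
  then show ?case using trig_poly_mult[of T "\<lambda>x. T x ^ N"] by simp
qed (simp add: trig_poly_const)

lemma trig_poly_sum:
  "finite I \<Longrightarrow> (\<And>i. i \<in> I \<Longrightarrow> trig_poly (T i)) \<Longrightarrow> trig_poly (\<lambda>x. \<Sum>i\<in>I. T i x)"
proof (induction I rule: finite_induct)
  case (insert i I)
  then show ?case using trig_poly.add[of "T i" "\<lambda>x. \<Sum>i\<in>I. T i x"] by simp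
qed (simp add: trig_poly_const)

text \<open>The summands of the peaking kernel in the uniqueness theorem.\<close>

lemma trig_poly_cos: "trig_poly (\<lambda>x. of_real (cos (2 * pi * (x $ i - p $ i))))"
proof -
  let ?e = "axis i 1 :: int^'a"
  have l: "lattice ?e = axis i 1" by (auto simp: lattice_def axis_def vec_eq_iff)
  have "of_real (cos (2 * pi * (x $ i - p $ i))) =
     (expo (lattice ?e) (- p) / 2) * expo (lattice ?e) x + (expo (lattice (- ?e)) (- p) / 2) * expo (lattice (- ?e)) x" for x
  proof -
    let ?t = "2 * pi * (x $ i - p $ i)"
    have "expo (lattice ?e) (- p) * expo (lattice ?e) x = cis ?t"
      "expo (lattice (- ?e)) (- p) * expo (lattice (- ?e)) x = cis (- ?t)"
      unfolding expo_add_right[symmetric] by (simp_all add: expo_eq_cis lattice_minus l inner_axis' algebra_simps)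
    moreover have "of_real (cos ?t) = (cis ?t + cis (- ?t)) / 2" by (simp add: complex_eq_iff)
    ultimately show ?thesis by (simp add: add_divide_distrib)
  qed
  then show ?thesis by (simp only:) (rule trig_poly.add[OF trig_poly.monom trig_poly.monom])
qed

lemma integral_trig_poly_eq_0:
  fixes g :: "real^'d::finite \<Rightarrow> complex"
  assumes g: "integrable lborel g" and 0: "\<And>n. (LINT x|lborel. g x * expo (lattice n) x) = 0"
    and "trig_poly T"
  shows "integrable lborel (\<lambda>x. g x * T x) \<and> (LINT x|lborel. g x * T x) = 0"
  using \<open>trig_poly T\<close>
proof induction
  case (monom c n)
  have i: "integrable lborel (\<lambda>x. g x * expo (lattice n) x)"
    by (rule Bochner_Integration.integrable_bound[OF g])
      (use g in \<open>auto simp: norm_mult\<close>)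
  have "(\<lambda>x. g x * (c * expo (lattice n) x)) = (\<lambda>x. c * (g x * expo (lattice n) x))" by (simp add: mult_ac)
  then show ?case using i 0 by simp
next
  case (add S T)
  then show ?case by (simp add: distrib_left Bochner_Integration.integral_add)
qed

text \<open>With \<open>d = CARD('d)\<close>, the trigonometric polynomial \<open>u x = (\<Sum>i. cos (2 * pi * (x $ i - p $ i)))\<close> attains its maximum
  \<open>d\<close> on the closed cube only at \<open>p\<close>. For small \<open>c\<close>, the even powers of \<open>u + c\<close> therefore concentrate at \<open>p\<close>:
  they exceed \<open>(d + c / 2) ^ (2 * N)\<close> near \<open>p\<close> and are at most \<open>(d - c) ^ (2 * N)\<close> away from it. If \<open>g p\<close> were not \<open>0\<close>,
  the integral of \<open>g\<close> against a high power could not vanish. The maximum is unique because \<open>p\<close> is an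
  interior point, so that no other point of the closed cube is congruent to it modulo the lattice.\<close>

lemma trig_uniqueness:
  fixes g :: "real^'d::finite \<Rightarrow> complex"
  assumes meas [measurable]: "g \<in> borel_measurable borel"
    and B: "\<And>x. norm (g x) \<le> B"
    and p: "\<And>i. a $ i < p $ i \<and> p $ i < a $ i + 1" and cont: "isCont g p"
    and orth: "\<And>n. (LINT x|lborel. (indicator (unit_box a) x *\<^sub>R g x) * expo (lattice n) x) = 0"
  shows "g p = 0"
proof (rule ccontr)
  assume gp: "g p \<noteq> 0"
  define G where "G x = Re (g x / g p)" for x
  define B' where "B' = B / norm (g p)"
  have GB: "\<bar>G x\<bar> \<le> B'" for x
  proof -
    have "\<bar>G x\<bar> \<le> norm (g x / g p)" unfolding G_def by (rule abs_Re_le_cmod)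
    also have "\<dots> \<le> B'" unfolding B'_def norm_divide by (intro divide_right_mono B) auto
    finally show ?thesis .
  qed
  have B'0: "B' \<ge> 0" using GB[of p] by linarith
  have [measurable]: "G \<in> borel_measurable borel" unfolding G_def by measurable
  have "isCont G p" unfolding G_def by (rule continuous_Re[OF isCont_divide[OF cont continuous_const gp]])
  moreover have "G p = 1" unfolding G_def using gp by simp
  ultimately have "\<forall>\<^sub>F x in nhds p. G x > 1 / 2"
    using order_tendstoD(1)[of G "G p" "nhds p" "1/2"] by (simp add: isCont_def tendsto_nhds_iff)
  moreover have "open (box a (a + 1))" "p \<in> box a (a + 1)" using p by (auto simp: mem_box_cart)
  then have "\<forall>\<^sub>F x in nhds p. x \<in> box a (a + 1)" by (rule eventually_nhds_in_open)
  ultimately have "\<forall>\<^sub>F x in nhds p. G x > 1 / 2 \<and> x \<in> box a (a + 1)" by (rule eventually_conj)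
  then obtain \<delta> where \<delta>: "\<delta> > 0" "\<And>x. dist x p < \<delta> \<Longrightarrow> G x > 1 / 2 \<and> x \<in> box a (a + 1)"
    unfolding eventually_nhds_metric by blast
  have sub: "box a (a + 1) \<subseteq> unit_box a" "unit_box a \<subseteq> cbox a (a + 1)"
    by (auto simp: unit_box_def mem_box_cart less_imp_le)
  define d where "d = real CARD('d)"
  define u where "u x = (\<Sum>i\<in>UNIV. cos (2 * pi * (x $ i - p $ i)))" for x :: "real^'d"
  have cu: "continuous_on S u" for S unfolding u_def by (intro continuous_intros)
  have u_le: "u x \<le> d" for x
    using sum_mono[of UNIV "\<lambda>i. cos (2 * pi * (x $ i - p $ i))" "\<lambda>_. 1"] unfolding u_def d_def by simp
  have u_ge: "u x \<ge> - d" for x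
    using sum_mono[of UNIV "\<lambda>_. -1" "\<lambda>i. cos (2 * pi * (x $ i - p $ i))"] unfolding u_def d_def by simp
  have u_less: "u x < d" if x: "x \<in> cbox a (a + 1)" "x \<noteq> p" for x
  proof -
    obtain i where i: "x $ i \<noteq> p $ i" using x(2) by (auto simp: vec_eq_iff)
    have "cos (2 * pi * (x $ i - p $ i)) \<noteq> 1"
    proof
      assume "cos (2 * pi * (x $ i - p $ i)) = 1"
      then obtain k :: int where k: "2 * pi * (x $ i - p $ i) = real_of_int k * 2 * pi" unfolding cos_one_2pi_int by blast
      then have xk: "x $ i - p $ i = real_of_int k" by simp
      moreover have "\<bar>x $ i - p $ i\<bar> < 1" using x(1) p[of i] by (auto simp: mem_box_cart dest!: spec[of _ i])
      ultimately have "k = 0" by linarith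
      then show False using i xk by simp
    qed
    then have "cos (2 * pi * (x $ i - p $ i)) < 1" using cos_le_one order_less_le by blast
    then have "u x < (\<Sum>i\<in>(UNIV::'d set). 1)" unfolding u_def by (intro sum_strict_mono_ex1) auto
    then show ?thesis unfolding d_def by simp
  qed
  have d1: "d \<ge> 1" unfolding d_def using zero_less_card_finite[where 'a='d] by linarith
  define S where "S = cbox a (a + 1) - ball p \<delta>"
  have "compact S" unfolding S_def by (intro compact_diff) auto
  \<comment> \<open>Then \<open>\<bar>u + c\<bar> \<le> d - c\<close> on \<open>S\<close>; the condition \<open>c \<le> d\<close> keeps the right-hand side nonnegative.\<close>
  obtain c where c: "0 < c" "c \<le> d" "\<And>x. x \<in> S \<Longrightarrow> u x \<le> d - 2 * c"
  proof (cases "S = {}")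
    case True
    then show ?thesis using that[of d] d1 by simp
  next
    case False
    then obtain z where z: "z \<in> S" "\<And>x. x \<in> S \<Longrightarrow> u x \<le> u z"
      using continuous_attains_sup[OF \<open>compact S\<close> False cu] by blast
    have "u z < d" using z(1) \<delta>(1) unfolding S_def by (intro u_less) auto
    then show ?thesis using z(2) u_ge[of z] by (intro that[of "(d - u z) / 2"]) (fastforce simp: field_simps)+
  qed
  have "u p = d" unfolding u_def d_def by simp
  moreover have "isCont u p" using cu[of UNIV] by (simp add: continuous_on_eq_continuous_at)
  ultimately have "\<forall>\<^sub>F x in nhds p. u x > d - c / 2"
    using order_tendstoD(1)[of u "u p" "nhds p" "d - c/2"] c(1)
    by (simp add: isCont_def tendsto_nhds_iff)
  then obtain \<delta>' where \<delta>': "\<delta>' > 0" "\<And>x. dist x p < \<delta>' \<Longrightarrow> u x > d - c / 2"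
    unfolding eventually_nhds_metric by blast
  define \<epsilon> where "\<epsilon> = min \<delta> \<delta>'"
  have \<epsilon>: "\<epsilon> > 0" unfolding \<epsilon>_def using \<delta>(1) \<delta>'(1) by simp
  define V where "V = measure lborel (ball p \<epsilon>)"
  have V: "V > 0" unfolding V_def using \<epsilon> by (simp add: content_ball_pos)
  have key: "1 / 2 * (d + c / 2) ^ (2 * N) * V \<le> B' * (d - c) ^ (2 * N)" for N
  proof -
    have T: "trig_poly (\<lambda>x. (of_real (u x + c) :: complex) ^ (2 * N))"
      unfolding u_def of_real_add of_real_sum
      by (intro trig_poly_power trig_poly.add trig_poly_sum trig_poly_cos trig_poly_const) auto
    have ig: "integrable lborel (\<lambda>x. indicator (unit_box a) x *\<^sub>R g x)"
      by (rule integrable_unit_box[OF meas B])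
    let ?h = "\<lambda>x. (indicator (unit_box a) x *\<^sub>R g x) * of_real (u x + c) ^ (2 * N)"
    have h: "integrable lborel ?h" "(LINT x|lborel. ?h x) = 0"
      using integral_trig_poly_eq_0[OF ig orth T] by auto
    have "integrable lborel (\<lambda>x. Re (?h x / g p))" by (intro integrable_Re integrable_divide h)
    moreover have "Re (?h x / g p) = indicator (unit_box a) x * (G x * (u x + c) ^ (2 * N))" for x
    proof -
      have "?h x / g p = of_real (indicator (unit_box a) x * (u x + c) ^ (2 * N)) * (g x / g p)"
        by (simp add: scaleR_conv_of_real)
      then have "Re (?h x / g p) = indicator (unit_box a) x * (u x + c) ^ (2 * N) * Re (g x / g p)"
        by (simp only: times_complex.sel Re_complex_of_real Im_complex_of_real mult_zero_left diff_zero)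
      then show ?thesis unfolding G_def by (simp only: mult_ac)
    qed
    moreover have "(LINT x|lborel. Re (?h x / g p)) = 0"
      using integral_Re[OF integrable_divide[OF h(1)], of "g p"] h(2) gp by simp
    ultimately have k: "integrable lborel (\<lambda>x. indicator (unit_box a) x * (G x * (u x + c) ^ (2 * N)))"
      "(LINT x|lborel. indicator (unit_box a) x * (G x * (u x + c) ^ (2 * N))) = 0" by simp_all
    let ?P = "1 / 2 * (d + c / 2) ^ (2 * N)" and ?M = "B' * (d - c) ^ (2 * N)"
    have ib: "integrable lborel (indicator (ball p \<epsilon>) :: _ \<Rightarrow> real)"
      by (intro integrable_real_indicator) (simp_all add: emeasure_bounded_finite[OF bounded_ball, unfolded infinity_ennreal_def])
    have iu: "integrable lborel (indicator (unit_box a) :: _ \<Rightarrow> real)"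
      by (intro integrable_real_indicator) (simp_all add: emeasure_unit_box)
    have "(LINT x|lborel. ?P * indicator (ball p \<epsilon>) x - ?M * indicator (unit_box a) x)
      \<le> (LINT x|lborel. indicator (unit_box a) x * (G x * (u x + c) ^ (2 * N)))"
    proof (rule integral_mono[OF Bochner_Integration.integrable_diff[OF integrable_mult_right[OF ib] integrable_mult_right[OF iu]] k(1)])
      fix x
      have M0: "?M \<ge> 0" using B'0 by simp
      have e0: "(u x + c) ^ (2 * N) \<ge> 0" by simp
      consider "dist x p < \<epsilon>" | "\<not> dist x p < \<epsilon>" "dist x p < \<delta>" | "\<not> dist x p < \<epsilon>" "\<not> dist x p < \<delta>" "x \<in> unit_box a"
        | "\<not> dist x p < \<epsilon>" "x \<notin> unit_box a" by blast
      then show "?P * indicator (ball p \<epsilon>) x - ?M * indicator (unit_box a) x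
         \<le> indicator (unit_box a) x * (G x * (u x + c) ^ (2 * N))"
      proof cases
        case 1
        then have "G x > 1 / 2" "x \<in> unit_box a" "u x > d - c / 2"
          using \<delta>(2)[of x] \<delta>'(2)[of x] sub unfolding \<epsilon>_def by auto
        moreover have "(d + c / 2) ^ (2 * N) \<le> (u x + c) ^ (2 * N)"
          using \<open>u x > d - c / 2\<close> c d1 by (intro power_mono) auto
        ultimately have "?P \<le> G x * (u x + c) ^ (2 * N)" using c d1 by (intro mult_mono) auto
        then show ?thesis using 1 \<open>x \<in> unit_box a\<close> M0 by (simp add: dist_commute)
      next
        case 2
        then have "G x > 1 / 2" "x \<in> unit_box a" using \<delta>(2)[of x] sub by auto
        then have "0 \<le> G x * (u x + c) ^ (2 * N)" by (intro mult_nonneg_nonneg e0) simp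
        then show ?thesis using 2 \<open>x \<in> unit_box a\<close> M0 by (simp add: dist_commute)
      next
        case 3
        then have "x \<in> S" using sub unfolding S_def by (auto simp: dist_commute)
        then have "\<bar>u x + c\<bar> \<le> d - c" using c(3)[of x] u_ge[of x] by linarith
        then have "\<bar>u x + c\<bar> ^ (2 * N) \<le> (d - c) ^ (2 * N)" by (intro power_mono) auto
        then have "\<bar>G x * (u x + c) ^ (2 * N)\<bar> \<le> ?M"
          unfolding abs_mult using GB[of x] B'0 by (intro mult_mono) (auto simp: power_abs)
        then show ?thesis using 3 by (simp add: dist_commute)
      next
        case 4
        then show ?thesis by (simp add: dist_commute)
      qed
    qed
    also have "\<dots> = 0" by (rule k(2))
    also have "(LINT x|lborel. ?P * indicator (ball p \<epsilon>) x - ?M * indicator (unit_box a) x) = ?P * V - ?M"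
      using Bochner_Integration.integral_diff[OF integrable_mult_right[OF ib, of ?P] integrable_mult_right[OF iu, of ?M]]
      by (simp add: V_def measure_unit_box)
    finally show ?thesis by simp
  qed
  define r where "r = ((d - c) / (d + c / 2))\<^sup>2"
  have r: "0 \<le> r" "r < 1"
  proof -
    have "\<bar>(d - c) / (d + c / 2)\<bar> < 1" using c d1 by (simp add: field_simps)
    then show "r < 1" unfolding r_def by (simp only: abs_square_less_1)
  qed (simp add: r_def)
  have "1 / 2 * V \<le> B' * r ^ N" for N
  proof -
    define P where "P = (d + c / 2) ^ (2 * N)"
    have P: "P > 0" unfolding P_def using c d1 by simp
    have "1 / 2 * V = 1 / 2 * P * V / P" using P by simp
    also have "\<dots> \<le> B' * (d - c) ^ (2 * N) / P"
      using key[of N] P unfolding P_def by (intro divide_right_mono) auto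
    also have "\<dots> = B' * r ^ N" unfolding r_def P_def by (simp add: power_divide power_mult)
    finally show ?thesis .
  qed
  moreover have "(\<lambda>N. B' * r ^ N) \<longlonglongrightarrow> B' * 0"
    by (intro tendsto_mult tendsto_const LIMSEQ_power_zero) (use r in simp)
  ultimately have "1 / 2 * V \<le> B' * 0" by (intro LIMSEQ_le_const) auto
  then show False using V by simp
qed

text \<open>Absolute convergence makes the series converge uniformly, so it may be integrated term by
  term against an integrable function.\<close>

lemma expo_series:
  fixes r :: "int^'d::finite \<Rightarrow> complex"
  assumes "(\<lambda>m. norm (r m)) summable_on UNIV"
  defines "H \<equiv> \<lambda>x. \<Sum>\<^sub>\<infinity>m. r m * expo (- lattice m) x"
  shows "((\<lambda>m. r m * expo (- lattice m) x) has_sum H x) UNIV"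
    and "continuous_on UNIV H" and "norm (H x) \<le> (\<Sum>\<^sub>\<infinity>m. norm (r m))"
    and "integrable lborel g \<Longrightarrow> integrable lborel (\<lambda>x. H x * g x)"
    and "integrable lborel g \<Longrightarrow>
      ((\<lambda>m. r m * (LINT x|lborel. expo (- lattice m) x * g x)) has_sum (LINT x|lborel. H x * g x)) UNIV"
proof -
  have abs: "(\<lambda>m. norm (r m * expo (- lattice m) x)) summable_on UNIV" for x
    using assms(1) by (simp add: norm_mult)
  show "((\<lambda>m. r m * expo (- lattice m) x) has_sum H x) UNIV"
    unfolding H_def by (rule has_sum_infsum[OF abs_summable_summable[OF abs]])
  have ul: "uniform_limit UNIV (\<lambda>F x. \<Sum>m\<in>F. r m * expo (- lattice m) x) H (finite_subsets_at_top UNIV)"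
    unfolding H_def by (rule Weierstrass_m_test_general[OF _ assms(1)]) (simp add: norm_mult)
  show H: "continuous_on UNIV H"
    by (rule uniform_limit_theorem[OF _ ul])
      (auto intro!: always_eventually continuous_intros continuous_expo)
  have Hm [measurable]: "H \<in> borel_measurable borel" by (rule borel_measurable_continuous_onI[OF H])
  show bound: "norm (H x) \<le> (\<Sum>\<^sub>\<infinity>m. norm (r m))" for x
    unfolding H_def using norm_infsum_bound[OF abs[of x]] by (simp add: norm_mult)
  let ?R = "\<Sum>\<^sub>\<infinity>m. norm (r m)"
  have R0: "?R \<ge> 0" by (simp add: infsum_nonneg)
  have iH: "integrable lborel (\<lambda>x. H x * g x)" if g: "integrable lborel g" for g
  proof (rule Bochner_Integration.integrable_bound[OF integrable_mult_right[OF integrable_norm[OF g], of ?R]])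
    show "(\<lambda>x. H x * g x) \<in> borel_measurable lborel" using g by measurable
    show "AE x in lborel. norm (H x * g x) \<le> norm (?R * norm (g x))"
      using bound R0 by (auto simp: norm_mult intro!: mult_right_mono)
  qed
  then show "integrable lborel g \<Longrightarrow> integrable lborel (\<lambda>x. H x * g x)" .
  assume g: "integrable lborel g"
  have ie: "integrable lborel (\<lambda>x. expo \<xi> x * g x)" for \<xi>
    by (rule Bochner_Integration.integrable_bound[OF g]) (use g in \<open>auto simp: norm_mult\<close>)
  show "((\<lambda>m. r m * (LINT x|lborel. expo (- lattice m) x * g x)) has_sum (LINT x|lborel. H x * g x)) UNIV"
    unfolding has_sum_def
  proof (rule tendstoI)
    fix e :: real assume e: "e > 0"
    define I where "I = (LINT x|lborel. norm (g x))"
    have I: "I \<ge> 0" unfolding I_def by simp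
    define e' where "e' = e / (2 * (I + 1))"
    have e': "e' > 0" unfolding e'_def using e I by simp
    have "\<forall>\<^sub>F F in finite_subsets_at_top UNIV. \<forall>x\<in>UNIV. dist (\<Sum>m\<in>F. r m * expo (- lattice m) x) (H x) < e'"
      using ul e' unfolding uniform_limit_iff by blast
    then show "\<forall>\<^sub>F F in finite_subsets_at_top UNIV.
       dist (\<Sum>m\<in>F. r m * (LINT x|lborel. expo (- lattice m) x * g x)) (LINT x|lborel. H x * g x) < e"
    proof eventually_elim
      case (elim F)
      have s: "(\<Sum>m\<in>F. r m * (LINT x|lborel. expo (- lattice m) x * g x)) = (LINT x|lborel. (\<Sum>m\<in>F. r m * (expo (- lattice m) x * g x)))"
        using ie by (subst Bochner_Integration.integral_sum) auto
      have fin: "integrable lborel (\<lambda>x. (\<Sum>m\<in>F. r m * (expo (- lattice m) x * g x)))"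
        using ie by (intro Bochner_Integration.integrable_sum integrable_mult_right)
      have "dist (\<Sum>m\<in>F. r m * (LINT x|lborel. expo (- lattice m) x * g x)) (LINT x|lborel. H x * g x)
         = norm (LINT x|lborel. (\<Sum>m\<in>F. r m * (expo (- lattice m) x * g x)) - H x * g x)"
        unfolding s dist_norm by (subst Bochner_Integration.integral_diff[OF fin iH[OF g]]) simp
      also have "\<dots> \<le> (LINT x|lborel. e' * norm (g x))"
      proof (rule order_trans[OF integral_norm_bound], rule integral_mono)
        show "integrable lborel (\<lambda>x. norm ((\<Sum>m\<in>F. r m * (expo (- lattice m) x * g x)) - H x * g x))"
          by (rule integrable_norm[OF Bochner_Integration.integrable_diff[OF fin iH[OF g]]])
        show "norm ((\<Sum>m\<in>F. r m * (expo (- lattice m) x * g x)) - H x * g x) \<le> e' * norm (g x)" for x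
        proof -
          have "(\<Sum>m\<in>F. r m * (expo (- lattice m) x * g x)) - H x * g x = ((\<Sum>m\<in>F. r m * expo (- lattice m) x) - H x) * g x"
            by (simp add: sum_distrib_right left_diff_distrib mult.assoc)
          then show ?thesis using elim[rule_format, of x]
            by (simp add: norm_mult dist_norm mult_right_mono less_imp_le)
        qed
      qed (use g in simp)
      also have "\<dots> = e' * I" unfolding I_def by simp
      also have "\<dots> < e" unfolding e'_def using e I by (simp add: field_simps add_nonneg_pos)
      finally show ?case .
    qed
  qed
qed

text \<open>The Fourier series of \<open>\<phi>\<close> and \<open>\<phi>\<close> itself have the same Fourier coefficients over a unit cube that contains
  the support of \<open>\<phi>\<close>, hence they agree in its interior.\<close>

lemma fourier_inversion:
  fixes \<phi> :: "real^'d::finite \<Rightarrow> complex"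
  assumes \<phi>: "\<phi> \<in> test_functions (cube 1 x0)" and x: "x \<in> cube 1 x0"
  shows "((\<lambda>m. ft \<phi> (lattice m) * expo (- lattice m) x) has_sum \<phi> x) UNIV"
proof -
  define r where "r m = ft \<phi> (lattice m)" for m
  obtain C where C: "\<And>\<xi>. norm (ft \<phi> \<xi>) \<le> C * jbracket \<xi> powr (- (2 * real CARD('d)))"
    using ft_decay[OF \<phi>] by blast
  have abs: "(\<lambda>m. norm (r m)) summable_on UNIV"
    by (rule summable_decay_mult[where C = C and R = "2 * real CARD('d)"]) (use C in \<open>auto simp: r_def\<close>)
  note ES = expo_series[OF abs]
  define H where "H x = (\<Sum>\<^sub>\<infinity>m. r m * expo (- lattice m) x)" for x
  note ES = ES[folded H_def]
  \<comment> \<open>The open cube with centre \<open>x0\<close> is the interior of the half-open one with corner \<open>a\<close>.\<close>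
  define a where "a = x0 - (\<chi> i. 1 / 2)"
  have cube: "y \<in> cube 1 x0 \<longleftrightarrow> (\<forall>i. a $ i < y $ i \<and> y $ i < a $ i + 1)" for y
    unfolding cube_def a_def by (auto simp: algebra_simps)
  then have cube_sub: "cube 1 x0 \<subseteq> unit_box a" unfolding unit_box_def by (auto simp: less_imp_le)
  have "\<phi> x - H x = 0"
  proof (rule trig_uniqueness[where g = "\<lambda>x. \<phi> x - H x"])
    show "(\<lambda>x. \<phi> x - H x) \<in> borel_measurable borel"
      by (intro borel_measurable_continuous_onI continuous_intros test_continuous[OF \<phi>] ES(2))
    have "norm (\<phi> y) \<le> (SUP x. norm (\<phi> x))" for y by (rule test_norm_le_SUP[OF \<phi>])
    then show "norm (\<phi> y - H y) \<le> (SUP x. norm (\<phi> x)) + (\<Sum>\<^sub>\<infinity>m. norm (r m))" for y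
      using ES(3)[of y] norm_triangle_ineq4[of "\<phi> y" "H y"] by (meson add_mono order_trans)
    show "a $ i < x $ i \<and> x $ i < a $ i + 1" for i using x cube by blast
    have "continuous_on UNIV (\<lambda>x. \<phi> x - H x)" by (intro continuous_intros test_continuous[OF \<phi>] ES(2))
    then show "isCont (\<lambda>x. \<phi> x - H x) x" by (simp add: continuous_on_eq_continuous_at)
    fix n :: "int^'d"
    define g where "g x = indicator (unit_box a) x *\<^sub>R expo (lattice n) x" for x
    have g: "integrable lborel g" unfolding g_def by (rule integrable_unit_box[where B = 1]) auto
    have "((\<lambda>m. r m * (LINT x|lborel. expo (- lattice m) x * g x)) has_sum (LINT x|lborel. H x * g x)) UNIV"
      by (rule ES(5)[OF g])
    moreover have "(LINT x|lborel. expo (- lattice m) x * g x) = (if m = n then 1 else 0)" for m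
    proof -
      have "expo (- lattice m) x * g x = indicator (unit_box a) x *\<^sub>R expo (lattice (n - m)) x" for x
        unfolding g_def lattice_diff using expo_add[of "lattice n" "- lattice m" x] by (simp add: mult.commute)
      then show ?thesis by (simp only: integral_unit_box_expo) auto
    qed
    moreover have "((\<lambda>m. r m * (if m = n then 1 else 0)) has_sum r n) UNIV"
      by (rule has_sum_finite_neutralI[of "{n}"]) auto
    ultimately have Hn: "(LINT x|lborel. H x * g x) = r n" using has_sum_unique by fastforce
    have \<phi>g: "expo (lattice n) x * \<phi> x = \<phi> x * g x" for x
      using support_subset_supp[of \<phi> x] test_functionsD(3)[OF \<phi>] cube_sub
      unfolding g_def by (cases "\<phi> x = 0") auto
    have i\<phi>: "integrable lborel (\<lambda>x. \<phi> x * g x)"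
      using test_integrable[OF test_expo[OF \<phi>], of "lattice n"] unfolding \<phi>g .
    have "(LINT x|lborel. (indicator (unit_box a) x *\<^sub>R (\<phi> x - H x)) * expo (lattice n) x)
       = (LINT x|lborel. \<phi> x * g x - H x * g x)"
      by (rule Bochner_Integration.integral_cong) (auto simp: g_def algebra_simps)
    also have "\<dots> = (LINT x|lborel. \<phi> x * g x) - (LINT x|lborel. H x * g x)"
      by (rule Bochner_Integration.integral_diff[OF i\<phi> ES(4)[OF g]])
    also have "\<dots> = 0" unfolding Hn r_def ft_def \<phi>g by simp
    finally show "(LINT x|lborel. (indicator (unit_box a) x *\<^sub>R (\<phi> x - H x)) * expo (lattice n) x) = 0" .
  qed
  then show ?thesis using ES(1)[of x] unfolding r_def by simp
qed

text \<open>Products become convolutions over the lattice. The first factor may be replaced by its Fourier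
  series since the second one vanishes off the cube.\<close>

lemma ft_mult_has_sum:
  fixes \<theta> \<Psi> :: "real^'d::finite \<Rightarrow> complex"
  assumes \<theta>: "\<theta> \<in> test_functions (cube 1 x0)" and \<Psi>: "\<Psi> \<in> test_functions (cube 1 x0)"
  shows "((\<lambda>m. ft \<theta> (lattice m) * ft \<Psi> (\<xi> - lattice m)) has_sum ft (\<lambda>x. \<theta> x * \<Psi> x) \<xi>) UNIV"
proof -
  obtain C where C: "\<And>\<xi>. norm (ft \<theta> \<xi>) \<le> C * jbracket \<xi> powr (- (2 * real CARD('d)))"
    using ft_decay[OF \<theta>] by blast
  have abs: "(\<lambda>m. norm (ft \<theta> (lattice m))) summable_on UNIV"
    by (rule summable_decay_mult[where C = C and R = "2 * real CARD('d)"]) (use C in auto)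
  have g: "integrable lborel (\<lambda>x. expo \<xi> x * \<Psi> x)" by (rule test_integrable[OF test_expo[OF \<Psi>]])
  have "(LINT x|lborel. (\<Sum>\<^sub>\<infinity>m. ft \<theta> (lattice m) * expo (- lattice m) x) * (expo \<xi> x * \<Psi> x)) = ft (\<lambda>x. \<theta> x * \<Psi> x) \<xi>"
    unfolding ft_def[of "\<lambda>x. \<theta> x * \<Psi> x"]
  proof (rule Bochner_Integration.integral_cong)
    fix x
    show "(\<Sum>\<^sub>\<infinity>m. ft \<theta> (lattice m) * expo (- lattice m) x) * (expo \<xi> x * \<Psi> x) = expo \<xi> x * (\<theta> x * \<Psi> x)"
    proof (cases "\<Psi> x = 0")
      case False
      then have "x \<in> cube 1 x0" using support_subset_supp test_functionsD(3)[OF \<Psi>] by blast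
      then show ?thesis using infsumI[OF fourier_inversion[OF \<theta>]] by simp
    qed simp
  qed simp
  moreover have "(LINT x|lborel. expo (- lattice m) x * (expo \<xi> x * \<Psi> x)) = ft \<Psi> (\<xi> - lattice m)" for m
    unfolding ft_def using expo_add[of \<xi> "- lattice m"] by (simp add: mult_ac)
  ultimately show ?thesis using expo_series(5)[OF abs g] by simp
qed

section \<open>Fourier coefficients of localized distributions\<close>

lemma ft_modulate: "ft (\<lambda>x. \<Psi> x * expo \<zeta> x) \<xi> = ft \<Psi> (\<xi> + \<zeta>)"
  unfolding ft_def expo_add by (simp add: mult_ac)

lemma test_expo': "\<phi> \<in> test_functions U \<Longrightarrow> (\<lambda>x. \<phi> x * expo \<xi> x) \<in> test_functions U"
  by (rule test_functions_mult'[OF smooth_expo])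

lemma fourier_series_modulated:
  assumes "has_fourier_series f c" "\<Psi> \<in> test_functions U"
  shows "((\<lambda>n. c n * ft \<Psi> (lattice n - \<xi>)) has_sum f (\<lambda>x. \<Psi> x * expo (- \<xi>) x)) UNIV"
proof -
  have "(fourier_term c (\<lambda>x. \<Psi> x * expo (- \<xi>) x) has_sum f (\<lambda>x. \<Psi> x * expo (- \<xi>) x)) UNIV"
    using assms(1) test_functions_UNIV[OF test_expo'[OF assms(2)]] unfolding has_fourier_series_def by blast
  then show ?thesis unfolding fourier_term_ft ft_modulate by simp
qed

definition poly_bounded :: "(int^'d::finite \<Rightarrow> complex) \<Rightarrow> bool" where
  "poly_bounded c \<longleftrightarrow> (\<exists>C\<ge>0. \<exists>M\<ge>0. \<forall>n. norm (c n) \<le> C * weight n powr M)"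

lemma has_sum_norm_le:
  fixes f :: "'a \<Rightarrow> 'b::banach"
  assumes "(f has_sum S) A" "\<And>x. x \<in> A \<Longrightarrow> norm (f x) \<le> g x" "g summable_on A"
  shows "norm S \<le> (\<Sum>\<^sub>\<infinity>x\<in>A. g x)"
  by (rule norm_infsum_le[OF assms(1) has_sum_infsum[OF assms(3)] assms(2)])

text \<open>The sum \<open>\<Sum>n. c n * ft \<Psi> (lattice n - \<xi>)\<close> is a convolution of a sequence of polynomial growth with a rapidly
  decreasing function; Peetre's inequality moves the growth to \<open>\<xi>\<close>.\<close>

lemma fourier_coefficient_growth:
  fixes \<Psi> :: "real^'d::finite \<Rightarrow> complex"
  assumes f: "has_fourier_series f c" and c: "poly_bounded c" and \<Psi>: "\<Psi> \<in> test_functions U"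
  shows "\<exists>C\<ge>0. \<exists>M\<ge>0. \<forall>\<xi>. norm (f (\<lambda>x. \<Psi> x * expo (- \<xi>) x)) \<le> C * jbracket \<xi> powr M"
proof -
  obtain C1 M where C1: "C1 \<ge> 0" "M \<ge> 0" "\<And>n. norm (c n) \<le> C1 * weight n powr M"
    using c unfolding poly_bounded_def by blast
  define D where "D = 2 * real CARD('d)"
  define s where "s = M + D"
  have s0: "s \<ge> 0" unfolding s_def D_def using C1 by simp
  obtain C2 where C2: "C2 \<ge> 0" "\<And>\<xi>. norm (ft \<Psi> \<xi>) \<le> C2 * jbracket \<xi> powr (- s)"
    using ft_decay[OF \<Psi>] by blast
  have sm: "(\<lambda>n::int^'d. weight n powr (- D)) summable_on UNIV"
    by (rule summable_lattice_powr) (simp add: D_def)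
  define Z where "Z = (\<Sum>\<^sub>\<infinity>n::int^'d. weight n powr (- D))"
  have Z0: "Z \<ge> 0" unfolding Z_def by (rule infsum_nonneg) simp
  have "norm (f (\<lambda>x. \<Psi> x * expo (- \<xi>) x)) \<le> (C1 * C2 * 2 powr s * Z) * jbracket \<xi> powr s" for \<xi>
  proof -
    have "norm (c n * ft \<Psi> (lattice n - \<xi>)) \<le> (C1 * C2 * 2 powr s * jbracket \<xi> powr s) * weight n powr (- D)" for n
    proof -
      have "jbracket (lattice n - \<xi>) powr (- s) \<le> 2 powr s * weight n powr (- s) * jbracket \<xi> powr s"
        using peetre[of "lattice n" "- \<xi>" "- s"] s0 by simp
      then have "norm (c n * ft \<Psi> (lattice n - \<xi>)) \<le> (C1 * weight n powr M) * (C2 * (2 powr s * weight n powr (- s) * jbracket \<xi> powr s))"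
        unfolding norm_mult using C1 C2(1) C2(2)[of "lattice n - \<xi>"]
        by (intro mult_mono order_trans[OF C2(2)] mult_left_mono mult_nonneg_nonneg) auto
      also have "\<dots> = (C1 * C2 * 2 powr s * jbracket \<xi> powr s) * (weight n powr M * weight n powr (- s))"
        by (simp only: mult_ac)
      also have "weight n powr M * weight n powr (- s) = weight n powr (- D)"
        unfolding s_def by (simp add: powr_add[symmetric])
      finally show ?thesis .
    qed
    then have "norm (f (\<lambda>x. \<Psi> x * expo (- \<xi>) x)) \<le> (\<Sum>\<^sub>\<infinity>n::int^'d. (C1 * C2 * 2 powr s * jbracket \<xi> powr s) * weight n powr (- D))"
      by (rule has_sum_norm_le[OF fourier_series_modulated[OF f \<Psi>] _ summable_on_cmult_right[OF sm]])
    then show ?thesis unfolding infsum_cmult_right' Z_def by (simp add: mult_ac)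
  qed
  moreover have "C1 * C2 * 2 powr s * Z \<ge> 0" using C1 C2 Z0 by simp
  ultimately show ?thesis using s0 by blast
qed

lemma ft_measurable [measurable]:
  assumes "\<Psi> \<in> test_functions U" shows "ft \<Psi> \<in> borel_measurable borel"
proof -
  have [measurable]: "\<Psi> \<in> borel_measurable borel" by (rule test_measurable[OF assms])
  have "(\<lambda>(\<xi>, x). expo \<xi> x * \<Psi> x) \<in> borel_measurable (borel \<Otimes>\<^sub>M lborel)"
    unfolding expo_def by measurable
  then show ?thesis unfolding ft_def[abs_def] by (rule lborel.borel_measurable_lebesgue_integral)
qed

lemma bij_nat_int_vec: "\<exists>g :: nat \<Rightarrow> int^'d::finite. bij g"
proof -
  have "inj (\<lambda>k::int. (\<chi> i. k) :: int^'d)" by (auto simp: inj_def vec_eq_iff)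
  then have "infinite (UNIV :: (int^'d) set)"
    using finite_subset[OF subset_UNIV] range_inj_infinite infinite_UNIV_int finite_imageD by blast
  then show ?thesis using bij_betw_from_nat_into[of "UNIV :: (int^'d) set"] by auto
qed

text \<open>A pointwise limit of partial sums of measurable functions. Measurability is needed for the
  decomposition of the integral over a cone into sums over translated lattices.\<close>

lemma fourier_coefficient_measurable:
  fixes \<Psi> :: "real^'d::finite \<Rightarrow> complex"
  assumes f: "has_fourier_series f c" and \<Psi>: "\<Psi> \<in> test_functions U"
  shows "(\<lambda>\<xi>. f (\<lambda>x. \<Psi> x * expo (- \<xi>) x)) \<in> borel_measurable borel"
proof -
  obtain g :: "nat \<Rightarrow> int^'d" where g: "bij g" using bij_nat_int_vec by blast
  note [measurable] = ft_measurable[OF \<Psi>]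
  show ?thesis
  proof (rule borel_measurable_LIMSEQ_metric)
    show "(\<lambda>\<xi>. \<Sum>i<n. c (g i) * ft \<Psi> (lattice (g i) - \<xi>)) \<in> borel_measurable borel" for n
      by measurable
    show "(\<lambda>n. \<Sum>i<n. c (g i) * ft \<Psi> (lattice (g i) - \<xi>)) \<longlonglongrightarrow> f (\<lambda>x. \<Psi> x * expo (- \<xi>) x)" for \<xi>
      using has_sum_imp_sums[OF has_sum_reindex_bij_betw[OF g, THEN iffD2, OF fourier_series_modulated[OF f \<Psi>]]]
      unfolding sums_def .
  qed
qed

text \<open>Expresses the coefficients of \<open>\<theta> \<Psi> f\<close> on the lattice through those of \<open>\<Psi> f\<close> on an arbitrary
  translate of the lattice: since \<open>\<theta> \<Psi> expo (- lattice k) = (expo t \<theta>) (\<Psi> expo (- (lattice k + t)))\<close>, it suffices to expand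
  \<open>expo t \<theta>\<close> in its Fourier series. The double series over \<open>n\<close> and \<open>m\<close> converges absolutely,
  because the decay of \<open>ft\<close> beats the growth of \<open>c\<close>.\<close>

lemma localized_coefficient_expansion:
  fixes \<theta> \<Psi> :: "real^'d::finite \<Rightarrow> complex"
  assumes f: "has_fourier_series f c" and c: "poly_bounded c"
    and \<theta>: "\<theta> \<in> test_functions (cube 1 x0)" and \<Psi>: "\<Psi> \<in> test_functions (cube 1 x0)"
  shows "((\<lambda>m. ft (\<lambda>x. expo t x * \<theta> x) (lattice m) * f (\<lambda>x. \<Psi> x * expo (- (lattice (k + m) + t)) x))
     has_sum f (\<lambda>x. \<theta> x * \<Psi> x * expo (- lattice k) x)) UNIV"
proof -
  define \<theta>t where "\<theta>t x = expo t x * \<theta> x" for x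
  have \<theta>t: "\<theta>t \<in> test_functions (cube 1 x0)" unfolding \<theta>t_def[abs_def] by (rule test_expo[OF \<theta>])
  define z where "z = lattice k + t"
  obtain C1 M where C1: "C1 \<ge> 0" "M \<ge> 0" "\<And>n. norm (c n) \<le> C1 * weight n powr M"
    using c unfolding poly_bounded_def by blast
  define D where "D = 2 * real CARD('d)"
  define s where "s = M + D"
  have s0: "s \<ge> 0" unfolding s_def D_def using C1 by simp
  obtain C2 where C2: "C2 \<ge> 0" "\<And>\<xi>. norm (ft \<Psi> \<xi>) \<le> C2 * jbracket \<xi> powr (- s)"
    using ft_decay[OF \<Psi>] by blast
  obtain C3 where C3: "C3 \<ge> 0" "\<And>\<xi>. norm (ft \<theta>t \<xi>) \<le> C3 * jbracket \<xi> powr (- (s + D))"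
    using ft_decay[OF \<theta>t] by blast
  define F where "F = (\<lambda>(n, m). c n * (ft \<theta>t (lattice m) * ft \<Psi> (lattice n - z - lattice m)))"
  have sm: "(\<lambda>n::int^'d. weight n powr (- D)) summable_on UNIV"
    by (rule summable_lattice_powr) (simp add: D_def)
  define K where "K = C1 * C2 * C3 * (2 powr s * 2 powr s * jbracket z powr s)"
  have F_le: "norm (F (n, m)) \<le> K * (weight n powr (- D) * weight m powr (- D))" for n m
  proof -
    have "jbracket (lattice n - z - lattice m) powr (- s) \<le> 2 powr s * weight n powr (- s) * jbracket (z + lattice m) powr s"
      using peetre[of "lattice n" "- (z + lattice m)" "- s"] s0 jbracket_minus[of "z + lattice m"]
      by (simp add: algebra_simps)
    also have "\<dots> \<le> 2 powr s * weight n powr (- s) * (2 powr s * jbracket z powr s * weight m powr s)"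
      using peetre[of z "lattice m" s] s0 by (intro mult_left_mono) auto
    finally have P: "jbracket (lattice n - z - lattice m) powr (- s) \<le> 2 powr s * weight n powr (- s) * (2 powr s * jbracket z powr s * weight m powr s)" .
    have "norm (F (n, m)) = norm (c n) * (norm (ft \<theta>t (lattice m)) * norm (ft \<Psi> (lattice n - z - lattice m)))"
      unfolding F_def by (simp add: norm_mult)
    also have "\<dots> \<le> (C1 * weight n powr M) * ((C3 * weight m powr (- (s + D))) *
       (C2 * (2 powr s * weight n powr (- s) * (2 powr s * jbracket z powr s * weight m powr s))))"
      using C1 C2 C3 P
      by (intro mult_mono order_trans[OF C2(2) mult_left_mono[OF P]] mult_nonneg_nonneg) auto
    also have "\<dots> = K * ((weight n powr M * weight n powr (- s))
        * (weight m powr (- (s + D)) * weight m powr s))"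
      unfolding K_def by (simp only: mult_ac)
    also have "weight n powr M * weight n powr (- s) = weight n powr (- D)"
      unfolding s_def by (simp add: powr_add[symmetric])
    also have "weight m powr (- (s + D)) * weight m powr s = weight m powr (- D)"
      by (simp add: powr_add[symmetric])
    finally show ?thesis .
  qed
  have "(\<lambda>(n, m). K * (weight n powr (- D) * weight m powr (- D))) summable_on (UNIV :: (int^'d) set) \<times> (UNIV :: (int^'d) set)"
  proof (rule summable_on_SigmaI)
    show "((\<lambda>m::int^'d. case (n, m) of (n, m) \<Rightarrow> K * (weight n powr (- D) * weight m powr (- D)))
       has_sum (K * (weight n powr (- D) * (\<Sum>\<^sub>\<infinity>m::int^'d. weight m powr (- D))))) UNIV" for n :: "int^'d"
      using has_sum_cmult_right[OF has_sum_cmult_right[OF has_sum_infsum[OF sm]]] by simp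
    show "(\<lambda>n::int^'d. K * (weight n powr (- D) * (\<Sum>\<^sub>\<infinity>m::int^'d. weight m powr (- D)))) summable_on UNIV"
      by (intro summable_on_cmult_right summable_on_cmult_left sm)
    show "0 \<le> (case (n, m) of (n, m) \<Rightarrow> K * (weight n powr (- D) * weight m powr (- D)))" for n m :: "int^'d"
      using C1 C2 C3 unfolding K_def by simp
  qed
  then have "(\<lambda>p. norm (F p)) summable_on UNIV \<times> UNIV"
    by (rule Infinite_Sum.abs_summable_on_comparison_test') (use F_le in auto)
  then have "F summable_on UNIV \<times> UNIV" by (rule abs_summable_summable)
  then obtain S where S: "(F has_sum S) (UNIV \<times> UNIV)" unfolding summable_on_def by blast
  have row: "((\<lambda>m. F (n, m)) has_sum (c n * ft (\<lambda>x. \<theta>t x * \<Psi> x) (lattice n - z))) UNIV" for n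
    unfolding F_def prod.case by (intro has_sum_cmult_right ft_mult_has_sum[OF \<theta>t \<Psi>])
  have "((\<lambda>n. c n * ft (\<lambda>x. \<theta>t x * \<Psi> x) (lattice n - z)) has_sum S) UNIV"
    by (rule has_sum_SigmaD[OF S row])
  moreover have "((\<lambda>n. c n * ft (\<lambda>x. \<theta>t x * \<Psi> x) (lattice n - z)) has_sum f (\<lambda>x. \<theta>t x * \<Psi> x * expo (- z) x)) UNIV"
    by (rule fourier_series_modulated[OF f test_functions_mult[OF test_functionsD(1)[OF \<theta>t] \<Psi>]])
  ultimately have Sval: "S = f (\<lambda>x. \<theta>t x * \<Psi> x * expo (- z) x)" by (rule has_sum_unique)
  have "(\<lambda>x. \<theta>t x * \<Psi> x * expo (- z) x) = (\<lambda>x. \<theta> x * \<Psi> x * expo (- lattice k) x)"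
  proof
    fix x
    have "expo t x * expo (- z) x = expo (- lattice k) x" unfolding z_def expo_add[symmetric] by simp
    then show "\<theta>t x * \<Psi> x * expo (- z) x = \<theta> x * \<Psi> x * expo (- lattice k) x"
      unfolding \<theta>t_def by (simp add: mult_ac flip: \<open>expo t x * expo (- z) x = expo (- lattice k) x\<close>)
  qed
  then have Sval: "S = f (\<lambda>x. \<theta> x * \<Psi> x * expo (- lattice k) x)" using Sval by simp
  have col: "((\<lambda>n. F (n, m)) has_sum (ft \<theta>t (lattice m) * f (\<lambda>x. \<Psi> x * expo (- (lattice (k + m) + t)) x))) UNIV" for m
  proof -
    have "lattice n - (lattice (k + m) + t) = lattice n - z - lattice m" for n
      unfolding z_def lattice_add by simp
    then have "((\<lambda>n. c n * ft \<Psi> (lattice n - z - lattice m)) has_sum f (\<lambda>x. \<Psi> x * expo (- (lattice (k + m) + t)) x)) UNIV"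
      using fourier_series_modulated[OF f \<Psi>, of "lattice (k + m) + t"] by (simp only:)
    from has_sum_cmult_right[OF this, of "ft \<theta>t (lattice m)"]
    show ?thesis unfolding F_def prod.case by (simp only: mult.left_commute)
  qed
  have "((\<lambda>(m, n). F (n, m)) has_sum S) (UNIV \<times> UNIV)" using S by (subst (asm) has_sum_swap)
  then have "((\<lambda>m. ft \<theta>t (lattice m) * f (\<lambda>x. \<Psi> x * expo (- (lattice (k + m) + t)) x)) has_sum S) UNIV"
    by (rule has_sum_SigmaD) (use col in simp)
  then show ?thesis unfolding Sval \<theta>t_def .
qed

text \<open>The cone generated by a small ball around \<open>\<xi>0\<close> keeps a positive angle from the complement of \<open>\<Gamma>\<close>.\<close>

lemma narrower_cone:
  fixes \<Gamma> :: "(real^'d::finite) set"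
  assumes "open \<Gamma>" "pos_cone \<Gamma>" "\<xi>0 \<in> \<Gamma>"
  shows "\<exists>V \<kappa>. open V \<and> pos_cone V \<and> \<xi>0 \<in> V \<and> 0 < \<kappa> \<and> \<kappa> \<le> 1 \<and>
     (\<forall>k\<in>V. \<forall>y. y \<notin> \<Gamma> \<longrightarrow> \<kappa> * norm k \<le> norm (y - k))"
proof -
  obtain e where e: "e > 0" "ball \<xi>0 e \<subseteq> \<Gamma>" using assms(1,3) by (meson openE)
  define \<delta> where "\<delta> = e / 2"
  have \<delta>: "\<delta> > 0" unfolding \<delta>_def using e by simp
  define V where "V = (\<Union>c\<in>{0<..}. (\<lambda>x. c *\<^sub>R x) ` ball \<xi>0 \<delta>)"
  define \<kappa> where "\<kappa> = \<delta> / (norm \<xi>0 + \<delta>)"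
  have den: "norm \<xi>0 + \<delta> > 0" using \<delta> by (simp add: add_nonneg_pos)
  have "open V" unfolding V_def by (intro open_UN ballI open_scaling open_ball) auto
  moreover have "pos_cone V" unfolding pos_cone_def V_def
  proof (intro ballI allI impI)
    fix x c assume "x \<in> (\<Union>c\<in>{0<..}. (\<lambda>x. c *\<^sub>R x) ` ball \<xi>0 \<delta>)" "c > (0::real)"
    then obtain b y where "b > 0" "y \<in> ball \<xi>0 \<delta>" "x = b *\<^sub>R y" by auto
    then show "c *\<^sub>R x \<in> (\<Union>c\<in>{0<..}. (\<lambda>x. c *\<^sub>R x) ` ball \<xi>0 \<delta>)"
      using \<open>c > 0\<close> by (auto intro!: bexI[of _ "c * b"])
  qed
  moreover have "\<xi>0 \<in> V" unfolding V_def using \<delta> by (auto intro!: bexI[of _ 1])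
  moreover have "\<kappa> > 0" "\<kappa> \<le> 1" unfolding \<kappa>_def using \<delta> den by auto
  moreover have "\<kappa> * norm k \<le> norm (y - k)" if "k \<in> V" "y \<notin> \<Gamma>" for k y
  proof -
    from that(1) obtain b where "b \<in> {0<..}" "k \<in> (\<lambda>x. b *\<^sub>R x) ` ball \<xi>0 \<delta>"
      unfolding V_def by (rule UN_E)
    then obtain x where b: "b > 0" "dist \<xi>0 x < \<delta>" "k = b *\<^sub>R x"
      by (auto simp only: image_iff mem_ball greaterThan_iff)
    have "(1 / b) *\<^sub>R y \<notin> \<Gamma>"
    proof
      assume "(1 / b) *\<^sub>R y \<in> \<Gamma>"
      then have "b *\<^sub>R ((1 / b) *\<^sub>R y) \<in> \<Gamma>" using assms(2) b(1) unfolding pos_cone_def by blast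
      then show False using that(2) b(1) by simp
    qed
    then have "dist \<xi>0 ((1 / b) *\<^sub>R y) \<ge> 2 * \<delta>" using e(2) unfolding \<delta>_def by force
    moreover have "dist \<xi>0 ((1 / b) *\<^sub>R y) \<le> dist \<xi>0 x + dist x ((1 / b) *\<^sub>R y)" by (rule dist_triangle)
    ultimately have d: "norm ((1 / b) *\<^sub>R y - x) \<ge> \<delta>" using b(2) by (simp add: dist_norm norm_minus_commute)
    have "y - k = b *\<^sub>R ((1 / b) *\<^sub>R y - x)" using b by (simp add: scaleR_diff_right)
    then have 1: "norm (y - k) \<ge> b * \<delta>" using d b(1) by simp
    have "norm x \<le> norm \<xi>0 + \<delta>" using b(2) norm_triangle_ineq2[of x \<xi>0] by (simp add: dist_norm norm_minus_commute)
    then have "norm k \<le> b * (norm \<xi>0 + \<delta>)" using b by simp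
    then have "\<kappa> * norm k \<le> \<kappa> * (b * (norm \<xi>0 + \<delta>))" using \<open>\<kappa> > 0\<close> by (intro mult_left_mono) auto
    also have "\<dots> = b * \<delta>" unfolding \<kappa>_def using den by simp
    finally show ?thesis using 1 by simp
  qed
  ultimately show ?thesis by blast
qed

section \<open>From integrals over cones to lattice sums\<close>

lemma summable_on_if_nn_integral_finite:
  fixes h :: "'a \<Rightarrow> real"
  assumes "\<And>k. h k \<ge> 0" "(\<integral>\<^sup>+k. ennreal (h k) \<partial>count_space UNIV) < \<infinity>"
  shows "h summable_on UNIV"
proof (rule nonneg_bdd_above_summable_on)
  let ?I = "\<integral>\<^sup>+k. ennreal (h k) \<partial>count_space UNIV"
  show "bdd_above (sum h ` {F. F \<subseteq> UNIV \<and> finite F})"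
  proof (rule bdd_aboveI2)
    fix F :: "'a set" assume "F \<in> {F. F \<subseteq> UNIV \<and> finite F}"
    then have F: "finite F" by simp
    have "ennreal (sum h F) = (\<integral>\<^sup>+k. ennreal (h k) \<partial>count_space F)"
      using F assms(1) by (simp add: nn_integral_count_space_finite sum_ennreal)
    also have "\<dots> \<le> ?I"
      by (subst nn_integral_count_space_indicator) (auto intro!: nn_integral_mono simp: indicator_def)
    finally have "ennreal (sum h F) \<le> ?I" .
    then have "enn2real (ennreal (sum h F)) \<le> enn2real ?I" using assms(2) by (intro enn2real_mono) auto
    then show "sum h F \<le> enn2real ?I" using assms(1) by (simp add: sum_nonneg)
  qed
qed (use assms in auto)

text \<open>By tiling, the integral is an average over \<open>t\<close> in the unit cube of the sums over
  \<open>lattice k + t\<close>, so almost all of these sums are finite.\<close>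

lemma exists_summable_translate:
  fixes F :: "real^'d::finite \<Rightarrow> real"
  assumes [measurable]: "F \<in> borel_measurable borel" and F0: "\<And>x. F x \<ge> 0"
    and fin: "(\<integral>\<^sup>+x. ennreal (F x) \<partial>lborel) < \<infinity>"
  shows "\<exists>t. (\<lambda>k. F (lattice k + t)) summable_on UNIV"
proof -
  define J where "J x = (\<integral>\<^sup>+k. ennreal (F (x + lattice k)) \<partial>count_space UNIV)" for x
  have Jm [measurable]: "J \<in> borel_measurable borel"
  proof -
    obtain g :: "nat \<Rightarrow> int^'d" where g: "bij g" using bij_nat_int_vec by blast
    have "J x = (\<Sum>i. ennreal (F (x + lattice (g i))))" for x
      unfolding J_def nn_integral_count_space_nat[symmetric]
      by (rule nn_integral_bij_count_space[symmetric, OF g])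
    then show ?thesis by (simp add: J_def[abs_def, symmetric] cong: measurable_cong)
  qed
  have "(\<integral>\<^sup>+x. J x * indicator (unit_box 0) x \<partial>lborel) < \<infinity>"
    using fin unfolding nn_integral_tiling[where a = 0 and F = "\<lambda>x. ennreal (F x)", OF measurable_compose[OF assms(1) measurable_ennreal]] J_def .
  then have ae: "AE x in lborel. J x * indicator (unit_box 0) x \<noteq> \<infinity>"
    by (intro nn_integral_PInf_AE) auto
  have "\<exists>t\<in>unit_box 0. J t \<noteq> \<infinity>"
  proof (rule ccontr)
    assume "\<not> ?thesis"
    then have "AE x in lborel. x \<notin> unit_box (0::real^'d)"
      using ae by (elim AE_mp) (auto intro!: AE_I2 simp: indicator_def)
    then have "emeasure lborel (unit_box (0::real^'d)) = 0"
      by (subst (asm) AE_iff_measurable[where N = "unit_box 0"]) auto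
    then show False by (simp add: emeasure_unit_box)
  qed
  then obtain t where "J t < \<infinity>" by (auto simp: less_top)
  then have "(\<lambda>k. F (t + lattice k)) summable_on UNIV"
    unfolding J_def by (intro summable_on_if_nn_integral_finite F0)
  then show ?thesis by (auto simp: add.commute)
qed

text \<open>The lattice version of \<^term>\<open>\<xi>0\<close> not being a singular direction: regularity of order \<^term>\<open>s\<close> of the sequence
  \<^term>\<open>a\<close> in an open cone around \<^term>\<open>\<xi>0\<close>.\<close>

definition l2_near :: "real \<Rightarrow> (int^'d::finite \<Rightarrow> complex) \<Rightarrow> real^'d \<Rightarrow> bool" where
  "l2_near s a \<xi>0 \<longleftrightarrow> (\<exists>V. open V \<and> pos_cone V \<and> \<xi>0 \<in> V \<and>
     (\<lambda>k. (norm (a k))\<^sup>2 * weight k powr (2 * s)) summable_on {k. lattice k \<in> V})"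

lemma sum_square_le: "(a + b)\<^sup>2 \<le> 2 * a\<^sup>2 + 2 * (b::real)\<^sup>2"
  using sum_squares_bound[of a b] by (simp add: power2_sum)

lemma l2_near_add:
  assumes "l2_near s a \<xi>0" "l2_near s b \<xi>0"
  shows "l2_near s (\<lambda>k. a k + b k) \<xi>0"
proof -
  let ?w = "\<lambda>k. weight k powr (2 * s)"
  obtain V W where V: "open V" "pos_cone V" "\<xi>0 \<in> V" "(\<lambda>k. (norm (a k))\<^sup>2 * ?w k) summable_on {k. lattice k \<in> V}"
    and W: "open W" "pos_cone W" "\<xi>0 \<in> W" "(\<lambda>k. (norm (b k))\<^sup>2 * ?w k) summable_on {k. lattice k \<in> W}"
    using assms unfolding l2_near_def by blast
  have "(\<lambda>k. (norm (a k + b k))\<^sup>2 * ?w k) summable_on {k. lattice k \<in> V \<inter> W}"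
  proof (rule summable_on_comparison_test)
    show "(\<lambda>k. 2 * ((norm (a k))\<^sup>2 * ?w k) + 2 * ((norm (b k))\<^sup>2 * ?w k)) summable_on {k. lattice k \<in> V \<inter> W}"
      by (intro summable_on_add summable_on_cmult_right summable_on_subset[OF V(4)] summable_on_subset[OF W(4)]) auto
    fix k
    have "(norm (a k + b k))\<^sup>2 \<le> (norm (a k) + norm (b k))\<^sup>2" by (intro power_mono norm_triangle_ineq) auto
    also have "\<dots> \<le> 2 * (norm (a k))\<^sup>2 + 2 * (norm (b k))\<^sup>2" by (rule sum_square_le)
    finally have "(norm (a k + b k))\<^sup>2 * ?w k \<le> (2 * (norm (a k))\<^sup>2 + 2 * (norm (b k))\<^sup>2) * ?w k"
      by (intro mult_right_mono) auto
    then show "(norm (a k + b k))\<^sup>2 * ?w k \<le> 2 * ((norm (a k))\<^sup>2 * ?w k) + 2 * ((norm (b k))\<^sup>2 * ?w k)"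
      by (simp add: algebra_simps)
  qed simp
  moreover have "open (V \<inter> W)" "pos_cone (V \<inter> W)" "\<xi>0 \<in> V \<inter> W"
    using V W by (auto simp: pos_cone_def)
  ultimately show ?thesis unfolding l2_near_def by blast
qed

text \<open>The integral condition provides a translate \<open>t\<close> for which the coefficients \<open>G (lattice k + t)\<close> of \<open>\<Psi> f\<close> are square
  summable over \<open>\<Gamma>\<close> with the given weight. The coefficients of \<open>\<theta> \<Psi> f\<close> are a convolution of these with a rapidly
  decreasing sequence. Contributions from inside \<open>\<Gamma>\<close> are controlled by Young's inequality. Those from outside \<open>\<Gamma>\<close>
  have polynomial growth only, but for \<open>lattice k\<close> in the narrower cone they are far away from
  \<open>lattice k\<close>, so the rapid decay makes them as small as wanted.\<close>

lemma localization:
  fixes \<theta> \<Psi> :: "real^'d::finite \<Rightarrow> complex"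
  assumes f: "has_fourier_series f c" and c: "poly_bounded c"
    and \<theta>: "\<theta> \<in> test_functions (cube 1 x0)" and \<Psi>: "\<Psi> \<in> test_functions (cube 1 x0)"
    and \<Gamma>: "open \<Gamma>" "pos_cone \<Gamma>" "\<xi>0 \<in> \<Gamma>"
    and int: "(\<integral>\<^sup>+\<xi>\<in>\<Gamma>. ennreal ((norm (f (\<lambda>x. \<Psi> x * expo (- \<xi>) x)))\<^sup>2 * jbracket \<xi> powr (2 * s)) \<partial>lborel) < \<infinity>"
  shows "l2_near s (\<lambda>k. f (\<lambda>x. \<theta> x * \<Psi> x * expo (- lattice k) x)) \<xi>0"
proof -
  define G where "G \<xi> = norm (f (\<lambda>x. \<Psi> x * expo (- \<xi>) x))" for \<xi>
  have G0: "G \<xi> \<ge> 0" for \<xi> unfolding G_def by simp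
  let ?w = "\<lambda>n::int^'d. weight n"
  have [measurable]: "G \<in> borel_measurable borel"
    unfolding G_def by (rule measurable_compose[OF fourier_coefficient_measurable[OF f \<Psi>] borel_measurable_norm])
  have [measurable]: "(\<lambda>\<xi>. jbracket \<xi> powr r) \<in> borel_measurable borel" for r
    unfolding jbracket_def by measurable
  have \<Gamma>m [measurable]: "\<Gamma> \<in> sets borel" using \<Gamma>(1) by (rule borel_open)
  obtain CG M where CG: "CG \<ge> 0" "M \<ge> 0" "\<And>\<xi>. G \<xi> \<le> CG * jbracket \<xi> powr M"
    using fourier_coefficient_growth[OF f c \<Psi>] unfolding G_def by blast
  have "\<exists>t. (\<lambda>k. (G (lattice k + t))\<^sup>2 * jbracket (lattice k + t) powr (2 * s) * indicator \<Gamma> (lattice k + t)) summable_on UNIV"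
  proof (rule exists_summable_translate)
    have "(\<integral>\<^sup>+x. ennreal ((G x)\<^sup>2 * jbracket x powr (2 * s) * indicator \<Gamma> x) \<partial>lborel)
       = (\<integral>\<^sup>+\<xi>\<in>\<Gamma>. ennreal ((G \<xi>)\<^sup>2 * jbracket \<xi> powr (2 * s)) \<partial>lborel)"
      by (rule nn_integral_cong) (auto simp: indicator_def)
    then show "(\<integral>\<^sup>+x. ennreal ((G x)\<^sup>2 * jbracket x powr (2 * s) * indicator \<Gamma> x) \<partial>lborel) < \<infinity>"
      using int unfolding G_def by simp
  qed auto
  then obtain t where t: "(\<lambda>k. (G (lattice k + t))\<^sup>2 * jbracket (lattice k + t) powr (2 * s) * indicator \<Gamma> (lattice k + t)) summable_on UNIV"
    by blast
  define \<rho> where "\<rho> m = norm (ft (\<lambda>x. expo t x * \<theta> x) (lattice m))" for m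
  have \<rho>0: "\<rho> m \<ge> 0" for m unfolding \<rho>_def by simp
  have decay: "\<exists>C\<ge>0. \<forall>m. \<rho> m \<le> C * ?w m powr (- R)" for R
    using ft_decay[OF test_expo[OF \<theta>], of t R] unfolding \<rho>_def by blast
  define D where "D = 2 * real CARD('d)"
  have sm: "(\<lambda>n::int^'d. ?w n powr (- D)) summable_on UNIV"
    by (rule summable_lattice_powr) (simp add: D_def)
  have \<rho>s: "(\<lambda>m. \<rho> m * ?w m powr r) summable_on UNIV" for r
  proof -
    obtain C where C: "\<And>m. \<rho> m \<le> C * ?w m powr (- (D + r))" using decay[of "D + r"] by blast
    show ?thesis
    proof (rule summable_decay_mult[where R = D and C = C])
      fix m
      have "\<rho> m * ?w m powr r \<le> C * ?w m powr (- (D + r)) * ?w m powr r"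
        by (intro mult_right_mono C) simp
      also have "\<dots> = C * ?w m powr (- D)" by (simp add: mult.assoc powr_add[symmetric])
      finally show "\<rho> m * ?w m powr r \<le> C * ?w m powr (- D)" .
    qed (auto simp: \<rho>0 D_def)
  qed
  define u1 where "u1 j = G (lattice j + t) * indicator \<Gamma> (lattice j + t)" for j
  have u10: "u1 j \<ge> 0" for j unfolding u1_def using G0 by simp
  have u1: "(\<lambda>j. (u1 j)\<^sup>2 * ?w j powr (2 * s)) summable_on UNIV"
  proof (rule summable_on_comparison_test[OF summable_on_cmult_right[OF t, of "2 powr \<bar>2 * s\<bar> * jbracket t powr \<bar>2 * s\<bar>"]])
    fix j
    have "?w j powr (2 * s) \<le> 2 powr \<bar>2 * s\<bar> * jbracket (lattice j + t) powr (2 * s) * jbracket t powr \<bar>2 * s\<bar>"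
      using peetre[of "lattice j + t" "- t" "2 * s"] by simp
    then have "(u1 j)\<^sup>2 * ?w j powr (2 * s) \<le> (u1 j)\<^sup>2 * (2 powr \<bar>2 * s\<bar> * jbracket (lattice j + t) powr (2 * s) * jbracket t powr \<bar>2 * s\<bar>)"
      by (intro mult_left_mono) auto
    then show "(u1 j)\<^sup>2 * ?w j powr (2 * s) \<le> 2 powr \<bar>2 * s\<bar> * jbracket t powr \<bar>2 * s\<bar> *
       ((G (lattice j + t))\<^sup>2 * jbracket (lattice j + t) powr (2 * s) * indicator \<Gamma> (lattice j + t))"
      unfolding u1_def by (cases "lattice j + t \<in> \<Gamma>") (simp_all add: mult_ac)
  qed auto
  note y = young_weighted[OF \<rho>0 u10 \<rho>s u1]
  define v1 where "v1 k = (\<Sum>\<^sub>\<infinity>m. \<rho> m * u1 (k + m))" for k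
  have v1: "(\<lambda>k. (v1 k)\<^sup>2 * ?w k powr (2 * s)) summable_on UNIV" using y(2) unfolding v1_def .
  have v10: "v1 k \<ge> 0" for k unfolding v1_def using \<rho>0 u10 by (simp add: infsum_nonneg)
  obtain V \<kappa> where V: "open V" "pos_cone V" "\<xi>0 \<in> V" and \<kappa>: "0 < \<kappa>" "\<kappa> \<le> 1"
    and sep: "\<And>k y. k \<in> V \<Longrightarrow> y \<notin> \<Gamma> \<Longrightarrow> \<kappa> * norm k \<le> norm (y - k)"
    using narrower_cone[OF \<Gamma>] by blast
  \<comment> \<open>The decay in \<open>k\<close> that is left to the far contributions: after the growth \<open>M\<close> of \<open>G\<close> it still has to
    make their squares summable against the weight of exponent \<open>2 * s\<close>.\<close>
  define A where "A = M + \<bar>s\<bar> + D"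
  have A0: "A \<ge> 0" unfolding A_def D_def using CG by simp
  obtain C3 where C3: "C3 \<ge> 0" "\<And>m. \<rho> m \<le> C3 * ?w m powr (- (M + A + D))" using decay by blast
  define c1 where "c1 = 2 * jbracket t / \<kappa>"
  have c1: "c1 > 0" unfolding c1_def using \<kappa> by simp
  \<comment> \<open>The angle between \<open>V\<close> and the complement of \<open>\<Gamma>\<close>: decay in \<open>m\<close> can be traded for decay in \<open>k\<close>.\<close>
  have wk: "?w k \<le> c1 * ?w m" if "lattice k \<in> V" "lattice (k + m) + t \<notin> \<Gamma>" for k m
  proof -
    have "\<kappa> * norm (lattice k) \<le> norm (lattice (k + m) + t - lattice k)" by (rule sep[OF that])
    also have "lattice (k + m) + t - lattice k = lattice m + t" by (simp add: lattice_add)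
    finally have "norm (lattice k) \<le> (1 / \<kappa>) * norm (lattice m + t)" using \<kappa> by (simp add: field_simps)
    then have "?w k \<le> (1 / \<kappa>) * jbracket (lattice m + t)" by (rule jbracket_scale) (use \<kappa> in simp)
    also have "\<dots> \<le> (1 / \<kappa>) * (2 * ?w m * jbracket t)"
      using \<kappa> by (intro mult_left_mono jbracket_add_le) auto
    finally show ?thesis unfolding c1_def by (simp add: mult_ac)
  qed
  define K where "K = C3 * CG * (2 powr M * 2 powr M * jbracket t powr M) * c1 powr A"
  have K0: "K \<ge> 0" unfolding K_def using C3 CG by simp
  have far: "\<rho> m * G (lattice (k + m) + t) \<le> K * ?w k powr (M - A) * ?w m powr (- D)"
    if "lattice k \<in> V" "lattice (k + m) + t \<notin> \<Gamma>" for k m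
  proof -
    have e: "lattice (k + m) + t = (lattice k + t) + lattice m" by (simp add: lattice_add)
    have "jbracket (lattice (k + m) + t) powr M \<le> 2 powr M * jbracket (lattice k + t) powr M * ?w m powr M"
      unfolding e using peetre[of "lattice k + t" "lattice m" M] CG(2) by simp
    also have "\<dots> \<le> 2 powr M * (2 powr M * ?w k powr M * jbracket t powr M) * ?w m powr M"
      using peetre[of "lattice k" t M] CG(2) by (intro mult_right_mono mult_left_mono) auto
    finally have 1: "jbracket (lattice (k + m) + t) powr M \<le> 2 powr M * (2 powr M * ?w k powr M * jbracket t powr M) * ?w m powr M" .
    have 2: "?w m powr (- A) \<le> c1 powr A * ?w k powr (- A)"
    proof -
      have "?w k powr A \<le> (c1 * ?w m) powr A" using wk[OF that] A0 by (intro powr_mono2) (auto simp: less_imp_le)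
      also have "\<dots> = c1 powr A * ?w m powr A" using c1 by (simp add: powr_mult less_imp_le)
      finally have "?w k powr A * (?w k powr (- A) * ?w m powr (- A)) \<le> c1 powr A * ?w m powr A * (?w k powr (- A) * ?w m powr (- A))"
        by (intro mult_right_mono) auto
      also have "?w k powr A * (?w k powr (- A) * ?w m powr (- A)) = ?w m powr (- A)"
        using jbracket_powr_cancel[of "lattice k" A] by (simp only: mult.assoc[symmetric] mult_1)
      also have "c1 powr A * ?w m powr A * (?w k powr (- A) * ?w m powr (- A)) = c1 powr A * ?w k powr (- A) * (?w m powr A * ?w m powr (- A))"
        by (simp only: mult_ac)
      finally show ?thesis unfolding jbracket_powr_cancel by simp
    qed
    have "\<rho> m * G (lattice (k + m) + t) \<le> (C3 * ?w m powr (- (M + A + D))) * (CG * (2 powr M * (2 powr M * ?w k powr M * jbracket t powr M) * ?w m powr M))"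
      using C3 CG G0 1 by (intro mult_mono order_trans[OF CG(3) mult_left_mono[OF 1]]) auto
    also have "?w m powr (- (M + A + D)) = ?w m powr (- M) * (?w m powr (- A) * ?w m powr (- D))"
      by (simp add: powr_add[symmetric] algebra_simps)
    also have "(C3 * (?w m powr (- M) * (?w m powr (- A) * ?w m powr (- D)))) * (CG * (2 powr M * (2 powr M * ?w k powr M * jbracket t powr M) * ?w m powr M))
       = (C3 * CG * (2 powr M * 2 powr M * jbracket t powr M) * ?w k powr M * ?w m powr (- D) * (?w m powr M * ?w m powr (- M))) * ?w m powr (- A)"
      by (simp only: mult_ac)
    also have "\<dots> \<le> (C3 * CG * (2 powr M * 2 powr M * jbracket t powr M) * ?w k powr M * ?w m powr (- D) * (?w m powr M * ?w m powr (- M))) * (c1 powr A * ?w k powr (- A))"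
      using C3(1) CG(1) by (intro mult_left_mono 2) auto
    also have "\<dots> = K * (?w k powr M * ?w k powr (- A)) * ?w m powr (- D) * (?w m powr M * ?w m powr (- M))"
      unfolding K_def by (simp only: mult_ac)
    also have "?w m powr M * ?w m powr (- M) = 1" by (rule jbracket_powr_cancel)
    also have "?w k powr M * ?w k powr (- A) = ?w k powr (M - A)" by (simp add: powr_add[symmetric])
    finally show ?thesis by simp
  qed
  define Z where "Z = (\<Sum>\<^sub>\<infinity>m::int^'d. ?w m powr (- D))"
  have Z0: "Z \<ge> 0" unfolding Z_def by (simp add: infsum_nonneg)
  let ?a = "\<lambda>k. f (\<lambda>x. \<theta> x * \<Psi> x * expo (- lattice k) x)"
  have bound: "norm (?a k) \<le> v1 k + K * ?w k powr (M - A) * Z" if k: "lattice k \<in> V" for k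
  proof -
    have s1: "(\<lambda>m. \<rho> m * u1 (k + m)) summable_on UNIV" by (rule y(1))
    have s2: "(\<lambda>m. K * ?w k powr (M - A) * ?w m powr (- D)) summable_on UNIV"
      by (rule summable_on_cmult_right[OF sm])
    have "norm (?a k) \<le> (\<Sum>\<^sub>\<infinity>m. \<rho> m * u1 (k + m) + K * ?w k powr (M - A) * ?w m powr (- D))"
    proof (rule has_sum_norm_le[OF localized_coefficient_expansion[OF f c \<theta> \<Psi>, of t k] _ summable_on_add[OF s1 s2]])
      fix m
      have "norm (ft (\<lambda>x. expo t x * \<theta> x) (lattice m) * f (\<lambda>x. \<Psi> x * expo (- (lattice (k + m) + t)) x))
         = \<rho> m * G (lattice (k + m) + t)" unfolding \<rho>_def G_def by (rule norm_mult)
      also have "\<dots> \<le> \<rho> m * u1 (k + m) + K * ?w k powr (M - A) * ?w m powr (- D)"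
      proof (cases "lattice (k + m) + t \<in> \<Gamma>")
        case True
        then show ?thesis unfolding u1_def using K0 by simp
      next
        case False
        then show ?thesis using far[OF k False] unfolding u1_def by simp
      qed
      finally show "norm (ft (\<lambda>x. expo t x * \<theta> x) (lattice m) * f (\<lambda>x. \<Psi> x * expo (- (lattice (k + m) + t)) x))
         \<le> \<rho> m * u1 (k + m) + K * ?w k powr (M - A) * ?w m powr (- D)" .
    qed
    also have "\<dots> = v1 k + K * ?w k powr (M - A) * Z"
      unfolding v1_def Z_def by (subst infsum_add[OF s1 s2]) (simp add: infsum_cmult_right')
    finally show ?thesis .
  qed
  have "(\<lambda>k. (norm (?a k))\<^sup>2 * ?w k powr (2 * s)) summable_on {k. lattice k \<in> V}"
  proof (rule summable_on_comparison_test)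
    show "(\<lambda>k. 2 * ((v1 k)\<^sup>2 * ?w k powr (2 * s)) + 2 * (K * Z)\<^sup>2 * ?w k powr (- D)) summable_on {k. lattice k \<in> V}"
      by (intro summable_on_add summable_on_cmult_right summable_on_subset[OF v1] summable_on_subset[OF sm]) auto
    fix k assume "k \<in> {k. lattice k \<in> V}"
    then have k: "lattice k \<in> V" by simp
    have "(norm (?a k))\<^sup>2 \<le> (v1 k + K * ?w k powr (M - A) * Z)\<^sup>2" by (intro power_mono bound k) auto
    also have "\<dots> \<le> 2 * (v1 k)\<^sup>2 + 2 * (K * ?w k powr (M - A) * Z)\<^sup>2" by (rule sum_square_le)
    also have "(K * ?w k powr (M - A) * Z)\<^sup>2 = (K * Z)\<^sup>2 * ?w k powr (2 * (M - A))"
      by (simp add: power_mult_distrib jbracket_powr_square)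
    finally have "(norm (?a k))\<^sup>2 * ?w k powr (2 * s) \<le> (2 * (v1 k)\<^sup>2 + 2 * ((K * Z)\<^sup>2 * ?w k powr (2 * (M - A)))) * ?w k powr (2 * s)"
      by (intro mult_right_mono) auto
    also have "\<dots> = 2 * ((v1 k)\<^sup>2 * ?w k powr (2 * s)) + 2 * (K * Z)\<^sup>2 * (?w k powr (2 * (M - A)) * ?w k powr (2 * s))"
      by (simp add: algebra_simps)
    also have "?w k powr (2 * (M - A)) * ?w k powr (2 * s) = ?w k powr (2 * (M - A) + 2 * s)" by (rule powr_add[symmetric])
    also have "2 * ((v1 k)\<^sup>2 * ?w k powr (2 * s)) + 2 * (K * Z)\<^sup>2 * ?w k powr (2 * (M - A) + 2 * s) \<le>
       2 * ((v1 k)\<^sup>2 * ?w k powr (2 * s)) + 2 * (K * Z)\<^sup>2 * ?w k powr (- D)"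
      using jbracket_ge_1 by (intro add_left_mono mult_left_mono powr_mono) (auto simp: A_def D_def)
    finally show "(norm (?a k))\<^sup>2 * ?w k powr (2 * s) \<le> 2 * ((v1 k)\<^sup>2 * ?w k powr (2 * s)) + 2 * (K * Z)\<^sup>2 * ?w k powr (- D)" .
  qed auto
  then show ?thesis unfolding l2_near_def using V by blast
qed

section \<open>Microlocal regularity of the localized distribution\<close>

lemma open_cube: "open (cube \<eta> x)"
proof -
  have "cube \<eta> x = (\<Inter>j\<in>UNIV. {y. x $ j - \<eta> / 2 < y $ j} \<inter> {y. y $ j < x $ j + \<eta> / 2})"
    unfolding cube_def by auto
  then show ?thesis
    by (simp only:) (intro open_INT finite_class.finite_UNIV ballI open_Int open_halfspace_component_gt_cart
        open_halfspace_component_lt_cart)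
qed

lemma cube_mono:
  assumes "\<eta> \<le> \<eta>'" shows "cube \<eta> x \<subseteq> cube \<eta>' x"
proof
  fix y assume y: "y \<in> cube \<eta> x"
  have "x $ j - \<eta>' / 2 < y $ j \<and> y $ j < x $ j + \<eta>' / 2" for j
  proof -
    have "x $ j - \<eta> / 2 < y $ j \<and> y $ j < x $ j + \<eta> / 2" using y unfolding cube_def by simp
    then show ?thesis using assms by linarith
  qed
  then show "y \<in> cube \<eta>' x" unfolding cube_def by simp
qed

lemma test_functions_mono: "\<phi> \<in> test_functions U \<Longrightarrow> U \<subseteq> U' \<Longrightarrow> \<phi> \<in> test_functions U'"
  unfolding test_functions_def by auto

text \<open>The given cut-off \<open>\<psi>\<close>, shrunk and moved, serves as a bump function, so none has to be constructed. The
  scaling factor is the dimension over \<open>\<delta>\<close>, since the norm is at most the sum of the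
  moduli of the coordinates.\<close>

lemma rescaled_bump:
  fixes \<psi> :: "real^'d::finite \<Rightarrow> complex" and y :: "real^'d"
  assumes \<psi>: "\<psi> \<in> test_functions (cube \<eta> x0)" and "\<eta> \<le> 1" and "0 < \<epsilon>" and one: "\<forall>x\<in>cube \<epsilon> x0. \<psi> x = 1"
    and "\<delta> > 0"
  shows "\<exists>\<beta>. \<beta> \<in> test_functions (ball y \<delta>) \<and> (\<exists>U. open U \<and> y \<in> U \<and> (\<forall>x\<in>U. \<beta> x = 1))"
proof -
  define d where "d = real CARD('d)"
  have d: "d > 0" unfolding d_def by simp
  define r where "r = d / \<delta>"
  have r: "r > 0" unfolding r_def using d \<open>\<delta> > 0\<close> by simp
  define L where "L x = (x0 - r *\<^sub>R y) + r *\<^sub>R x" for x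
  define \<beta> where "\<beta> x = \<psi> (L x)" for x
  have sm: "smooth \<beta>" unfolding \<beta>_def[abs_def] L_def by (rule smooth_affine[OF test_functionsD(1)[OF \<psi>]])
  have near: "dist y x \<le> \<delta> / 2" if "\<beta> x \<noteq> 0" for x
  proof -
    have "L x \<in> cube \<eta> x0"
      using that support_subset_supp[of \<psi> "L x"] test_functionsD(3)[OF \<psi>] unfolding \<beta>_def by blast
    then have "x0 $ j - \<eta> / 2 < L x $ j \<and> L x $ j < x0 $ j + \<eta> / 2" for j unfolding cube_def by simp
    then have "\<bar>L x $ j - x0 $ j\<bar> \<le> 1 / 2" for j
      using \<open>\<eta> \<le> 1\<close> unfolding abs_le_iff by (smt (verit) field_sum_of_halves)
    moreover have "L x $ j - x0 $ j = r * (x - y) $ j" for j unfolding L_def by (simp add: algebra_simps)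
    ultimately have "\<bar>r * (x - y) $ j\<bar> \<le> 1 / 2" for j by simp
    then have "\<bar>r\<bar> * \<bar>(x - y) $ j\<bar> \<le> 1 / 2" for j unfolding abs_mult .
    then have "\<bar>(x - y) $ j\<bar> \<le> 1 / (2 * r)" for j
      using r by (simp add: pos_le_divide_eq mult_ac)
    then have "(\<Sum>j\<in>UNIV. \<bar>(x - y) $ j\<bar>) \<le> (\<Sum>j\<in>(UNIV::'d set). 1 / (2 * r))" by (rule sum_mono)
    then have "norm (x - y) \<le> d / (2 * r)" using norm_le_l1_cart[of "x - y"] by (simp add: d_def)
    also have "\<dots> = \<delta> / 2" unfolding r_def using d \<open>\<delta> > 0\<close> by simp
    finally show ?thesis by (simp add: dist_norm norm_minus_commute)
  qed
  then have sup: "supp \<beta> \<subseteq> cball y (\<delta> / 2)"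
    unfolding supp_def by (intro closure_minimal) auto
  moreover have "compact (supp \<beta>)"
    using compact_Int_closed[OF compact_cball[of y "\<delta> / 2"], of "supp \<beta>"] sup
    by (simp add: supp_def inf.absorb2)
  moreover have "cball y (\<delta> / 2) \<subseteq> ball y \<delta>" using \<open>\<delta> > 0\<close> by auto
  ultimately have "\<beta> \<in> test_functions (ball y \<delta>)"
    using sm unfolding test_functions_def by blast
  moreover have "open (L -` cube \<epsilon> x0)"
    by (rule open_vimage[OF open_cube]) (auto simp: L_def intro!: continuous_intros)
  moreover have "y \<in> L -` cube \<epsilon> x0" using \<open>\<epsilon> > 0\<close> by (simp add: L_def cube_def)
  moreover have "\<forall>x\<in>L -` cube \<epsilon> x0. \<beta> x = 1" using one unfolding \<beta>_def by auto
  ultimately show ?thesis by blast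
qed

lemma distribution_zero:
  fixes f :: "'d::finite functional" and \<phi> :: "real^'d \<Rightarrow> complex"
  assumes "distribution f" "\<phi> \<in> test_functions UNIV"
  shows "f (\<lambda>x. 0) = 0"
proof -
  have "f (\<lambda>x. 0 * \<phi> x) = 0 * f \<phi>" using assms unfolding distribution_def by blast
  then show ?thesis by simp
qed

lemma not_in_WF_obtain:
  assumes "(y, \<xi>0) \<notin> WF s g" "\<xi>0 \<noteq> 0"
  obtains \<Gamma> \<omega> where "open \<Gamma>" "pos_cone \<Gamma>" "\<xi>0 \<in> \<Gamma>" "\<omega> \<in> test_functions UNIV" "\<forall>\<^sub>F x in nhds y. \<omega> x = 1"
    "(\<integral>\<^sup>+\<xi>\<in>\<Gamma>. ennreal ((norm (fourier_distr (smult_distr \<omega> g) \<xi>))\<^sup>2 * jbracket \<xi> powr (2 * s)) \<partial>lborel) < \<infinity>"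
  using assms unfolding WF_def by blast

text \<open>For every \<open>y\<close> in the support of \<open>\<psi>\<close> there are a cut-off \<open>\<omega>\<close> at \<open>y\<close> as in the definition of the wave front
  set and a bump \<open>\<beta>\<close> that is \<open>1\<close> near \<open>y\<close> and lives where \<open>\<omega> = 1\<close>. Finitely many of the sets where the \<open>\<beta> y\<close> equal \<open>1\<close> cover
  the support, so \<open>\<psi> * (1 - Q) = \<psi>\<close> for the product \<open>Q\<close> of the functions \<open>1 - \<beta> y\<close>. Adding a
  factor to \<open>Q\<close> adds the term \<open>\<psi> * Q * \<beta> y = (Q * \<beta> y) * (\<psi> * \<omega> y)\<close>, to which \<open>localization\<close> applies.\<close>

lemma l2_near_if_not_in_WF:
  fixes \<psi> :: "real^'d::finite \<Rightarrow> complex"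
  assumes dist: "distribution f" and f: "has_fourier_series f c" and c: "poly_bounded c"
    and \<psi>: "\<psi> \<in> test_functions (cube \<eta> x0)" and "\<eta> \<le> 1" and "0 < \<epsilon>" and one: "\<forall>x\<in>cube \<epsilon> x0. \<psi> x = 1"
    and "\<xi>0 \<noteq> 0" and nWF: "\<xi>0 \<notin> snd ` WF s (smult_distr \<psi> f)"
  shows "l2_near s (\<lambda>k. f (\<lambda>x. \<psi> x * expo (- lattice k) x)) \<xi>0"
proof -
  have \<psi>1: "\<psi> \<in> test_functions (cube 1 x0)" by (rule test_functions_mono[OF \<psi> cube_mono[OF \<open>\<eta> \<le> 1\<close>]])
  note \<psi>U = test_functions_UNIV[OF \<psi>]
  have add: "f (\<lambda>x. \<phi> x + \<theta> x) = f \<phi> + f \<theta>" if "\<phi> \<in> test_functions UNIV" "\<theta> \<in> test_functions UNIV" for \<phi> \<theta>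
    using dist that unfolding distribution_def by blast
  define P where "P y \<beta> U \<Gamma> \<omega> \<longleftrightarrow> \<beta> \<in> test_functions (cube 1 x0) \<and> open U \<and> y \<in> U \<and> (\<forall>x\<in>U. \<beta> x = 1) \<and>
     open \<Gamma> \<and> pos_cone \<Gamma> \<and> \<xi>0 \<in> \<Gamma> \<and> \<omega> \<in> test_functions UNIV \<and> (\<forall>x. \<beta> x \<noteq> 0 \<longrightarrow> \<omega> x = 1) \<and>
     (\<integral>\<^sup>+\<xi>\<in>\<Gamma>. ennreal ((norm (f (\<lambda>x. \<psi> x * \<omega> x * expo (- \<xi>) x)))\<^sup>2 * jbracket \<xi> powr (2 * s)) \<partial>lborel) < \<infinity>"
    for y \<beta> U \<Gamma> \<omega>
  have ex: "\<exists>\<beta> U \<Gamma> \<omega>. P y \<beta> U \<Gamma> \<omega>"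
    if "y \<in> supp \<psi>" for y
  proof -
    have "(y, \<xi>0) \<notin> WF s (smult_distr \<psi> f)" using nWF by force
    from not_in_WF_obtain[OF this \<open>\<xi>0 \<noteq> 0\<close>] obtain \<Gamma> \<omega> where \<Gamma>: "open \<Gamma>" "pos_cone \<Gamma>" "\<xi>0 \<in> \<Gamma>" and \<omega>: "\<omega> \<in> test_functions UNIV" "\<forall>\<^sub>F x in nhds y. \<omega> x = 1"
      and I: "(\<integral>\<^sup>+\<xi>\<in>\<Gamma>. ennreal ((norm (fourier_distr (smult_distr \<omega> (smult_distr \<psi> f)) \<xi>))\<^sup>2 * jbracket \<xi> powr (2 * s)) \<partial>lborel) < \<infinity>"
      by blast
    have "y \<in> cube 1 x0" using that test_functionsD(3)[OF \<psi>1] by blast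
    then have "\<forall>\<^sub>F x in nhds y. x \<in> cube 1 x0" by (rule eventually_nhds_in_open[OF open_cube])
    with \<omega>(2) have "\<forall>\<^sub>F x in nhds y. \<omega> x = 1 \<and> x \<in> cube 1 x0" by (rule eventually_conj)
    then obtain \<delta> where \<delta>: "\<delta> > 0" "\<And>x. dist x y < \<delta> \<Longrightarrow> \<omega> x = 1 \<and> x \<in> cube 1 x0"
      unfolding eventually_nhds_metric by blast
    obtain \<beta> U where \<beta>: "\<beta> \<in> test_functions (ball y \<delta>)" "open U" "y \<in> U" "\<forall>x\<in>U. \<beta> x = 1"
      using rescaled_bump[OF \<psi> \<open>\<eta> \<le> 1\<close> \<open>0 < \<epsilon>\<close> one \<delta>(1), of y] by blast
    have "ball y \<delta> \<subseteq> cube 1 x0" using \<delta>(2) by (auto simp: dist_commute)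
    then have 1: "\<beta> \<in> test_functions (cube 1 x0)" by (rule test_functions_mono[OF \<beta>(1)])
    have 2: "\<forall>x. \<beta> x \<noteq> 0 \<longrightarrow> \<omega> x = 1"
    proof (intro allI impI)
      fix x assume "\<beta> x \<noteq> 0"
      then have "x \<in> ball y \<delta>" using support_subset_supp[of \<beta> x] test_functionsD(3)[OF \<beta>(1)] by blast
      then show "\<omega> x = 1" using \<delta>(2)[of x] by (simp add: dist_commute)
    qed
    have "fourier_distr (smult_distr \<omega> (smult_distr \<psi> f)) \<xi> = f (\<lambda>x. \<psi> x * \<omega> x * expo (- \<xi>) x)" for \<xi>
      unfolding fourier_distr_def smult_distr_def by (simp only: mult.assoc)
    then show ?thesis unfolding P_def using 1 2 \<beta> \<Gamma> \<omega>(1) I by (simp only:) blast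
  qed
  have "\<forall>y\<in>supp \<psi>. \<exists>\<beta> U \<Gamma> \<omega>. P y \<beta> U \<Gamma> \<omega>" using ex by blast
  then obtain \<beta> U \<Gamma> \<omega> where P: "\<And>y. y \<in> supp \<psi> \<Longrightarrow> P y (\<beta> y) (U y) (\<Gamma> y) (\<omega> y)" by metis
  have \<beta>: "\<beta> y \<in> test_functions (cube 1 x0)" if "y \<in> supp \<psi>" for y using P[OF that] unfolding P_def by blast
  obtain Y where Y: "Y \<subseteq> supp \<psi>" "finite Y" "supp \<psi> \<subseteq> (\<Union>y\<in>Y. U y)"
  proof -
    have "\<And>y. y \<in> supp \<psi> \<Longrightarrow> open (U y)" "supp \<psi> \<subseteq> (\<Union>y\<in>supp \<psi>. U y)" using P unfolding P_def by blast+
    from compactE_image[OF test_functionsD(2)[OF \<psi>] this] show ?thesis using that by blast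
  qed
  define Q where "Q F x = (\<Prod>y\<in>F. 1 - \<beta> y x)" for F x
  have Qs: "smooth (Q F)" if "F \<subseteq> supp \<psi>" for F
    unfolding Q_def[abs_def] using that
    by (intro smooth_prod smooth_diff smooth_const test_functionsD(1)[OF \<beta>]) auto
  have "F \<subseteq> supp \<psi> \<Longrightarrow> l2_near s (\<lambda>k. f (\<lambda>x. (\<psi> x * (1 - Q F x)) * expo (- lattice k) x)) \<xi>0" if "finite F" for F
    using that
  proof (induction F rule: finite_induct)
    case empty
    have "l2_near s (\<lambda>k. 0) \<xi>0" unfolding l2_near_def by (intro exI[of _ UNIV]) (auto simp: pos_cone_def)
    then show ?case by (simp add: Q_def distribution_zero[OF dist \<psi>U])
  next
    case (insert y F)
    then have y: "y \<in> supp \<psi>" and F: "F \<subseteq> supp \<psi>" by auto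
    define \<theta> where "\<theta> x = Q F x * \<beta> y x" for x
    define \<Psi> where "\<Psi> x = \<psi> x * \<omega> y x" for x
    have \<theta>: "\<theta> \<in> test_functions (cube 1 x0)"
      unfolding \<theta>_def[abs_def] by (rule test_functions_mult[OF Qs[OF F] \<beta>[OF y]])
    have Py: "open (\<Gamma> y)" "pos_cone (\<Gamma> y)" "\<xi>0 \<in> \<Gamma> y" "\<omega> y \<in> test_functions UNIV" "\<forall>x. \<beta> y x \<noteq> 0 \<longrightarrow> \<omega> y x = 1"
     "(\<integral>\<^sup>+\<xi>\<in>\<Gamma> y. ennreal ((norm (f (\<lambda>x. \<Psi> x * expo (- \<xi>) x)))\<^sup>2 * jbracket \<xi> powr (2 * s)) \<partial>lborel) < \<infinity>"
      using P[OF y] unfolding P_def \<Psi>_def by blast+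
    have \<Psi>: "\<Psi> \<in> test_functions (cube 1 x0)"
      unfolding \<Psi>_def[abs_def] by (rule test_functions_mult'[OF test_functionsD(1)[OF Py(4)] \<psi>1])
    have new: "l2_near s (\<lambda>k. f (\<lambda>x. \<theta> x * \<Psi> x * expo (- lattice k) x)) \<xi>0"
      by (rule localization[OF f c \<theta> \<Psi> Py(1,2,3,6)])
    have "f (\<lambda>x. (\<psi> x * (1 - Q (insert y F) x)) * expo (- lattice k) x)
      = f (\<lambda>x. (\<psi> x * (1 - Q F x)) * expo (- lattice k) x) + f (\<lambda>x. \<theta> x * \<Psi> x * expo (- lattice k) x)" for k
    proof -
      have "(\<psi> x * (1 - Q (insert y F) x)) * expo (- lattice k) x =
        (\<psi> x * (1 - Q F x)) * expo (- lattice k) x + \<theta> x * \<Psi> x * expo (- lattice k) x" for x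
      proof -
        have "\<theta> x * \<Psi> x = \<psi> x * (Q F x * \<beta> y x)"
          unfolding \<theta>_def \<Psi>_def using Py(5) by (cases "\<beta> y x = 0") auto
        then show ?thesis unfolding Q_def using insert.hyps by (simp add: algebra_simps)
      qed
      moreover have "(\<lambda>x. (\<psi> x * (1 - Q F x)) * expo (- lattice k) x) \<in> test_functions UNIV"
        by (intro test_expo' test_functions_mult'[OF _ \<psi>U] smooth_diff smooth_const Qs[OF F])
      moreover have "(\<lambda>x. \<theta> x * \<Psi> x * expo (- lattice k) x) \<in> test_functions UNIV"
        by (intro test_expo' test_functions_mult[OF test_functionsD(1)[OF \<theta>]] test_functions_UNIV[OF \<Psi>])
      ultimately show ?thesis using add by simp
    qed
    then show ?case using l2_near_add[OF insert.IH[OF F] new] by simp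
  qed
  from this[OF Y(2,1)] have "l2_near s (\<lambda>k. f (\<lambda>x. (\<psi> x * (1 - Q Y x)) * expo (- lattice k) x)) \<xi>0" .
  moreover have "\<psi> x * (1 - Q Y x) = \<psi> x" for x
  proof (cases "\<psi> x = 0")
    case False
    then have "x \<in> supp \<psi>" by (rule support_subset_supp)
    then obtain y where y: "y \<in> Y" "x \<in> U y" using Y(3) by blast
    then have "\<beta> y x = 1" using P[of y] Y(1) unfolding P_def by blast
    then have "Q Y x = 0" unfolding Q_def using y(1) Y(2) by (intro prod_zero) auto
    then show ?thesis by simp
  qed simp
  ultimately show ?thesis by simp
qed

section \<open>Convolution of microlocally separated sequences\<close>

text \<open>The weights cancel up to a power of the weight of \<open>u + v\<close>, as \<open>\<tau> \<le> \<sigma>\<close>. The bound is by a sum of squares rather than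
  by a product of two square roots, so that it can be summed without Cauchy-Schwarz.\<close>

lemma l2_pair_bound:
  fixes u v :: "real^'d::finite" and p q :: real
  assumes "\<tau> \<le> \<sigma>" "p \<ge> 0" "q \<ge> 0"
  shows "p * q \<le> 2 powr \<bar>\<tau>\<bar> * jbracket (u + v) powr \<bar>\<tau>\<bar> *
     (p\<^sup>2 * jbracket u powr (2 * \<sigma>) + q\<^sup>2 * jbracket v powr (2 * (- \<tau>)))"
proof -
  let ?K = "2 powr \<bar>\<tau>\<bar> * jbracket (u + v) powr \<bar>\<tau>\<bar>"
  define x y where "x = p * jbracket u powr \<sigma>" and "y = q * jbracket v powr (- \<tau>)"
  have xy: "x \<ge> 0" "y \<ge> 0" unfolding x_def y_def using assms by auto
  have "jbracket v powr \<tau> \<le> 2 powr \<bar>\<tau>\<bar> * jbracket u powr \<tau> * jbracket (u + v) powr \<bar>\<tau>\<bar>"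
    using peetre[of "- u" "u + v" \<tau>] by simp
  then have "jbracket u powr (- \<sigma>) * jbracket v powr \<tau> \<le> jbracket u powr (- \<sigma>) * (2 powr \<bar>\<tau>\<bar> * jbracket u powr \<tau> * jbracket (u + v) powr \<bar>\<tau>\<bar>)"
    by (intro mult_left_mono) auto
  also have "\<dots> = ?K * jbracket u powr (\<tau> - \<sigma>)"
    by (simp add: powr_add[of "jbracket u" \<tau> "- \<sigma>", simplified] mult_ac)
  also have "\<dots> \<le> ?K * 1"
    using powr_mono[of "\<tau> - \<sigma>" 0 "jbracket u"] assms(1) jbracket_ge_1[of u] by (intro mult_left_mono) auto
  finally have K: "jbracket u powr (- \<sigma>) * jbracket v powr \<tau> \<le> ?K" by simp
  have "p * q = x * y * (jbracket u powr (- \<sigma>) * jbracket v powr \<tau>)"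
  proof -
    have "x * y * (jbracket u powr (- \<sigma>) * jbracket v powr \<tau>)
      = p * q * (jbracket u powr \<sigma> * jbracket u powr (- \<sigma>)) * (jbracket v powr \<tau> * jbracket v powr (- \<tau>))"
      unfolding x_def y_def by (simp only: mult_ac)
    then show ?thesis by (simp only: jbracket_powr_cancel mult_1_right)
  qed
  also have "\<dots> \<le> x * y * ?K" using xy by (intro mult_left_mono K) auto
  also have "\<dots> \<le> (x\<^sup>2 + y\<^sup>2) * ?K"
  proof (rule mult_right_mono)
    show "x * y \<le> x\<^sup>2 + y\<^sup>2" using sum_squares_bound[of x y] mult_nonneg_nonneg[OF xy] by linarith
  qed simp
  finally show ?thesis unfolding x_def y_def by (simp add: power_mult_distrib jbracket_powr_square mult.commute)
qed

lemma summable_on_finite_UN: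
  fixes h :: "'a \<Rightarrow> real"
  assumes "finite I" "\<And>i. i \<in> I \<Longrightarrow> h summable_on S i"
  shows "h summable_on (\<Union>i\<in>I. S i)"
  using assms by (induction I rule: finite_induct) (auto intro: summable_on_union)

text \<open>Each direction has an open cone \<open>\<Gamma>\<close> on which \<open>a\<close>, or on whose negative \<open>b\<close>, is regular, and a narrower cone
  \<open>V\<close> at a positive angle from the complement of \<open>\<Gamma>\<close>. Finitely many of the \<open>V\<close> cover the sphere; \<open>A\<close> and \<open>B\<close> are
  the unions of the corresponding \<open>\<Gamma>\<close> of either kind. A vector \<open>y \<noteq> 0\<close> outside \<open>B\<close> lies, up to scaling, in a \<open>V\<close> whose
  \<open>\<Gamma>\<close> is part of \<open>A\<close>, hence is separated from every \<open>x\<close> outside \<open>A\<close>.\<close>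

lemma microlocal_cover:
  fixes a b :: "int^'d::finite \<Rightarrow> complex"
  assumes near: "\<And>\<xi>. \<xi> \<noteq> 0 \<Longrightarrow> l2_near s1 a \<xi> \<or> l2_near s2 b (- \<xi>)"
  shows "\<exists>A B \<kappa>. 0 < \<kappa> \<and> \<kappa> \<le> 1 \<and>
    (\<lambda>k. (norm (a k))\<^sup>2 * weight k powr (2 * s1)) summable_on {k. lattice k \<in> A} \<and>
    (\<lambda>k. (norm (b k))\<^sup>2 * weight k powr (2 * s2)) summable_on {k. - lattice k \<in> B} \<and>
    (\<forall>x y. x \<notin> A \<longrightarrow> y \<notin> B \<longrightarrow> \<kappa> * norm y \<le> norm (x - y))"
proof -
  let ?f = "\<lambda>k. (norm (a k))\<^sup>2 * weight k powr (2 * s1)"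
  let ?g = "\<lambda>k. (norm (b k))\<^sup>2 * weight k powr (2 * s2)"
  define S1 where "S1 \<Gamma> \<longleftrightarrow> ?f summable_on {k. lattice k \<in> \<Gamma>}" for \<Gamma>
  define S2 where "S2 \<Gamma> \<longleftrightarrow> ?g summable_on {k. - lattice k \<in> \<Gamma>}" for \<Gamma>
  define P where "P \<xi> \<Gamma> V \<kappa> \<longleftrightarrow> (S1 \<Gamma> \<or> S2 \<Gamma>) \<and> pos_cone V \<and> open V \<and> \<xi> \<in> V \<and> 0 < \<kappa> \<and> \<kappa> \<le> 1 \<and>
     (\<forall>k\<in>V. \<forall>y. y \<notin> \<Gamma> \<longrightarrow> \<kappa> * norm k \<le> norm (y - k))" for \<xi> \<Gamma> V and \<kappa> :: real
  have "\<exists>\<Gamma> V \<kappa>. P \<xi> \<Gamma> V \<kappa>" if "\<xi> \<noteq> 0" for \<xi> :: "real^'d"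
  proof -
    have "\<exists>\<Gamma>. open \<Gamma> \<and> pos_cone \<Gamma> \<and> \<xi> \<in> \<Gamma> \<and> (S1 \<Gamma> \<or> S2 \<Gamma>)"
      using near[OF that]
    proof
      assume "l2_near s1 a \<xi>"
      then show ?thesis unfolding l2_near_def S1_def by blast
    next
      assume "l2_near s2 b (- \<xi>)"
      then obtain \<Gamma> where \<Gamma>: "open \<Gamma>" "pos_cone \<Gamma>" "- \<xi> \<in> \<Gamma>" "?g summable_on {k. lattice k \<in> \<Gamma>}"
        unfolding l2_near_def by blast
      have m: "x \<in> uminus ` \<Gamma> \<longleftrightarrow> - x \<in> \<Gamma>" for x by force
      have "open (uminus ` \<Gamma>)" by (rule open_negations[OF \<Gamma>(1)])
      moreover have "pos_cone (uminus ` \<Gamma>)"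
        using \<Gamma>(2) unfolding pos_cone_def Ball_def m by (metis scaleR_minus_right)
      moreover have "S2 (uminus ` \<Gamma>)" using \<Gamma>(4) unfolding S2_def m by simp
      ultimately show ?thesis using \<Gamma>(3) m by blast
    qed
    then obtain \<Gamma> where "open \<Gamma>" "pos_cone \<Gamma>" "\<xi> \<in> \<Gamma>" "S1 \<Gamma> \<or> S2 \<Gamma>" by blast
    then show ?thesis using narrower_cone[of \<Gamma> \<xi>] unfolding P_def by blast
  qed
  then have "\<forall>\<xi>\<in>sphere 0 1. \<exists>\<Gamma> V \<kappa>. P \<xi> \<Gamma> V \<kappa>" by (metis mem_sphere_0 norm_zero zero_neq_one)
  then obtain \<Gamma> V \<kappa> where P: "\<And>\<xi>. \<xi> \<in> sphere 0 1 \<Longrightarrow> P \<xi> (\<Gamma> \<xi>) (V \<xi>) (\<kappa> \<xi>)" by metis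
  obtain D where D: "D \<subseteq> sphere 0 1" "finite D" "sphere 0 1 \<subseteq> (\<Union>\<xi>\<in>D. V \<xi>)"
  proof -
    have "\<And>\<xi>. \<xi> \<in> sphere 0 1 \<Longrightarrow> open (V \<xi>)" "sphere 0 1 \<subseteq> (\<Union>\<xi>\<in>sphere 0 1. V \<xi>)" using P unfolding P_def by blast+
    from compactE_image[OF compact_sphere this] show ?thesis using that by blast
  qed
  define A where "A = (\<Union>\<xi>\<in>{\<xi>\<in>D. S1 (\<Gamma> \<xi>)}. \<Gamma> \<xi>)"
  define B where "B = (\<Union>\<xi>\<in>{\<xi>\<in>D. S2 (\<Gamma> \<xi>)}. \<Gamma> \<xi>)"
  define \<kappa>0 where "\<kappa>0 = Min (insert 1 (\<kappa> ` D))"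
  have \<kappa>0: "0 < \<kappa>0" "\<kappa>0 \<le> 1" "\<And>\<xi>. \<xi> \<in> D \<Longrightarrow> \<kappa>0 \<le> \<kappa> \<xi>"
    unfolding \<kappa>0_def using D(1,2) P unfolding P_def by (auto simp: subset_iff)
  have "?f summable_on {k. lattice k \<in> A}"
  proof -
    have "{k. lattice k \<in> A} = (\<Union>\<xi>\<in>{\<xi>\<in>D. S1 (\<Gamma> \<xi>)}. {k. lattice k \<in> \<Gamma> \<xi>})" unfolding A_def by auto
    then show ?thesis using D(2) unfolding S1_def by (simp only:) (rule summable_on_finite_UN, auto)
  qed
  moreover have "?g summable_on {k. - lattice k \<in> B}"
  proof -
    have "{k. - lattice k \<in> B} = (\<Union>\<xi>\<in>{\<xi>\<in>D. S2 (\<Gamma> \<xi>)}. {k. - lattice k \<in> \<Gamma> \<xi>})" unfolding B_def by auto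
    then show ?thesis using D(2) unfolding S2_def by (simp only:) (rule summable_on_finite_UN, auto)
  qed
  moreover have "\<kappa>0 * norm y \<le> norm (x - y)" if x: "x \<notin> A" and y: "y \<notin> B" for x y
  proof (cases "y = 0")
    case False
    have "(1 / norm y) *\<^sub>R y \<in> sphere 0 1" using False by simp
    then obtain \<xi> where \<xi>: "\<xi> \<in> D" "(1 / norm y) *\<^sub>R y \<in> V \<xi>" using D(3) by blast
    have P\<xi>: "S1 (\<Gamma> \<xi>) \<or> S2 (\<Gamma> \<xi>)" "pos_cone (V \<xi>)" "0 < \<kappa> \<xi>"
      "\<And>k z. k \<in> V \<xi> \<Longrightarrow> z \<notin> \<Gamma> \<xi> \<Longrightarrow> \<kappa> \<xi> * norm k \<le> norm (z - k)"
      using P[of \<xi>] \<xi>(1) D(1) unfolding P_def by blast+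
    have "norm y *\<^sub>R ((1 / norm y) *\<^sub>R y) \<in> V \<xi>"
      using P\<xi>(2) \<xi>(2) False unfolding pos_cone_def by (metis zero_less_norm_iff)
    then have yV: "y \<in> V \<xi>" using False by simp
    have "y \<in> \<Gamma> \<xi>"
    proof (rule ccontr)
      assume "y \<notin> \<Gamma> \<xi>"
      then have "\<kappa> \<xi> * norm y \<le> norm (y - y)" by (rule P\<xi>(4)[OF yV])
      then show False using P\<xi>(3) False by (simp add: mult_le_0_iff)
    qed
    then have "\<not> S2 (\<Gamma> \<xi>)" using y \<xi>(1) unfolding B_def by blast
    then have "S1 (\<Gamma> \<xi>)" using P\<xi>(1) by blast
    then have "x \<notin> \<Gamma> \<xi>" using x \<xi>(1) unfolding A_def by blast
    then have "\<kappa> \<xi> * norm y \<le> norm (x - y)" by (rule P\<xi>(4)[OF yV])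
    moreover have "\<kappa>0 * norm y \<le> \<kappa> \<xi> * norm y" by (intro mult_right_mono \<kappa>0(3) \<xi>(1)) auto
    ultimately show ?thesis by linarith
  qed simp
  ultimately show ?thesis using \<kappa>0(1,2) by blast
qed

lemma reflect_summable:
  fixes h :: "int^'d::finite \<Rightarrow> real"
  assumes "h summable_on UNIV"
  shows "(\<lambda>k. h (n - k)) summable_on UNIV" "(\<Sum>\<^sub>\<infinity>k. h (n - k)) = (\<Sum>\<^sub>\<infinity>k. h k)"
proof -
  have b: "bij_betw (\<lambda>k. n - k) UNIV (UNIV :: (int^'d) set)"
    by (rule bij_betwI[of _ _ _ "\<lambda>k. n - k"]) auto
  show "(\<lambda>k. h (n - k)) summable_on UNIV" using summable_on_reindex_bij_betw[OF b, of h] assms by simp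
  show "(\<Sum>\<^sub>\<infinity>k. h (n - k)) = (\<Sum>\<^sub>\<infinity>k. h k)" by (rule infsum_reindex_bij_betw[OF b])
qed

text \<open>Each summand is at most \<open>K * weight n powr M * H n k\<close>, where \<open>H n\<close> collects the summable majorants of the
  three cases and has a sum \<open>T\<close> that does not depend on \<open>n\<close>.\<close>

lemma convolution_poly_bounded:
  fixes a b :: "int^'d::finite \<Rightarrow> complex"
  assumes a2: "(\<lambda>k. (norm (a k))\<^sup>2 * weight k powr (2 * (- \<tau>1))) summable_on UNIV"
    and b2: "(\<lambda>k. (norm (b k))\<^sup>2 * weight k powr (2 * (- \<tau>2))) summable_on UNIV"
    and pa: "poly_bounded a" and pb: "poly_bounded b"
    and near: "\<And>\<xi>. \<xi> \<noteq> 0 \<Longrightarrow> l2_near s1 a \<xi> \<or> l2_near s2 b (- \<xi>)"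
    and s: "s1 \<ge> \<tau>2" "s2 \<ge> \<tau>1"
  shows "\<And>n. (\<lambda>k. a (n - k) * b k) summable_on UNIV" and "poly_bounded (\<lambda>n. \<Sum>\<^sub>\<infinity>k. a (n - k) * b k)"
proof -
  let ?w = "\<lambda>n::int^'d. weight n"
  obtain A B \<kappa> where \<kappa>: "0 < \<kappa>" "\<kappa> \<le> 1"
    and A: "(\<lambda>k. (norm (a k))\<^sup>2 * ?w k powr (2 * s1)) summable_on {k. lattice k \<in> A}"
    and B: "(\<lambda>k. (norm (b k))\<^sup>2 * ?w k powr (2 * s2)) summable_on {k. - lattice k \<in> B}"
    and sep: "\<And>x y. x \<notin> A \<Longrightarrow> y \<notin> B \<Longrightarrow> \<kappa> * norm y \<le> norm (x - y)"
    using microlocal_cover[OF near] by blast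
  obtain Ca Ma where Ca: "Ca \<ge> 0" "Ma \<ge> 0" "\<And>k. norm (a k) \<le> Ca * ?w k powr Ma" using pa unfolding poly_bounded_def by blast
  obtain Cb Mb where Cb: "Cb \<ge> 0" "Mb \<ge> 0" "\<And>k. norm (b k) \<le> Cb * ?w k powr Mb" using pb unfolding poly_bounded_def by blast
  define D where "D = 2 * real CARD('d)"
  have D0: "D \<ge> 0" unfolding D_def by simp
  define \<alpha>1 where "\<alpha>1 k = (if lattice k \<in> A then (norm (a k))\<^sup>2 * ?w k powr (2 * s1) else 0)" for k
  define \<beta>1 where "\<beta>1 k = (norm (b k))\<^sup>2 * ?w k powr (2 * (- \<tau>2))" for k
  define \<beta>2 where "\<beta>2 k = (if - lattice k \<in> B then (norm (b k))\<^sup>2 * ?w k powr (2 * s2) else 0)" for k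
  define \<alpha>2 where "\<alpha>2 k = (norm (a k))\<^sup>2 * ?w k powr (2 * (- \<tau>1))" for k
  have nn: "\<alpha>1 k \<ge> 0" "\<alpha>2 k \<ge> 0" "\<beta>1 k \<ge> 0" "\<beta>2 k \<ge> 0" for k
    unfolding \<alpha>1_def \<alpha>2_def \<beta>1_def \<beta>2_def by auto
  have \<alpha>1: "\<alpha>1 summable_on UNIV"
    by (rule summable_on_cong_neutral[THEN iffD1, OF _ _ _ A]) (auto simp: \<alpha>1_def)
  have \<beta>2: "\<beta>2 summable_on UNIV"
    by (rule summable_on_cong_neutral[THEN iffD1, OF _ _ _ B]) (auto simp: \<beta>2_def)
  have \<beta>1: "\<beta>1 summable_on UNIV" unfolding \<beta>1_def by (rule b2)
  have \<alpha>2: "\<alpha>2 summable_on UNIV" unfolding \<alpha>2_def by (rule a2)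
  have sm: "(\<lambda>k. ?w k powr (- D)) summable_on UNIV" by (rule summable_lattice_powr) (simp add: D_def)
  define H where "H n k = (\<alpha>1 (n - k) + \<alpha>2 (n - k)) + (\<beta>1 k + \<beta>2 k + ?w k powr (- D))" for n k
  define T where "T = (\<Sum>\<^sub>\<infinity>k. \<alpha>1 k + \<alpha>2 k) + (\<Sum>\<^sub>\<infinity>k. \<beta>1 k + \<beta>2 k + ?w k powr (- D))"
  have T0: "T \<ge> 0" unfolding T_def by (intro add_nonneg_nonneg infsum_nonneg) (auto simp: nn)
  have \<alpha>: "(\<lambda>k. \<alpha>1 k + \<alpha>2 k) summable_on UNIV" by (intro summable_on_add \<alpha>1 \<alpha>2)
  have \<beta>: "(\<lambda>k. \<beta>1 k + \<beta>2 k + ?w k powr (- D)) summable_on UNIV" by (intro summable_on_add \<beta>1 \<beta>2 sm)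
  have H: "H n summable_on UNIV" "infsum (H n) UNIV = T" for n
  proof -
    note r = reflect_summable[OF \<alpha>, of n]
    show "H n summable_on UNIV" unfolding H_def[abs_def] by (rule summable_on_add[OF r(1) \<beta>])
    show "infsum (H n) UNIV = T" unfolding H_def[abs_def] T_def infsum_add[OF r(1) \<beta>] r(2) ..
  qed
  \<comment> \<open>In the third case \<open>k\<close> is at most a multiple of \<open>n\<close>, so \<open>E\<close> powers of the weight of \<open>k\<close> can be
    moved to \<open>n\<close>; this leaves the summable weight of exponent \<open>-D\<close>.\<close>
  define E where "E = Ma + Mb + D"
  define M where "M = \<bar>\<tau>1\<bar> + \<bar>\<tau>2\<bar> + (Ma + E)"
  define K where "K = 2 powr \<bar>\<tau>1\<bar> + 2 powr \<bar>\<tau>2\<bar> + Ca * Cb * 2 powr Ma * (1 / \<kappa>) powr E"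
  have E0: "E \<ge> 0" unfolding E_def using Ca Cb D0 by simp
  have K0: "K \<ge> 0" unfolding K_def using Ca Cb by simp
  have bound: "norm (a (n - k) * b k) \<le> K * ?w n powr M * H n k" for n k
  proof -
    have ln: "lattice (n - k) + lattice k = lattice n" by (simp add: lattice_diff)
    have wmono: "?w n powr r \<le> ?w n powr M" if "r \<le> M" for r
      using that jbracket_ge_1 by (intro powr_mono) auto
    consider "lattice (n - k) \<in> A" | "- lattice k \<in> B" | "lattice (n - k) \<notin> A" "- lattice k \<notin> B" by blast
    then show ?thesis
    proof cases
      case 1
      have "norm (a (n - k)) * norm (b k) \<le> 2 powr \<bar>\<tau>2\<bar> * ?w n powr \<bar>\<tau>2\<bar> * (\<alpha>1 (n - k) + \<beta>1 k)"
        using l2_pair_bound[OF s(1), of "norm (a (n - k))" "norm (b k)" "lattice (n - k)" "lattice k"] 1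
        unfolding \<alpha>1_def \<beta>1_def ln by simp
      also have "\<dots> \<le> K * ?w n powr M * H n k"
        using nn Ca Cb E0 unfolding H_def by (intro mult_mono wmono) (auto simp: K_def M_def)
      finally show ?thesis by (simp add: norm_mult)
    next
      case 2
      have "norm (b k) * norm (a (n - k)) \<le> 2 powr \<bar>\<tau>1\<bar> * ?w n powr \<bar>\<tau>1\<bar> * (\<beta>2 k + \<alpha>2 (n - k))"
        using l2_pair_bound[OF s(2), of "norm (b k)" "norm (a (n - k))" "lattice k" "lattice (n - k)"] 2
        unfolding \<beta>2_def \<alpha>2_def add.commute[of "lattice k"] ln by simp
      also have "\<dots> \<le> K * ?w n powr M * H n k"
        using nn Ca Cb E0 unfolding H_def by (intro mult_mono wmono) (auto simp: K_def M_def)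
      finally show ?thesis by (simp add: norm_mult mult.commute)
    next
      case 3
      have "\<kappa> * norm (- lattice k) \<le> norm (lattice (n - k) - - lattice k)" by (rule sep[OF 3])
      then have "norm (lattice k) \<le> (1 / \<kappa>) * norm (lattice n)" using \<kappa>(1) ln by (simp add: field_simps)
      then have "?w k \<le> (1 / \<kappa>) * ?w n" by (rule jbracket_scale) (use \<kappa> in simp)
      then have "?w k powr E \<le> ((1 / \<kappa>) * ?w n) powr E" using E0 by (intro powr_mono2) (auto simp: less_imp_le)
      then have wE: "?w k powr E \<le> (1 / \<kappa>) powr E * ?w n powr E"
        using \<kappa>(1) by (subst (asm) powr_mult) (auto simp: less_imp_le)
      have "?w (n - k) powr Ma \<le> 2 powr Ma * ?w n powr Ma * ?w k powr Ma"
        using peetre[of "lattice n" "- lattice k" Ma] Ca(2) by (simp add: lattice_diff)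
      then have "norm (a (n - k)) \<le> Ca * (2 powr Ma * ?w n powr Ma * ?w k powr Ma)"
        using Ca(1) Ca(3)[of "n - k"] by (meson mult_left_mono order_trans)
      then have "norm (a (n - k)) * norm (b k) \<le> (Ca * (2 powr Ma * ?w n powr Ma * ?w k powr Ma)) * (Cb * ?w k powr Mb)"
        using Ca(1) Cb(3)[of k] by (intro mult_mono) auto
      also have "\<dots> = (Ca * Cb * 2 powr Ma * ?w n powr Ma) * (?w k powr Ma * ?w k powr Mb)" by (simp only: mult_ac)
      also have "?w k powr Ma * ?w k powr Mb = ?w k powr E * ?w k powr (- D)"
        unfolding E_def by (simp add: powr_add[symmetric])
      also have "(Ca * Cb * 2 powr Ma * ?w n powr Ma) * (?w k powr E * ?w k powr (- D))
        \<le> (Ca * Cb * 2 powr Ma * ?w n powr Ma) * (((1 / \<kappa>) powr E * ?w n powr E) * ?w k powr (- D))"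
        using Ca(1) Cb(1) wE by (intro mult_left_mono mult_right_mono) auto
      also have "\<dots> = (Ca * Cb * 2 powr Ma * (1 / \<kappa>) powr E) * (?w n powr Ma * ?w n powr E) * ?w k powr (- D)"
        by (simp only: mult_ac)
      also have "?w n powr Ma * ?w n powr E = ?w n powr (Ma + E)" by (rule powr_add[symmetric])
      also have "(Ca * Cb * 2 powr Ma * (1 / \<kappa>) powr E) * ?w n powr (Ma + E) * ?w k powr (- D) \<le> K * ?w n powr M * H n k"
        using nn Ca Cb E0 unfolding H_def by (intro mult_mono wmono) (auto simp: K_def M_def)
      finally show ?thesis by (simp add: norm_mult)
    qed
  qed
  have dom: "(\<lambda>k. K * ?w n powr M * H n k) summable_on UNIV" for n
    by (rule summable_on_cmult_right[OF H(1)])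
  show sum: "(\<lambda>k. a (n - k) * b k) summable_on UNIV" for n
    by (rule abs_summable_summable[OF Infinite_Sum.abs_summable_on_comparison_test'[OF dom bound]])
  have "norm (\<Sum>\<^sub>\<infinity>k. a (n - k) * b k) \<le> (K * T) * ?w n powr M" for n
  proof -
    have "norm (\<Sum>\<^sub>\<infinity>k. a (n - k) * b k) \<le> (\<Sum>\<^sub>\<infinity>k. K * ?w n powr M * H n k)"
      by (rule has_sum_norm_le[OF has_sum_infsum[OF sum] bound dom])
    also have "\<dots> = K * ?w n powr M * T" unfolding infsum_cmult_right' H(2) ..
    finally show ?thesis by (simp only: mult_ac)
  qed
  moreover have "K * T \<ge> 0" "M \<ge> 0" using K0 T0 Ca E0 unfolding M_def by auto
  ultimately show "poly_bounded (\<lambda>n. \<Sum>\<^sub>\<infinity>k. a (n - k) * b k)" unfolding poly_bounded_def by blast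
qed

section \<open>Fourier series of polynomial growth and the product\<close>

lemma fourier_term_summable:
  fixes c :: "int^'d::finite \<Rightarrow> complex"
  assumes c: "poly_bounded c" and \<phi>: "\<phi> \<in> test_functions U"
  shows "fourier_term c \<phi> summable_on UNIV"
proof -
  obtain C M where C: "C \<ge> 0" "\<And>n. norm (c n) \<le> C * weight n powr M" using c unfolding poly_bounded_def by blast
  define D where "D = 2 * real CARD('d)"
  obtain C2 where C2: "C2 \<ge> 0" "\<And>\<xi>. norm (ft \<phi> \<xi>) \<le> C2 * jbracket \<xi> powr (- (M + D))"
    using ft_decay[OF \<phi>] by blast
  have "(\<lambda>n. norm (fourier_term c \<phi> n)) summable_on UNIV"
  proof (rule summable_decay_mult[where R = D and C = "C * C2"])
    fix n
    have "norm (fourier_term c \<phi> n) \<le> (C * weight n powr M) * (C2 * weight n powr (- (M + D)))"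
      unfolding fourier_term_ft norm_mult using C by (intro mult_mono C(2) C2(2)) auto
    also have "\<dots> = C * C2 * (weight n powr M * weight n powr (- (M + D)))" by (simp only: mult_ac)
    also have "weight n powr M * weight n powr (- (M + D)) = weight n powr (- D)"
      by (simp add: powr_add[symmetric])
    finally show "norm (fourier_term c \<phi> n) \<le> C * C2 * weight n powr (- D)" .
  qed (auto simp: D_def)
  then show ?thesis by (rule abs_summable_summable)
qed

definition fourier_sum :: "(int^'d::finite \<Rightarrow> complex) \<Rightarrow> 'd functional" where
  "fourier_sum c \<phi> = (\<Sum>\<^sub>\<infinity>n. fourier_term c \<phi> n)"

lemma has_fourier_series_fourier_sum:
  "poly_bounded c \<Longrightarrow> has_fourier_series (fourier_sum c) c"
  unfolding has_fourier_series_def fourier_sum_def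
  by (intro ballI has_sum_infsum fourier_term_summable)

lemma ft_add:
  "\<phi> \<in> test_functions U \<Longrightarrow> \<theta> \<in> test_functions U \<Longrightarrow> ft (\<lambda>x. \<phi> x + \<theta> x) \<xi> = ft \<phi> \<xi> + ft \<theta> \<xi>"
  unfolding ft_def distrib_left by (intro Bochner_Integration.integral_add test_integrable[OF test_expo])

lemma ft_shift:
  assumes "\<phi> \<in> test_functions U"
  shows "ft (\<lambda>x. \<phi> (x + lattice k)) (lattice n) = ft \<phi> (lattice n)"
proof -
  have [measurable]: "\<phi> \<in> borel_measurable borel" by (rule test_measurable[OF assms])
  have "ft (\<lambda>x. \<phi> (x + lattice k)) (lattice n) = (LINT x|lborel. expo (lattice n) (x + lattice k) * \<phi> (x + lattice k))"
    unfolding ft_def by (simp add: expo_lattice_periodic)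
  also have "\<dots> = ft \<phi> (lattice n)" unfolding ft_def by (rule lborel_integral_shift) measurable
  finally show ?thesis .
qed

text \<open>The order of the derivatives is chosen such that the decay that they give absorbs the growth of
  \<open>c\<close> and leaves a summable weight.\<close>

lemma fourier_sum_seminorm_bound:
  fixes c :: "int^'d::finite \<Rightarrow> complex"
  assumes c: "poly_bounded c" and K: "compact K"
  shows "\<exists>C N. \<forall>\<phi>\<in>test_functions UNIV. supp \<phi> \<subseteq> K \<longrightarrow>
        norm (fourier_sum c \<phi>) \<le> C * (\<Sum>is | length is \<le> N. SUP x. norm (partial is \<phi> x))"
proof -
  obtain C M where C: "C \<ge> 0" "\<And>n. norm (c n) \<le> C * weight n powr M" using c unfolding poly_bounded_def by blast
  define D where "D = 2 * real CARD('d)"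
  define N where "N = nat \<lceil>\<bar>M + D\<bar>\<rceil>"
  have N: "M + D \<le> 2 * real N" unfolding N_def by linarith
  obtain C2 where C2: "C2 \<ge> 0" "\<And>\<phi> \<xi>. \<phi> \<in> test_functions UNIV \<Longrightarrow> supp \<phi> \<subseteq> K \<Longrightarrow>
    (1 + (norm \<xi>)\<^sup>2) ^ N * norm (ft \<phi> \<xi>) \<le> C2 * (\<Sum>is | length is \<le> 2 * N. SUP x. norm (partial is \<phi> x))"
    using ft_seminorm_bound[OF K, of N] by blast
  have sm: "(\<lambda>n::int^'d. weight n powr (- D)) summable_on UNIV"
    by (rule summable_lattice_powr) (simp add: D_def)
  define Z where "Z = (\<Sum>\<^sub>\<infinity>n::int^'d. weight n powr (- D))"
  have "norm (fourier_sum c \<phi>) \<le> (C * C2 * Z) * (\<Sum>is | length is \<le> 2 * N. SUP x. norm (partial is \<phi> x))"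
    if \<phi>: "\<phi> \<in> test_functions UNIV" and sK: "supp \<phi> \<subseteq> K" for \<phi>
  proof -
    define T where "T = (\<Sum>is | length is \<le> 2 * N. SUP x. norm (partial is \<phi> x))"
    have le: "norm (fourier_term c \<phi> n) \<le> C * C2 * T * weight n powr (- D)" for n
    proof -
      let ?w = "weight n"
      have wt: "?w powr (2 * real N) * norm (ft \<phi> (lattice n)) \<le> C2 * T"
        using C2(2)[OF \<phi> sK, of "lattice n"] unfolding power_eq_jbracket_powr T_def .
      have "?w powr (M + D) * norm (ft \<phi> (lattice n)) \<le> ?w powr (2 * real N) * norm (ft \<phi> (lattice n))"
        using N jbracket_ge_1 by (intro mult_right_mono powr_mono) auto
      with wt have wt: "?w powr (M + D) * norm (ft \<phi> (lattice n)) \<le> C2 * T" by linarith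
      have "norm (fourier_term c \<phi> n) \<le> (C * ?w powr M) * norm (ft \<phi> (lattice n))"
        unfolding fourier_term_ft norm_mult by (intro mult_right_mono C(2)) auto
      also have "?w powr M = ?w powr (M + D) * ?w powr (- D)" by (simp add: powr_add[symmetric])
      also have "C * (?w powr (M + D) * ?w powr (- D)) * norm (ft \<phi> (lattice n))
         = (C * ?w powr (- D)) * (?w powr (M + D) * norm (ft \<phi> (lattice n)))" by (simp only: mult_ac)
      also have "\<dots> \<le> (C * ?w powr (- D)) * (C2 * T)" using C(1) by (intro mult_left_mono wt) auto
      finally show ?thesis by (simp only: mult_ac)
    qed
    have "norm (fourier_sum c \<phi>) \<le> (\<Sum>\<^sub>\<infinity>n::int^'d. C * C2 * T * weight n powr (- D))"
      unfolding fourier_sum_def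
      by (rule has_sum_norm_le[OF has_sum_infsum[OF fourier_term_summable[OF c \<phi>]] le summable_on_cmult_right[OF sm]])
    then show ?thesis unfolding infsum_cmult_right' Z_def T_def by (simp only: mult_ac)
  qed
  then show ?thesis by blast
qed

lemma fourier_sum_periodic_distribution:
  fixes c :: "int^'d::finite \<Rightarrow> complex"
  assumes c: "poly_bounded c"
  shows "fourier_sum c \<in> periodic_distributions"
proof -
  have "fourier_sum c (\<lambda>x. \<phi> x + \<theta> x) = fourier_sum c \<phi> + fourier_sum c \<theta>"
    if "\<phi> \<in> test_functions UNIV" "\<theta> \<in> test_functions UNIV" for \<phi> \<theta>
  proof -
    have "fourier_term c (\<lambda>x. \<phi> x + \<theta> x) = (\<lambda>n. fourier_term c \<phi> n + fourier_term c \<theta> n)"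
      by (rule ext) (simp add: fourier_term_ft ft_add[OF that] distrib_left)
    then show ?thesis unfolding fourier_sum_def
      by (simp add: infsum_add fourier_term_summable[OF c that(1)] fourier_term_summable[OF c that(2)])
  qed
  moreover have "fourier_sum c (\<lambda>x. z * \<phi> x) = z * fourier_sum c \<phi>" for \<phi> z
  proof -
    have "ft (\<lambda>x. z * \<phi> x) \<xi> = z * ft \<phi> \<xi>" for \<xi>
      unfolding ft_def by (simp add: mult.left_commute)
    then have "fourier_term c (\<lambda>x. z * \<phi> x) = (\<lambda>n. z * fourier_term c \<phi> n)"
      by (auto simp: fourier_term_ft)
    then show ?thesis unfolding fourier_sum_def by (simp add: infsum_cmult_right')
  qed
  moreover have "fourier_sum c (\<lambda>x. \<phi> (x + lattice k)) = fourier_sum c \<phi>" if "\<phi> \<in> test_functions UNIV" for \<phi> k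
  proof -
    have "fourier_term c (\<lambda>x. \<phi> (x + lattice k)) = fourier_term c \<phi>"
      by (rule ext) (simp add: fourier_term_ft ft_shift[OF that])
    then show ?thesis unfolding fourier_sum_def by simp
  qed
  ultimately show ?thesis
    unfolding periodic_distributions_def distribution_def using fourier_sum_seminorm_bound[OF c] by blast
qed

lemma l2_imp_poly_bounded:
  fixes c :: "int^'d::finite \<Rightarrow> complex"
  assumes "(\<lambda>n. (norm (c n))\<^sup>2 * weight n powr (2 * s)) summable_on UNIV"
  shows "poly_bounded c"
proof -
  obtain C where C: "C \<ge> 0" "\<And>n. norm (c n) \<le> C * weight n powr (- s)" using l2_pointwise[OF assms] by blast
  have "norm (c n) \<le> C * weight n powr \<bar>s\<bar>" for n
  proof -
    have "C * weight n powr (- s) \<le> C * weight n powr \<bar>s\<bar>"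
      using C(1) jbracket_ge_1 by (intro mult_left_mono powr_mono) auto
    then show ?thesis using C(2)[of n] by linarith
  qed
  then show ?thesis unfolding poly_bounded_def using C(1) by (meson abs_ge_zero)
qed

text \<open>The coefficients of \<open>\<psi> f\<close> are the convolution of \<open>c\<close> with the rapidly decreasing sequence
  \<open>ft \<psi> (lattice m)\<close>.\<close>

lemma localized_coefficients_l2:
  fixes c :: "int^'d::finite \<Rightarrow> complex"
  assumes f: "has_fourier_series f c"
    and c: "(\<lambda>n. (norm (c n))\<^sup>2 * weight n powr (2 * s)) summable_on UNIV"
    and \<psi>: "\<psi> \<in> test_functions U"
  shows "(\<lambda>k. (norm (f (\<lambda>x. \<psi> x * expo (- lattice k) x)))\<^sup>2 * weight k powr (2 * s)) summable_on UNIV"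
proof -
  define \<rho> where "\<rho> m = norm (ft \<psi> (lattice m))" for m
  define D where "D = 2 * real CARD('d)"
  obtain C where C: "C \<ge> 0" "\<And>\<xi>. norm (ft \<psi> \<xi>) \<le> C * jbracket \<xi> powr (- (D + \<bar>s\<bar>))"
    using ft_decay[OF \<psi>] by blast
  have \<rho>: "(\<lambda>m. \<rho> m * weight m powr \<bar>s\<bar>) summable_on UNIV"
  proof (rule summable_decay_mult[where R = D and C = C])
    fix m :: "int^'d"
    have "\<rho> m * weight m powr \<bar>s\<bar> \<le> C * weight m powr (- (D + \<bar>s\<bar>)) * weight m powr \<bar>s\<bar>"
      unfolding \<rho>_def by (intro mult_right_mono C(2)) auto
    also have "\<dots> = C * weight m powr (- D)" by (simp add: mult.assoc powr_add[symmetric])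
    finally show "\<rho> m * weight m powr \<bar>s\<bar> \<le> C * weight m powr (- D)" .
  qed (auto simp: \<rho>_def D_def)
  note y = young_weighted[OF _ _ \<rho> c, unfolded \<rho>_def, OF norm_ge_zero norm_ge_zero]
  show ?thesis
  proof (rule summable_on_comparison_test[OF y(2)])
    fix k :: "int^'d"
    let ?v = "f (\<lambda>x. \<psi> x * expo (- lattice k) x)"
    have "((\<lambda>n. c n * ft \<psi> (lattice n - lattice k)) has_sum ?v) UNIV" by (rule fourier_series_modulated[OF f \<psi>])
    moreover have b: "bij_betw (\<lambda>m. k + m) UNIV (UNIV :: (int^'d) set)"
      by (rule bij_betwI[of _ _ _ "\<lambda>n. n - k"]) auto
    ultimately have "((\<lambda>m. c (k + m) * ft \<psi> (lattice (k + m) - lattice k)) has_sum ?v) UNIV"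
      using has_sum_reindex_bij_betw[OF b, of "\<lambda>n. c n * ft \<psi> (lattice n - lattice k)"] by simp
    then have "norm ?v \<le> (\<Sum>\<^sub>\<infinity>m. norm (ft \<psi> (lattice m)) * norm (c (k + m)))"
      by (rule has_sum_norm_le[OF _ _ y(1)]) (simp add: lattice_add norm_mult mult.commute)
    then have "(norm ?v)\<^sup>2 \<le> (\<Sum>\<^sub>\<infinity>m. norm (ft \<psi> (lattice m)) * norm (c (k + m)))\<^sup>2" by (rule power_mono) simp
    then show "(norm ?v)\<^sup>2 * weight k powr (2 * s)
      \<le> (\<Sum>\<^sub>\<infinity>m. norm (ft \<psi> (lattice m)) * norm (c (k + m)))\<^sup>2 * weight k powr (2 * s)"
      by (rule mult_right_mono) simp
  qed simp
qed

lemma periodic_distributions_orderD: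
  assumes "f \<in> periodic_distributions_order \<tau>"
  obtains c where "distribution f" "has_fourier_series f c"
    "(\<lambda>n. (norm (c n))\<^sup>2 * weight n powr (2 * (- \<tau>))) summable_on UNIV"
  using assms unfolding periodic_distributions_order_def periodic_distributions_def by auto

lemma periodic_extension_eq_fourier_sum:
  "periodic_extension f \<psi> = fourier_sum (\<lambda>k. f (\<lambda>x. \<psi> x * expo (- lattice k) x))"
  unfolding periodic_extension_def fourier_sum_def ..

theorem theorem7:
  fixes \<tau>1 \<tau>2 s1 s2 \<eta> \<epsilon> :: real
    and f1 f2 :: "'d::finite functional"
    and \<Gamma>1 \<Gamma>2 :: "(real^'d) set"
    and x0 \<xi>0 :: "real^'d"
    and \<psi> :: "real^'d \<Rightarrow> complex"
  assumes "f1 \<in> periodic_distributions" and "f2 \<in> periodic_distributions"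
    and "f1 \<in> periodic_distributions_order \<tau>1" and "f2 \<in> periodic_distributions_order \<tau>2"
    and "pos_cone \<Gamma>1" and "pos_cone \<Gamma>2" and "\<Gamma>1 \<inter> uminus ` \<Gamma>2 = {}"
    and "\<exists>C>0. \<exists>\<gamma>\<ge>1. \<forall>n :: int^'d.
           finite {k. lattice (n - k) \<in> \<Gamma>1 \<and> lattice k \<in> \<Gamma>2} \<and>
           real (card {k. lattice (n - k) \<in> \<Gamma>1 \<and> lattice k \<in> \<Gamma>2}) \<le> C * norm (lattice n) powr \<gamma>"
    and "\<xi>0 \<noteq> 0"
    and "0 < \<eta>" and "\<eta> < 1" and "0 < \<epsilon>" and "\<epsilon> < \<eta>"
    and "\<psi> \<in> test_functions (cube \<eta> x0)" and "\<forall>x\<in>cube \<epsilon> x0. \<psi> x = 1"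
    and "snd ` WF s1 (smult_distr \<psi> f1) \<subseteq> \<Gamma>1" and "snd ` WF s2 (smult_distr \<psi> f2) \<subseteq> \<Gamma>2"
    and "s1 \<ge> \<tau>2" and "s2 \<ge> \<tau>1"
  shows "\<exists>f. distribution f \<and>
           is_product (periodic_extension f1 \<psi>) (periodic_extension f2 \<psi>) f \<and>
           f \<in> periodic_distributions"
proof -
  note \<psi> = \<open>\<psi> \<in> test_functions (cube \<eta> x0)\<close>
  have \<eta>: "\<eta> \<le> 1" using \<open>\<eta> < 1\<close> by simp
  obtain c1 where f1: "distribution f1" "has_fourier_series f1 c1"
      "(\<lambda>n. (norm (c1 n))\<^sup>2 * weight n powr (2 * (- \<tau>1))) summable_on UNIV"
    by (rule periodic_distributions_orderD[OF assms(3)])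
  obtain c2 where f2: "distribution f2" "has_fourier_series f2 c2"
      "(\<lambda>n. (norm (c2 n))\<^sup>2 * weight n powr (2 * (- \<tau>2))) summable_on UNIV"
    by (rule periodic_distributions_orderD[OF assms(4)])
  define a where "a k = f1 (\<lambda>x. \<psi> x * expo (- lattice k) x)" for k
  define b where "b k = f2 (\<lambda>x. \<psi> x * expo (- lattice k) x)" for k
  have a2: "(\<lambda>k. (norm (a k))\<^sup>2 * weight k powr (2 * (- \<tau>1))) summable_on UNIV"
    unfolding a_def by (rule localized_coefficients_l2[OF f1(2,3) \<psi>])
  have b2: "(\<lambda>k. (norm (b k))\<^sup>2 * weight k powr (2 * (- \<tau>2))) summable_on UNIV"
    unfolding b_def by (rule localized_coefficients_l2[OF f2(2,3) \<psi>])
  have pa: "poly_bounded a" by (rule l2_imp_poly_bounded[OF a2])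
  have pb: "poly_bounded b" by (rule l2_imp_poly_bounded[OF b2])
  have near: "l2_near s1 a \<xi> \<or> l2_near s2 b (- \<xi>)" if "\<xi> \<noteq> 0" for \<xi>
  proof -
    have "\<xi> \<notin> \<Gamma>1 \<or> - \<xi> \<notin> \<Gamma>2" using \<open>\<Gamma>1 \<inter> uminus ` \<Gamma>2 = {}\<close> by (metis disjoint_iff image_eqI minus_minus)
    then show ?thesis
    proof
      assume "\<xi> \<notin> \<Gamma>1"
      then have "\<xi> \<notin> snd ` WF s1 (smult_distr \<psi> f1)" using assms(16) by blast
      then have "l2_near s1 a \<xi>" unfolding a_def[abs_def]
        using l2_near_if_not_in_WF[OF f1(1,2) l2_imp_poly_bounded[OF f1(3)] \<psi> \<eta> \<open>0 < \<epsilon>\<close> assms(15) that] by blast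
      then show ?thesis ..
    next
      assume "- \<xi> \<notin> \<Gamma>2"
      then have n: "- \<xi> \<notin> snd ` WF s2 (smult_distr \<psi> f2)" using assms(17) by blast
      have "- \<xi> \<noteq> 0" using that by simp
      then have "l2_near s2 b (- \<xi>)" unfolding b_def[abs_def]
        using l2_near_if_not_in_WF[OF f2(1,2) l2_imp_poly_bounded[OF f2(3)] \<psi> \<eta> \<open>0 < \<epsilon>\<close> assms(15) _ n] by blast
      then show ?thesis ..
    qed
  qed
  define h where "h n = (\<Sum>\<^sub>\<infinity>j. a (n - j) * b j)" for n
  note conv = convolution_poly_bounded[OF a2 b2 pa pb near \<open>s1 \<ge> \<tau>2\<close> \<open>s2 \<ge> \<tau>1\<close>]
  have ph: "poly_bounded h" unfolding h_def[abs_def] by (rule conv(2))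
  have "has_fourier_series (periodic_extension f1 \<psi>) a" "has_fourier_series (periodic_extension f2 \<psi>) b"
    unfolding periodic_extension_eq_fourier_sum a_def[symmetric] b_def[symmetric]
    by (rule has_fourier_series_fourier_sum[OF pa], rule has_fourier_series_fourier_sum[OF pb])
  moreover have "has_fourier_series (fourier_sum h) (\<lambda>n. \<Sum>\<^sub>\<infinity>j. a (n - j) * b j)"
    using has_fourier_series_fourier_sum[OF ph] unfolding h_def .
  ultimately have "is_product (periodic_extension f1 \<psi>) (periodic_extension f2 \<psi>) (fourier_sum h)"
    unfolding is_product_def using conv(1) by blast
  moreover have "fourier_sum h \<in> periodic_distributions" by (rule fourier_sum_periodic_distribution[OF ph])
  moreover from this have "distribution (fourier_sum h)" unfolding periodic_distributions_def by blast
  ultimately show ?thesis by blast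
qed

end
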